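(* Let $X_0$ be a smooth, closed and locally convex planar curve. The flow $$\frac{\partial X}{\partial t}(\theta,t)=\bigl(2w_k(\theta,t)-\rho_k(\theta,t)+f(t)\bigr)N(\theta,t),\qquad X(\theta,0)=X_0(\theta),\qquad (\theta,t)\in[0,2m\pi]\times[0,T_{\max}),$$ (with $m$, $w_k$, $\rho_k$, $N$ and the nonlocal term $f(t)$ as defined in the context) has a global solution and keeps both the local convexity and the elastic energy of the evolving curve. As time goes to infinity, the curve $X(\cdot,t)$ converges smoothly to a locally convex curve of constant $k$-order width. In particular, the limiting curve is a multiple circle if and only if the initial curve $X_0$ is $k$-symmetric.
   Context: Here $k\ge2$ is an integer. A locally convex curve is a $C^2$, immersed, closed curve in the Euclidean plane whose relative curvature $\kappa$ is positive everywhere. Its winding number (also called rotation number) is $m=\frac1{2\pi}\int\kappa\,ds$, where $s$ is arc length. With $\theta$ the tangent angle, $d\theta/ds=\kappa>0$, so the curve can be parameterized by $\theta\in[0,2m\pi]$ (functions of $\theta$ being $2m\pi$-periodic); the unit tangent is $T=(\cos\theta,\sin\theta)$ and the unit normal is $N=(-\sin\theta,\cos\theta)$. The support function is $p(\theta,t)=-\langle X(\theta,t),N(\theta,t)\rangle$ and the radius of curvature is $\rho=1/\kappa$. Further, $$w_k(\theta)=\sum_{i=0}^{k-1}p\Bigl(\theta+\tfrac{2im\pi}{k}\Bigr),\qquad \rho_k(\theta)=\sum_{i=0}^{k-1}\rho\Bigl(\theta+\tfrac{2im\pi}{k}\Bigr),$$ $$f(t)=\frac{\int_0^{2m\pi}\kappa^2\,\frac{\partial^2\rho_k}{\partial\theta^2}\,d\theta-\int_0^{2m\pi}\kappa^2\rho_k\,d\theta}{\int_0^{2m\pi}\kappa^2\,d\theta},$$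 all quantities being those of the curve $X(\cdot,t)$. The function $w_k$ is the $k$-order width function; a curve is of constant $k$-order width if $w_k$ is constant. The elastic energy of a curve is $\int\kappa^2\,ds$, integrated over the whole curve. A global solution is one existing on the time interval $[0,+\infty)$. A closed plane curve with rotation number $m$ is called $k$-symmetric if it is invariant under the rotation of the angle $\frac{2m\pi}{k}$. A multiple circle is a circle traversed several times (here $m$ times). *)

theory Defs
  imports "HOL-Analysis.Analysis"
begin

text \<open>
  The Euclidean plane is the type \<^typ>\<open>complex\<close>. A closed curve is a periodic map from the reals
  together with its period.
\<close>

definition nderiv :: "nat \<Rightarrow> (real \<Rightarrow> 'a::real_normed_vector) \<Rightarrow> real \<Rightarrow> 'a" where
  "nderiv n g = ((\<lambda>h u. vector_derivative h (at u)) ^^ n) g"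

definition C_n :: "nat \<Rightarrow> (real \<Rightarrow> 'a::real_normed_vector) \<Rightarrow> bool" where
  "C_n n g \<longleftrightarrow> (\<forall>i<n. \<forall>u. nderiv i g differentiable (at u)) \<and> continuous_on UNIV (nderiv n g)"

definition smooth :: "(real \<Rightarrow> 'a::real_normed_vector) \<Rightarrow> bool" where
  "smooth g \<longleftrightarrow> (\<forall>n. C_n n g)"

definition closed_curve :: "real \<Rightarrow> (real \<Rightarrow> complex) \<Rightarrow> bool" where
  "closed_curve L g \<longleftrightarrow> L > 0 \<and> (\<forall>u. g (u + L) = g u)"

definition immersed :: "(real \<Rightarrow> complex) \<Rightarrow> bool" where
  "immersed g \<longleftrightarrow> (\<forall>u. nderiv 1 g u \<noteq> 0)"

text \<open>Relative (signed) curvature: the determinant of the first two derivatives over the cubed speed.\<close>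

definition curvature :: "(real \<Rightarrow> complex) \<Rightarrow> real \<Rightarrow> real" where
  "curvature g u =
     (Re (nderiv 1 g u) * Im (nderiv 2 g u) - Im (nderiv 1 g u) * Re (nderiv 2 g u))
       / norm (nderiv 1 g u) ^ 3"

definition locally_convex_curve :: "real \<Rightarrow> (real \<Rightarrow> complex) \<Rightarrow> bool" where
  "locally_convex_curve L g \<longleftrightarrow>
     C_n 2 g \<and> closed_curve L g \<and> immersed g \<and> (\<forall>u. curvature g u > 0)"

text \<open>Arc length is \<open>ds = norm (nderiv 1 g u) du\<close>.\<close>

definition rotation_number :: "real \<Rightarrow> (real \<Rightarrow> complex) \<Rightarrow> real" where
  "rotation_number L g = integral {0..L} (\<lambda>u. curvature g u * norm (nderiv 1 g u)) / (2 * pi)"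

definition elastic_energy :: "real \<Rightarrow> (real \<Rightarrow> complex) \<Rightarrow> real" where
  "elastic_energy L g = integral {0..L} (\<lambda>u. (curvature g u)\<^sup>2 * norm (nderiv 1 g u))"

definition tangent :: "real \<Rightarrow> complex" where
  "tangent \<theta> = Complex (cos \<theta>) (sin \<theta>)"

definition normal :: "real \<Rightarrow> complex" where
  "normal \<theta> = Complex (- sin \<theta>) (cos \<theta>)"

definition tangent_angle :: "(real \<Rightarrow> complex) \<Rightarrow> (real \<Rightarrow> real) \<Rightarrow> bool" where
  "tangent_angle g \<phi> \<longleftrightarrow> (\<forall>u. sgn (nderiv 1 g u) = tangent (\<phi> u))"

definition by_tangent_angle :: "(real \<Rightarrow> complex) \<Rightarrow> bool" where
  "by_tangent_angle Y \<longleftrightarrow> tangent_angle Y (\<lambda>\<theta>. \<theta>)"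

text \<open>
  From here on functions of \<open>\<theta>\<close> belong to a curve parametrized by its tangent angle, with period
  \<open>2 * m * pi\<close>.
\<close>

definition support :: "(real \<Rightarrow> complex) \<Rightarrow> real \<Rightarrow> real" where
  "support Y \<theta> = - inner (Y \<theta>) (normal \<theta>)"

text \<open>\<open>k_sum k m p\<close> is \<open>w_k\<close>, and \<open>k_sum k m (\<lambda>\<theta>. 1 / \<kappa> \<theta>)\<close> is \<open>\<rho>_k\<close>.\<close>

definition k_sum :: "nat \<Rightarrow> nat \<Rightarrow> (real \<Rightarrow> real) \<Rightarrow> real \<Rightarrow> real" where
  "k_sum k m h \<theta> = (\<Sum>i<k. h (\<theta> + 2 * real i * real m * pi / real k))"

definition nonlocal_term :: "nat \<Rightarrow> nat \<Rightarrow> (real \<Rightarrow> real) \<Rightarrow> real" where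
  "nonlocal_term k m \<kappa> =
     (let \<rho>k = k_sum k m (\<lambda>\<theta>. 1 / \<kappa> \<theta>); I = {0..2 * real m * pi} in
       (integral I (\<lambda>\<theta>. (\<kappa> \<theta>)\<^sup>2 * nderiv 2 \<rho>k \<theta>) - integral I (\<lambda>\<theta>. (\<kappa> \<theta>)\<^sup>2 * \<rho>k \<theta>))
         / integral I (\<lambda>\<theta>. (\<kappa> \<theta>)\<^sup>2))"

definition normal_speed :: "nat \<Rightarrow> nat \<Rightarrow> (real \<Rightarrow> real) \<Rightarrow> (real \<Rightarrow> real) \<Rightarrow> real \<Rightarrow> real" where
  "normal_speed k m p \<kappa> \<theta> =
     2 * k_sum k m p \<theta> - k_sum k m (\<lambda>\<theta>. 1 / \<kappa> \<theta>) \<theta> + nonlocal_term k m \<kappa>"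

definition constant_width :: "nat \<Rightarrow> nat \<Rightarrow> (real \<Rightarrow> complex) \<Rightarrow> bool" where
  "constant_width k m Y \<longleftrightarrow> (\<exists>c. \<forall>\<theta>. k_sum k m (support Y) \<theta> = c)"

text \<open>
  Rotation by \<open>2 * m * pi / k\<close> about some centre maps the curve to itself. The rotation adds its angle
  to the tangent angle, so invariance of the curve (not only of its image, which would be a vacuous
  condition when \<open>k\<close> divides \<open>m\<close>) is the following equation.
\<close>

definition k_symmetric :: "nat \<Rightarrow> nat \<Rightarrow> (real \<Rightarrow> complex) \<Rightarrow> bool" where
  "k_symmetric k m Y \<longleftrightarrow>
     (\<exists>c. \<forall>\<theta>. Y (\<theta> + 2 * real m * pi / real k) = c + cis (2 * real m * pi / real k) * (Y \<theta> - c))"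

text \<open>
  The circle with centre \<open>c\<close> and radius \<open>r\<close>, at tangent angle \<open>\<theta>\<close>; it is traversed \<open>m\<close> times as
  \<open>\<theta>\<close> runs through \<open>[0, 2 * m * pi]\<close>.
\<close>

definition multiple_circle :: "nat \<Rightarrow> (real \<Rightarrow> complex) \<Rightarrow> bool" where
  "multiple_circle m Y \<longleftrightarrow> (\<exists>c r. r > 0 \<and> (\<forall>\<theta>\<in>{0..2 * real m * pi}. Y \<theta> = c - r *\<^sub>R normal \<theta>))"

definition time_dom :: "ereal \<Rightarrow> real set" where
  "time_dom T = {t. 0 \<le> t \<and> ereal t < T}"

text \<open>
  A solution on \<open>[0, T)\<close> is a family of curves \<open>X t\<close> together with their tangent angles \<open>\<theta> t\<close>.
  Since a purely normal motion turns the tangent, the label \<open>u\<close> of a moving point equals its tangent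
  angle only at time 0; at time \<open>t\<close> the tangent angle is \<open>\<theta> t u\<close>, and all quantities in the
  speed are the functions of the tangent angle obtained through the inverse of \<open>\<theta> t\<close>.

  Parametrizability by the tangent angle is expressed by strict monotonicity of \<open>\<theta> t\<close>. Positivity
  of the curvature is not part of the definition.

  Regularity: every spatial derivative of \<open>X\<close> is continuous in \<open>(t, u)\<close> and continuously
  differentiable in time.
\<close>

definition flow_solution ::
  "nat \<Rightarrow> nat \<Rightarrow> (real \<Rightarrow> complex) \<Rightarrow> ereal \<Rightarrow> (real \<Rightarrow> real \<Rightarrow> complex) \<Rightarrow> (real \<Rightarrow> real \<Rightarrow> real) \<Rightarrow> bool"
where
  "flow_solution k m X0 T X \<theta> \<longleftrightarrow>
     0 < T \<and> X 0 = X0 \<and> (\<forall>u. \<theta> 0 u = u) \<and>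
     (\<forall>t\<in>time_dom T. smooth (X t) \<and> closed_curve (2 * real m * pi) (X t) \<and> immersed (X t)) \<and>
     (\<forall>t\<in>time_dom T. tangent_angle (X t) (\<theta> t) \<and> strict_mono (\<theta> t)) \<and>
     continuous_on (time_dom T \<times> UNIV) (\<lambda>(t, u). \<theta> t u) \<and>
     (\<forall>n. continuous_on (time_dom T \<times> UNIV) (\<lambda>(t, u). nderiv n (X t) u) \<and>
          (\<forall>t\<in>time_dom T. \<forall>u. (\<lambda>s. nderiv n (X s) u) differentiable (at t within time_dom T)) \<and>
          continuous_on (time_dom T \<times> UNIV)
            (\<lambda>(t, u). vector_derivative (\<lambda>s. nderiv n (X s) u) (at t within time_dom T))) \<and>
     (\<forall>t\<in>time_dom T. \<forall>u.
        ((\<lambda>s. X s u) has_vector_derivative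
           normal_speed k m (support (X t \<circ> inv (\<theta> t))) (curvature (X t) \<circ> inv (\<theta> t)) (\<theta> t u)
             *\<^sub>R normal (\<theta> t u)) (at t within time_dom T))"

text \<open>
  Convergence in \<open>C\<^sup>\<infinity>\<close> as \<open>t\<close> tends to infinity: all derivatives converge uniformly.
\<close>

definition converges_smoothly :: "(real \<Rightarrow> real \<Rightarrow> complex) \<Rightarrow> (real \<Rightarrow> complex) \<Rightarrow> bool" where
  "converges_smoothly Y Z \<longleftrightarrow>
     (\<forall>n. uniform_limit UNIV (\<lambda>t. nderiv n (Y t)) (nderiv n Z) at_top)"

end

(*
  In terms of the support function p(theta, t) the flow is the linear equation p_t = w'' - w - f with
  w = w_k. Summing over the rotations by 2 m pi / k shows that p - w / k does not depend on time, while
  w_t = k (w'' - w) - k f. Hence w / k = U + c with U_t = k (U'' - U), an exponentially decaying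
  solution of a linear heat equation, and a function c of time alone. Since f is chosen such that the
  elastic energy, the integral of 1 / (p + p''), is conserved, c(t) is the only number for which p + p''
  is positive and has the initial energy; the logarithmic divergence of that integral bounds p + p''
  away from zero. Existence follows by solving the ordinary differential equation theta_t = V' / rho
  for the tangent angle of a point with fixed label.

  Conversely, for a given solution p is differentiable in time at fixed angle by an envelope argument,
  and w - k U is constant in theta by an energy estimate, so p is the function found above as long as
  the curvature is positive. The lower bound for p + p'' lets this propagate to all times.

  The limit has support function p - w / k + const at t = 0, whose k-order width is constant. It is a
  circle if and only if rho - rho_k / k is constant at t = 0, that is, if rho has period 2 m pi / k.
*)
theory Submission
  imports Defs "HOL-Probability.Distributions"
begin

section \<open>Iterated derivatives\<close>

text \<open>Since rho_k = w_k + w_k'', the speed is w_k - w_k'' + f. It has period 2 m pi / k, which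
  is why all summands of w_k change at the same rate. The nonlinearity is thus confined to one
  function \<open>c\<close> of time. Its differential equation might lead out of the region of
  positive radii, so \<open>c\<close> is not obtained by solving it: at each time the intermediate
  value theorem yields \<open>c\<close> from the energy, and differentiability is shown afterwards.

  For a given solution the obstacle is that only strict monotonicity of the tangent angle is known.
  Where the curvature vanishes, the inverse of the angle map cannot be differentiated, and the flow
  prescribes time derivatives at fixed labels only. So the derivative at fixed angle has to be found
  with an inverse that is merely continuous, and the equations in space are first derived on a time
  interval of positive curvature.

  Space and time are kept apart throughout: families have jointly continuous spatial derivatives of
  all orders, and time derivatives are added where they are wanted.\<close>

lemma nderiv_0 [simp]: "nderiv 0 g = g"
  by (simp add: nderiv_def)

lemma nderiv_Suc: "nderiv (Suc n) g = nderiv n (nderiv 1 g)"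
  unfolding nderiv_def funpow_Suc_right by simp

lemma nderiv_1: "nderiv 1 g u = vector_derivative g (at u)"
  by (simp add: nderiv_def)

lemma nderiv_Suc': "nderiv (Suc n) g = nderiv 1 (nderiv n g)"
  by (simp add: nderiv_def)

lemma nderiv_1_eq:
  assumes "\<And>x. (g has_vector_derivative g' x) (at x)"
  shows "nderiv 1 g = g'"
  using vector_derivative_at[OF assms] by (auto simp: nderiv_1 simp del: One_nat_def)

lemma nderiv_add_index: "nderiv (i + j) g = nderiv i (nderiv j g)"
  by (simp add: nderiv_def funpow_add)

section \<open>Time-dependent functions with jointly continuous spatial derivatives\<close>

text \<open>A witness \<open>F'\<close> in place of \<open>nderiv\<close> lets closure under
  products and compositions go by induction on \<open>n\<close>, the calculus rule supplying the
  witness. Joint continuity holds up to time 0 at every order; times below 0 are left free, and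
  nothing is asked about time derivatives.\<close>

fun cdiff :: "nat \<Rightarrow> (real \<Rightarrow> real \<Rightarrow> 'a::real_normed_vector) \<Rightarrow> bool" where
  "cdiff 0 F \<longleftrightarrow> continuous_on ({0..} \<times> UNIV) (\<lambda>(t, x). F t x)"
| "cdiff (Suc n) F \<longleftrightarrow> continuous_on ({0..} \<times> UNIV) (\<lambda>(t, x). F t x) \<and>
     (\<exists>F'. (\<forall>t\<ge>0. \<forall>x. (F t has_vector_derivative F' t x) (at x)) \<and> cdiff n F')"

definition csmooth :: "(real \<Rightarrow> real \<Rightarrow> 'a::real_normed_vector) \<Rightarrow> bool" where
  "csmooth F \<longleftrightarrow> (\<forall>n. cdiff n F)"

lemma cdiff_continuous: "cdiff n F \<Longrightarrow> continuous_on ({0..} \<times> UNIV) (\<lambda>(t, x). F t x)"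
  by (cases n) auto

lemma cdiff_mono1: "cdiff (Suc n) F \<Longrightarrow> cdiff n F"
proof (induction n arbitrary: F)
  case (Suc n)
  from Suc.prems obtain F' where F': "\<forall>t\<ge>0. \<forall>x. (F t has_vector_derivative F' t x) (at x)" "cdiff (Suc n) F'"
    by (auto simp del: cdiff.simps(2) simp add: cdiff.simps(2)[of "Suc n"])
  with Suc.IH[of F'] cdiff_continuous[OF Suc.prems] show ?case by auto
qed auto

lemma cdiff_cong:
  assumes "\<And>t x. t \<ge> 0 \<Longrightarrow> F t x = G t x" "cdiff n F"
  shows "cdiff n G"
proof -
  have c: "continuous_on ({0..} \<times> UNIV) (\<lambda>(t, x). G t x)"
    using cdiff_continuous[OF assms(2)] by (rule continuous_on_eq) (auto simp: assms(1))
  show ?thesis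
  proof (cases n)
    case (Suc k)
    with assms(2) obtain F' where F': "\<forall>t\<ge>0. \<forall>x. (F t has_vector_derivative F' t x) (at x)" "cdiff k F'"
      by auto
    have "F t = G t" if "t \<ge> 0" for t using assms(1) that by auto
    with F' c Suc show ?thesis by auto
  qed (use c in simp)
qed

lemma cdiff_SucI:
  assumes "cdiff n F" "\<And>t x. t \<ge> 0 \<Longrightarrow> (F t has_vector_derivative F' t x) (at x)" "cdiff n F'"
  shows "cdiff (Suc n) F"
  using assms cdiff_continuous by auto

lemma cdiff_SucE:
  assumes "cdiff (Suc n) F"
  obtains F' where "\<And>t x. t \<ge> 0 \<Longrightarrow> (F t has_vector_derivative F' t x) (at x)" "cdiff n F'" "cdiff n F"
  using assms cdiff_mono1[OF assms] by auto

lemma cdiff_const_space: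
  assumes "continuous_on {0..} c"
  shows "cdiff n (\<lambda>t x. c t)"
proof -
  have *: "continuous_on ({0..} \<times> UNIV) (\<lambda>(t, x). c t)" if "continuous_on {0..} c"
    for c :: "real \<Rightarrow> 'a"
    unfolding case_prod_unfold
    by (rule continuous_on_compose2[OF that]) (auto intro!: continuous_intros)
  have z: "cdiff n (\<lambda>t x. 0 :: 'a)" for n
  proof (induction n)
    case 0
    then show ?case using *[of "\<lambda>t. 0"] by simp
  next
    case (Suc n)
    then show ?case by (intro cdiff_SucI[where F'="\<lambda>t x. 0"]) auto
  qed
  show ?thesis
  proof (cases n)
    case 0
    then show ?thesis using *[OF assms] by simp
  next
    case (Suc k)
    show ?thesis unfolding Suc cdiff.simps
      using *[OF assms] z[of k] by (intro conjI exI[of _ "\<lambda>t x. 0"] allI impI) simp_all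
  qed
qed

lemma cdiff_id: "cdiff n (\<lambda>t x. x)"
proof -
  have *: "continuous_on ({0..} \<times> UNIV) (\<lambda>(t::real, x::real). x)"
    unfolding case_prod_unfold by (intro continuous_intros)
  have d: "((\<lambda>x::real. x) has_vector_derivative 1) (at x)" for x
    by (auto intro!: derivative_eq_intros)
  have c: "cdiff k (\<lambda>t x. 1 :: real)" for k
    by (rule cdiff_const_space) simp
  show ?thesis
  proof (cases n)
    case 0
    then show ?thesis using * by simp
  next
    case (Suc k)
    show ?thesis unfolding Suc cdiff.simps
      by (intro conjI exI[of _ "\<lambda>t x. 1"] allI impI * d c)
  qed
qed

lemma cdiff_add:
  "cdiff n F \<Longrightarrow> cdiff n G \<Longrightarrow> cdiff n (\<lambda>t x. F t x + G t x)"
proof (induction n arbitrary: F G)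
  case 0
  then show ?case unfolding cdiff.simps case_prod_unfold by (intro continuous_intros)
next
  case (Suc n)
  obtain F' where F': "\<And>t x. t \<ge> 0 \<Longrightarrow> (F t has_vector_derivative F' t x) (at x)" "cdiff n F'" "cdiff n F"
    using cdiff_SucE[OF Suc.prems(1)] by blast
  obtain G' where G': "\<And>t x. t \<ge> 0 \<Longrightarrow> (G t has_vector_derivative G' t x) (at x)" "cdiff n G'" "cdiff n G"
    using cdiff_SucE[OF Suc.prems(2)] by blast
  show ?case
    by (rule cdiff_SucI[where F'="\<lambda>t x. F' t x + G' t x"])
      (auto intro!: Suc.IH F' G' has_vector_derivative_add)
qed

lemma cdiff_scaleR:
  fixes f :: "real \<Rightarrow> real \<Rightarrow> real"
  shows "cdiff n f \<Longrightarrow> cdiff n F \<Longrightarrow> cdiff n (\<lambda>t x. f t x *\<^sub>R F t x)"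
proof (induction n arbitrary: f F)
  case 0
  then show ?case unfolding cdiff.simps case_prod_unfold by (intro continuous_intros)
next
  case (Suc n)
  obtain f' where f': "\<And>t x. t \<ge> 0 \<Longrightarrow> (f t has_vector_derivative f' t x) (at x)" "cdiff n f'" "cdiff n f"
    using cdiff_SucE[OF Suc.prems(1)] by blast
  obtain F' where F': "\<And>t x. t \<ge> 0 \<Longrightarrow> (F t has_vector_derivative F' t x) (at x)" "cdiff n F'" "cdiff n F"
    using cdiff_SucE[OF Suc.prems(2)] by blast
  show ?case
  proof (rule cdiff_SucI[where F'="\<lambda>t x. f t x *\<^sub>R F' t x + f' t x *\<^sub>R F t x"])
    show "((\<lambda>x. f t x *\<^sub>R F t x) has_vector_derivative f t x *\<^sub>R F' t x + f' t x *\<^sub>R F t x) (at x)"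
      if "t \<ge> 0" for t x
      using f'(1)[OF that, of x] F'(1)[OF that, of x]
      by (intro has_vector_derivative_scaleR)
        (auto simp: has_real_derivative_iff_has_vector_derivative)
  qed (auto intro!: cdiff_add Suc.IH f' F')
qed

lemma cdiff_mult:
  fixes f g :: "real \<Rightarrow> real \<Rightarrow> real"
  shows "cdiff n f \<Longrightarrow> cdiff n g \<Longrightarrow> cdiff n (\<lambda>t x. f t x * g t x)"
  using cdiff_scaleR[of n f g] by simp

lemma cdiff_bounded_linear:
  assumes "bounded_linear T"
  shows "cdiff n F \<Longrightarrow> cdiff n (\<lambda>t x. T (F t x))"
proof (induction n arbitrary: F)
  case 0
  then show ?case
    unfolding cdiff.simps case_prod_unfold by (intro bounded_linear.continuous_on[OF assms])
next
  case (Suc n)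
  obtain F' where F': "\<And>t x. t \<ge> 0 \<Longrightarrow> (F t has_vector_derivative F' t x) (at x)" "cdiff n F'" "cdiff n F"
    using cdiff_SucE[OF Suc.prems(1)] by blast
  show ?case
    by (rule cdiff_SucI[where F'="\<lambda>t x. T (F' t x)"])
      (auto intro!: Suc.IH F' bounded_linear.has_vector_derivative[OF assms])
qed

lemma cdiff_compose:
  fixes \<theta> :: "real \<Rightarrow> real \<Rightarrow> real"
  shows "cdiff n F \<Longrightarrow> cdiff n \<theta> \<Longrightarrow> cdiff n (\<lambda>t x. F t (\<theta> t x))"
proof (induction n arbitrary: F)
  case 0
  have "continuous_on ({0..} \<times> UNIV) (\<lambda>z. (\<lambda>(t, x). F t x) (fst z, \<theta> (fst z) (snd z)))"
  proof (rule continuous_on_compose2[of "{0..} \<times> UNIV" "\<lambda>(t, x). F t x" _ "\<lambda>z. (fst z, \<theta> (fst z) (snd z))"])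
    show "continuous_on ({0..} \<times> UNIV) (\<lambda>(t, x). F t x)" using 0 by simp
    have "continuous_on ({0..} \<times> UNIV) (\<lambda>z. \<theta> (fst z) (snd z))"
      using 0(2) by (simp add: case_prod_unfold)
    then show "continuous_on ({0..} \<times> UNIV) (\<lambda>z. (fst z, \<theta> (fst z) (snd z)))"
      by (intro continuous_intros)
  qed auto
  then show ?case by (simp add: case_prod_unfold)
next
  case (Suc n)
  obtain F' where F': "\<And>t x. t \<ge> 0 \<Longrightarrow> (F t has_vector_derivative F' t x) (at x)" "cdiff n F'" "cdiff n F"
    using cdiff_SucE[OF Suc.prems(1)] by blast
  obtain \<theta>' where t': "\<And>t x. t \<ge> 0 \<Longrightarrow> (\<theta> t has_vector_derivative \<theta>' t x) (at x)" "cdiff n \<theta>'" "cdiff n \<theta>"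
    using cdiff_SucE[OF Suc.prems(2)] by blast
  show ?case
  proof (rule cdiff_SucI[where F'="\<lambda>t x. \<theta>' t x *\<^sub>R F' t (\<theta> t x)"])
    show "((\<lambda>x. F t (\<theta> t x)) has_vector_derivative \<theta>' t x *\<^sub>R F' t (\<theta> t x)) (at x)" if "t \<ge> 0" for t x
      using vector_diff_chain_at[OF t'(1)[OF that, of x] F'(1)[OF that, of "\<theta> t x"]] by (simp add: o_def)
  qed (auto intro!: cdiff_scaleR Suc.IH F' t')
qed

lemma cdiff_inverse:
  fixes f :: "real \<Rightarrow> real \<Rightarrow> real"
  assumes nz: "\<And>t x. t \<ge> 0 \<Longrightarrow> f t x \<noteq> 0"
  shows "cdiff n f \<Longrightarrow> cdiff n (\<lambda>t x. inverse (f t x))"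
proof (induction n)
  case 0
  then show ?case unfolding cdiff.simps case_prod_unfold by (intro continuous_intros) (auto simp: nz)
next
  case (Suc n)
  obtain f' where f': "\<And>t x. t \<ge> 0 \<Longrightarrow> (f t has_vector_derivative f' t x) (at x)" "cdiff n f'" "cdiff n f"
    using cdiff_SucE[OF Suc.prems(1)] by blast
  show ?case
  proof (rule cdiff_SucI[where F'="\<lambda>t x. (-1) * (f' t x * (inverse (f t x) * inverse (f t x)))"])
    show "((\<lambda>x. inverse (f t x)) has_vector_derivative - 1 * (f' t x * (inverse (f t x) * inverse (f t x)))) (at x)"
      if "t \<ge> 0" for t x
      using f'(1)[OF that, of x] nz[OF that, of x]
      unfolding has_real_derivative_iff_has_vector_derivative[symmetric]
      by (auto intro!: derivative_eq_intros)
  qed (intro cdiff_mult cdiff_const_space Suc.IH f' continuous_intros)+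
qed

lemma cdiff_exp:
  fixes f :: "real \<Rightarrow> real \<Rightarrow> real"
  shows "cdiff n f \<Longrightarrow> cdiff n (\<lambda>t x. exp (f t x))"
proof (induction n)
  case 0
  then show ?case unfolding cdiff.simps case_prod_unfold by (intro continuous_intros)
next
  case (Suc n)
  obtain f' where f': "\<And>t x. t \<ge> 0 \<Longrightarrow> (f t has_vector_derivative f' t x) (at x)" "cdiff n f'" "cdiff n f"
    using cdiff_SucE[OF Suc.prems(1)] by blast
  show ?case
  proof (rule cdiff_SucI[where F'="\<lambda>t x. f' t x * exp (f t x)"])
    show "((\<lambda>x. exp (f t x)) has_vector_derivative f' t x * exp (f t x)) (at x)"
      if "t \<ge> 0" for t x
      using f'(1)[OF that, of x]
      unfolding has_real_derivative_iff_has_vector_derivative[symmetric]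
      by (auto intro!: derivative_eq_intros)
  qed (intro cdiff_mult Suc.IH f')+
qed

text \<open>The substitution s = t * sigma moves the variable upper limit into the integrand, and an
  integral over a fixed interval depends continuously on its parameters.\<close>

lemma continuous_on_time_integral:
  fixes G :: "real \<Rightarrow> 'b::topological_space \<Rightarrow> 'a::euclidean_space"
  assumes G: "continuous_on ({0..} \<times> S) (\<lambda>(t, x). G t x)"
  shows "continuous_on ({0..} \<times> S) (\<lambda>(t, x). integral {0..t} (\<lambda>s. G s x))"
proof -
  have *: "integral {0..t} (\<lambda>s. G s x) = integral {0..1} (\<lambda>\<sigma>. t *\<^sub>R G (t * \<sigma>) x)"
    if "t \<ge> 0" "x \<in> S" for t x
  proof -
    have c: "continuous_on {0..t} (\<lambda>s. G s x)"
    proof -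
      have "continuous_on {0..t} (\<lambda>s. (\<lambda>(t, x). G t x) (s, x))"
        by (rule continuous_on_compose2[OF G]) (use that in \<open>auto intro!: continuous_intros\<close>)
      then show ?thesis by simp
    qed
    have "((\<lambda>\<sigma>. t *\<^sub>R (\<lambda>s. G s x) (t * \<sigma>)) has_integral integral {t*0..t*1} (\<lambda>s. G s x)) {0..1}"
      by (rule has_integral_substitution[where c=0 and d=t])
        (use that c in \<open>auto intro!: derivative_eq_intros simp: mult_left_le\<close>)
    from integral_unique[OF this] show ?thesis by (simp del: integral_cmul)
  qed
  have "continuous_on ({0..} \<times> S) (\<lambda>z. integral (cbox 0 1) (\<lambda>\<sigma>. fst z *\<^sub>R G (fst z * \<sigma>) (snd z)))"
  proof (rule integral_continuous_on_param)
    have "continuous_on (({0..} \<times> S) \<times> cbox 0 1) (\<lambda>y. fst (fst y) *\<^sub>R (\<lambda>(t, x). G t x) (fst (fst y) * snd y, snd (fst y)))"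
      by (intro continuous_intros continuous_on_compose2[OF G]) auto
    then show "continuous_on (({0..} \<times> S) \<times> cbox 0 1) (\<lambda>(z, \<sigma>). fst z *\<^sub>R G (fst z * \<sigma>) (snd z))"
      by (simp add: case_prod_unfold)
  qed
  then show ?thesis
    by (rule continuous_on_eq) (auto simp: *)
qed

lemma time_integral_has_space_derivative:
  fixes G :: "real \<Rightarrow> real \<Rightarrow> 'a::euclidean_space"
  assumes "cdiff 0 G" "cdiff 0 G'" "t \<ge> 0"
    "\<And>t x. t \<ge> 0 \<Longrightarrow> (G t has_vector_derivative G' t x) (at x)"
  shows "((\<lambda>x. integral {0..t} (\<lambda>s. G s x)) has_vector_derivative integral {0..t} (\<lambda>s. G' s x)) (at x)"
proof -
  have "((\<lambda>x. integral (cbox 0 t) (\<lambda>s. G s x)) has_vector_derivative integral (cbox 0 t) (\<lambda>s. G' s x)) (at x within UNIV)"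
  proof (rule leibniz_rule_vector_derivative)
    show "((\<lambda>x. G s x) has_vector_derivative G' s x) (at x within UNIV)" if "s \<in> cbox 0 t" for s x
      using assms(4) that by auto
    have "continuous_on (cbox 0 t) (\<lambda>s. (\<lambda>(t, x). G t x) (s, x))" for x
      by (rule continuous_on_compose2[OF assms(1)[simplified]]) (auto intro!: continuous_intros)
    then show "(\<lambda>s. G s x) integrable_on cbox 0 t" for x
      using integrable_continuous by fastforce
    have "continuous_on (UNIV \<times> cbox 0 t) (\<lambda>z. (\<lambda>(t, x). G' t x) (snd z, fst z))"
      by (rule continuous_on_compose2[OF assms(2)[simplified]]) (auto intro!: continuous_intros)
    then show "continuous_on (UNIV \<times> cbox 0 t) (\<lambda>(x, s). G' s x)"
      by (simp add: case_prod_unfold)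
  qed auto
  then show ?thesis by simp
qed

lemma cdiff_mono0: "cdiff n F \<Longrightarrow> cdiff 0 F"
  using cdiff_continuous by auto

lemma cdiff_time_integral:
  fixes G :: "real \<Rightarrow> real \<Rightarrow> 'a::euclidean_space"
  shows "cdiff n G \<Longrightarrow> cdiff n (\<lambda>t x. integral {0..t} (\<lambda>s. G s x))"
proof (induction n arbitrary: G)
  case 0
  then show ?case using continuous_on_time_integral[of UNIV G] by simp
next
  case (Suc n)
  obtain G' where G': "\<And>t x. t \<ge> 0 \<Longrightarrow> (G t has_vector_derivative G' t x) (at x)" "cdiff n G'" "cdiff n G"
    using cdiff_SucE[OF Suc.prems(1)] by blast
  show ?case
    by (rule cdiff_SucI[where F'="\<lambda>t x. integral {0..t} (\<lambda>s. G' s x)"])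
      (auto intro!: Suc.IH G' time_integral_has_space_derivative intro: cdiff_mono0 simp del: cdiff.simps)
qed

lemma time_integral_has_time_derivative:
  fixes h :: "real \<Rightarrow> 'a::banach"
  assumes "continuous_on {0..} h" "t \<ge> 0"
  shows "((\<lambda>s. integral {0..s} h) has_vector_derivative h t) (at t within {0..})"
proof -
  have "((\<lambda>s. integral {0..s} h) has_vector_derivative h t) (at t within {0..t+1})"
    using assms by (intro integral_has_vector_derivative) (auto intro: continuous_on_subset)
  moreover have "at t within {0..t+1} = at t within {0..}"
    by (rule at_within_nhd[of _ "{..<t+1}"]) (use assms in auto)
  ultimately show ?thesis by simp
qed

section \<open>Families with spatial derivatives of every order\<close>

lemma csmooth_add: "csmooth F \<Longrightarrow> csmooth G \<Longrightarrow> csmooth (\<lambda>t x. F t x + G t x)"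
  by (simp add: csmooth_def cdiff_add)

lemma csmooth_scaleR: "csmooth f \<Longrightarrow> csmooth F \<Longrightarrow> csmooth (\<lambda>t x. f t x *\<^sub>R F t x)"
  by (simp add: csmooth_def cdiff_scaleR)

lemma csmooth_mult: "csmooth f \<Longrightarrow> csmooth g \<Longrightarrow> csmooth (\<lambda>t x. f t x * g t x :: real)"
  by (simp add: csmooth_def cdiff_mult)

lemma csmooth_compose: "csmooth F \<Longrightarrow> csmooth f \<Longrightarrow> csmooth (\<lambda>t x. F t (f t x))"
  by (simp add: csmooth_def cdiff_compose)

lemma csmooth_const_space: "continuous_on {0..} c \<Longrightarrow> csmooth (\<lambda>t x. c t)"
  by (simp add: csmooth_def cdiff_const_space)

lemma csmooth_const: "csmooth (\<lambda>t x. b)"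
  by (rule csmooth_const_space) simp

lemma csmooth_id: "csmooth (\<lambda>t x. x)"
  by (simp add: csmooth_def cdiff_id)

lemma csmooth_bounded_linear:
  assumes "bounded_linear T" shows "csmooth F \<Longrightarrow> csmooth (\<lambda>t x. T (F t x))"
  using cdiff_bounded_linear[OF assms] by (auto simp: csmooth_def)

lemma csmooth_minus: "csmooth F \<Longrightarrow> csmooth (\<lambda>t x. - F t x)"
  by (rule csmooth_bounded_linear[OF bounded_linear_minus[OF bounded_linear_ident]])

lemma csmooth_diff: "csmooth F \<Longrightarrow> csmooth G \<Longrightarrow> csmooth (\<lambda>t x. F t x - G t x)"
  using csmooth_add[OF _ csmooth_minus, of F G] by simp

lemma csmooth_inverse:
  "csmooth f \<Longrightarrow> (\<And>t x. t \<ge> 0 \<Longrightarrow> f t x \<noteq> (0::real)) \<Longrightarrow> csmooth (\<lambda>t x. inverse (f t x))"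
  by (simp add: csmooth_def cdiff_inverse)

lemma csmooth_sum:
  "(\<And>i. i \<in> I \<Longrightarrow> csmooth (F i)) \<Longrightarrow> csmooth (\<lambda>t x. \<Sum>i\<in>I. F i t x)"
  by (induction I rule: infinite_finite_induct) (auto intro: csmooth_add csmooth_const)

lemma csmooth_nderiv1: "csmooth F \<Longrightarrow> csmooth (\<lambda>t. nderiv 1 (F t))"
  unfolding csmooth_def
proof
  fix n assume "\<forall>n. cdiff n F"
  then obtain F' where F': "\<And>t x. t \<ge> 0 \<Longrightarrow> (F t has_vector_derivative F' t x) (at x)" "cdiff n F'"
    using cdiff_SucE by blast
  then have "nderiv 1 (F t) = F' t" if "t \<ge> 0" for t
    using that by (intro nderiv_1_eq) auto
  then show "cdiff n (\<lambda>t. nderiv 1 (F t))"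
    using F'(2) by (auto intro: cdiff_cong)
qed

lemma csmooth_nderiv: "csmooth F \<Longrightarrow> csmooth (\<lambda>t. nderiv i (F t))"
proof (induction i)
  case (Suc i)
  then show ?case using csmooth_nderiv1 unfolding nderiv_Suc' by blast
qed simp

lemma csmooth_has_derivative1:
  assumes "csmooth F" "t \<ge> 0" shows "(F t has_vector_derivative nderiv 1 (F t) x) (at x)"
proof -
  obtain F' where F': "\<And>t x. t \<ge> 0 \<Longrightarrow> (F t has_vector_derivative F' t x) (at x)"
    using assms(1) cdiff_SucE unfolding csmooth_def by blast
  then have "nderiv 1 (F t) = F' t"
    using assms by (intro nderiv_1_eq) auto
  with F'[OF assms(2)] show ?thesis by simp
qed

lemma csmooth_has_derivative:
  assumes "csmooth F" "t \<ge> 0"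
  shows "(nderiv i (F t) has_vector_derivative nderiv (Suc i) (F t) x) (at x)"
  unfolding nderiv_Suc' using csmooth_has_derivative1[OF csmooth_nderiv[OF assms(1)] assms(2)] .

lemma csmooth_continuous:
  "csmooth F \<Longrightarrow> continuous_on ({0..} \<times> UNIV) (\<lambda>(t, x). F t x)"
  using cdiff_continuous unfolding csmooth_def by blast

lemma csmooth_continuous_time:
  assumes "csmooth F" shows "continuous_on {0..} (\<lambda>t. F t x)"
proof -
  have "continuous_on {0..} (\<lambda>t. (\<lambda>(t, x). F t x) (t, x))"
    by (rule continuous_on_compose2[OF csmooth_continuous[OF assms]]) (auto intro!: continuous_intros)
  then show ?thesis by simp
qed

lemma csmooth_smooth:
  assumes "csmooth F" "t \<ge> 0" shows "smooth (F t)"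
  unfolding smooth_def C_n_def
proof (intro allI conjI impI)
  fix n i u
  show "nderiv i (F t) differentiable at u"
    using csmooth_has_derivative[OF assms] by (rule differentiableI_vector)
  have "continuous_on UNIV (\<lambda>x. (\<lambda>(t, x). nderiv n (F t) x) (t, x))"
    by (rule continuous_on_compose2[OF csmooth_continuous[OF csmooth_nderiv[OF assms(1)]]])
      (use assms in \<open>auto intro!: continuous_intros\<close>)
  then show "continuous_on UNIV (nderiv n (F t))" by simp
qed

lemma csmooth_static:
  assumes "smooth g" shows "csmooth (\<lambda>t. g)"
proof -
  have "cdiff n (\<lambda>t. nderiv i g)" for n i
  proof (induction n arbitrary: i)
    case 0
    have "continuous_on UNIV (nderiv i g)"
      using assms by (auto simp: smooth_def C_n_def)
    then have "continuous_on ({0..} \<times> UNIV) (\<lambda>z::real\<times>real. nderiv i g (snd z))"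
      by (rule continuous_on_compose2) (auto intro!: continuous_intros)
    then show ?case by (simp add: case_prod_unfold)
  next
    case (Suc n)
    have "nderiv i g differentiable at x" for x
      using assms by (auto simp: smooth_def C_n_def)
    then have "(nderiv i g has_vector_derivative nderiv (Suc i) g x) (at x)" for x
      by (simp add: nderiv_def vector_derivative_works)
    then show ?case
      by (intro cdiff_SucI[where F'="\<lambda>t. nderiv (Suc i) g"] Suc)
  qed
  from this[of _ 0] show ?thesis by (simp add: csmooth_def)
qed

text \<open>Smooth functions are the time-independent families, so closure properties of
  \<open>csmooth\<close> carry over to \<open>smooth\<close>.\<close>

lemma smooth_iff_csmooth: "smooth g \<longleftrightarrow> csmooth (\<lambda>t. g)"
  using csmooth_static csmooth_smooth[of "\<lambda>t. g" 0] by auto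

lemma smooth_has_derivative:
  "smooth g \<Longrightarrow> (nderiv i g has_vector_derivative nderiv (Suc i) g x) (at x)"
  using csmooth_has_derivative[OF csmooth_static, of g 0] by simp

lemma smooth_nderiv: "smooth g \<Longrightarrow> smooth (nderiv i g)"
  unfolding smooth_iff_csmooth by (rule csmooth_nderiv)

lemma smooth_continuous_nderiv: "smooth g \<Longrightarrow> continuous_on S (nderiv n g)"
  by (meson C_n_def continuous_on_subset smooth_def subset_UNIV)

lemma csmooth_time_integral:
  fixes G :: "real \<Rightarrow> real \<Rightarrow> 'a::euclidean_space"
  shows "csmooth G \<Longrightarrow> csmooth (\<lambda>t x. integral {0..t} (\<lambda>s. G s x))"
  by (simp add: csmooth_def cdiff_time_integral)

lemma nderiv_time_integral:
  fixes G :: "real \<Rightarrow> real \<Rightarrow> 'a::euclidean_space"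
  assumes "csmooth G" "t \<ge> 0"
  shows "nderiv n (\<lambda>x. integral {0..t} (\<lambda>s. G s x)) = (\<lambda>x. integral {0..t} (\<lambda>s. nderiv n (G s) x))"
  using assms
proof (induction n arbitrary: G)
  case (Suc n)
  have 1: "nderiv 1 (\<lambda>x. integral {0..t} (\<lambda>s. G s x)) = (\<lambda>x. integral {0..t} (\<lambda>s. nderiv 1 (G s) x))"
  proof (rule nderiv_1_eq, rule time_integral_has_space_derivative)
    show "cdiff 0 G" "cdiff 0 (\<lambda>s. nderiv 1 (G s))"
      using Suc.prems(1) csmooth_nderiv1[OF Suc.prems(1)] by (auto simp only: csmooth_def)
    show "(G t has_vector_derivative nderiv 1 (G t) x) (at x)" if "t \<ge> 0" for t x
      using Suc.prems(1) that by (rule csmooth_has_derivative1)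
  qed (use Suc.prems in simp)
  show ?case
    unfolding nderiv_Suc[of n] 1 Suc.IH[OF csmooth_nderiv1[OF Suc.prems(1)] Suc.prems(2)] ..
qed simp

section \<open>Linearity and translation invariance of iterated derivatives\<close>

lemma nderiv_add:
  assumes "smooth f" "smooth g"
  shows "nderiv n (\<lambda>x. f x + g x) = (\<lambda>x. nderiv n f x + nderiv n g x)"
  using assms
proof (induction n arbitrary: f g)
  case (Suc n)
  have "nderiv 1 (\<lambda>x. f x + g x) = (\<lambda>x. nderiv 1 f x + nderiv 1 g x)"
    using smooth_has_derivative[OF Suc.prems(1), of 0] smooth_has_derivative[OF Suc.prems(2), of 0]
    by (intro nderiv_1_eq has_vector_derivative_add) auto
  then show ?case by (simp add: nderiv_Suc[of n] Suc.IH smooth_nderiv Suc.prems del: One_nat_def)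
qed simp

lemma nderiv_bounded_linear:
  assumes "bounded_linear T" "smooth f"
  shows "nderiv n (\<lambda>x. T (f x)) = (\<lambda>x. T (nderiv n f x))"
  using assms(2)
proof (induction n arbitrary: f)
  case (Suc n)
  have "nderiv 1 (\<lambda>x. T (f x)) = (\<lambda>x. T (nderiv 1 f x))"
    using smooth_has_derivative[OF Suc.prems(1), of 0]
    by (intro nderiv_1_eq bounded_linear.has_vector_derivative[OF assms(1)]) auto
  then show ?case by (simp add: nderiv_Suc[of n] Suc.IH smooth_nderiv Suc.prems del: One_nat_def)
qed simp

lemma nderiv_cmult: "smooth f \<Longrightarrow> nderiv n (\<lambda>x. a * f x :: real) = (\<lambda>x. a * nderiv n f x)"
  by (rule nderiv_bounded_linear) (rule bounded_linear_mult_right)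

lemma nderiv_shift: "smooth f \<Longrightarrow> nderiv n (\<lambda>x. f (x + a)) = (\<lambda>x. nderiv n f (x + a))"
proof (induction n arbitrary: f)
  case (Suc n)
  have "((\<lambda>x. f (x + a)) has_vector_derivative nderiv 1 f (x + a)) (at x)" for x
  proof -
    have "((\<lambda>x. x + a) has_vector_derivative 1) (at x)"
      by (auto intro!: derivative_eq_intros)
    from vector_diff_chain_at[OF this, of f "nderiv 1 f (x + a)"]
    show ?thesis using smooth_has_derivative[OF Suc.prems, of 0] by (simp add: o_def)
  qed
  then have "nderiv 1 (\<lambda>x. f (x + a)) = (\<lambda>x. nderiv 1 f (x + a))" by (rule nderiv_1_eq)
  then show ?case by (simp add: nderiv_Suc[of n] Suc.IH smooth_nderiv Suc.prems del: One_nat_def)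
qed simp

lemma nderiv_const: "nderiv n (\<lambda>x. c) = (\<lambda>x. if n = 0 then c else 0)"
proof (induction n arbitrary: c)
  case (Suc n)
  have "nderiv 1 (\<lambda>x::real. c) = (\<lambda>x. 0)" by (rule nderiv_1_eq) simp
  then show ?case by (auto simp add: nderiv_Suc[of n] Suc.IH simp del: One_nat_def)
qed simp

lemma smooth_add: "smooth f \<Longrightarrow> smooth g \<Longrightarrow> smooth (\<lambda>x. f x + g x)"
  unfolding smooth_iff_csmooth by (rule csmooth_add)

lemma smooth_diff: "smooth f \<Longrightarrow> smooth g \<Longrightarrow> smooth (\<lambda>x. f x - g x)"
  unfolding smooth_iff_csmooth by (rule csmooth_diff)

lemma smooth_const: "smooth (\<lambda>x. b)"
  unfolding smooth_iff_csmooth by (rule csmooth_const)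

lemma smooth_mult: "smooth f \<Longrightarrow> smooth g \<Longrightarrow> smooth (\<lambda>x. f x * g x :: real)"
  unfolding smooth_iff_csmooth by (rule csmooth_mult)

lemma smooth_sum: "(\<And>i. i \<in> I \<Longrightarrow> smooth (h i)) \<Longrightarrow> smooth (\<lambda>x. \<Sum>i\<in>I. h i x)"
  unfolding smooth_iff_csmooth by (rule csmooth_sum)

lemma smooth_shift: "smooth f \<Longrightarrow> smooth (\<lambda>x. f (x + a))"
  unfolding smooth_iff_csmooth
  using csmooth_compose[of "\<lambda>t. f" "\<lambda>t x. x + a"] by (simp add: csmooth_add csmooth_id csmooth_const)

lemma nderiv_sum:
  assumes "\<And>i. i \<in> I \<Longrightarrow> smooth (h i)"
  shows "nderiv n (\<lambda>x. \<Sum>i\<in>I. h i x) = (\<lambda>x. \<Sum>i\<in>I. nderiv n (h i) x)"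
  using assms
proof (induction I rule: infinite_finite_induct)
  case (insert i I)
  then show ?case using nderiv_add[of "h i" "\<lambda>x. \<Sum>i\<in>I. h i x"] by (simp add: smooth_sum)
qed (auto simp: nderiv_const)

lemma nderiv_diff:
  assumes "smooth f" "smooth g"
  shows "nderiv n (\<lambda>x. f x - g x) = (\<lambda>x. nderiv n f x - nderiv n g x)"
proof -
  have l: "bounded_linear (\<lambda>y. - y :: 'a)" by (rule bounded_linear_minus[OF bounded_linear_ident])
  have "smooth (\<lambda>x. - g x)"
    using assms(2) unfolding smooth_iff_csmooth by (rule csmooth_minus)
  from nderiv_add[OF assms(1) this, of n] show ?thesis
    by (simp add: nderiv_bounded_linear[OF l assms(2)])
qed

section \<open>The heat equation on the circle\<close>

lemma std_normal_density_has_derivative: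
  "(std_normal_density has_real_derivative - y * std_normal_density y) (at y)"
  unfolding std_normal_density_def [abs_def]
  by (auto intro!: derivative_eq_intros simp: field_simps)

text \<open>Crude decay that suffices to make boundary terms vanish at infinity. It follows from
  \<open>\<bar>y\<bar> \<le> 1 + y\<^sup>2 / 2 \<le> exp (y\<^sup>2 / 2)\<close>.\<close>

lemma std_normal_density_le_inverse: "std_normal_density y \<le> \<bar>inverse y\<bar>" if "y \<noteq> 0"
proof -
  have "0 \<le> (\<bar>y\<bar> - 1)\<^sup>2" by simp
  then have "\<bar>y\<bar> \<le> 1 + y\<^sup>2 / 2" unfolding power2_eq_square by (auto simp: algebra_simps abs_if split: if_splits)
  also have "\<dots> \<le> exp (y\<^sup>2 / 2)" by (rule exp_ge_add_one_self)
  finally have 1: "exp (- (y\<^sup>2 / 2)) \<le> inverse \<bar>y\<bar>"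
    unfolding exp_minus by (rule le_imp_inverse_le) (use that in simp)
  have "sqrt (2 * pi) \<ge> sqrt 1" by (rule real_sqrt_le_mono) (use pi_gt3 in simp)
  then have "std_normal_density y \<le> 1 * exp (- (y\<^sup>2 / 2))"
    unfolding std_normal_density_def by (intro mult_mono) auto
  with 1 show ?thesis by simp
qed

definition gexp :: "(real \<Rightarrow> real) \<Rightarrow> real" where
  "gexp \<psi> = (LINT y|lborel. std_normal_density y * \<psi> y)"

text \<open>Quadratic growth is allowed because the Taylor remainder with respect to the standard
  deviation is quadratic in \<open>y\<close>.\<close>

lemma gexp_integrable:
  assumes "continuous_on UNIV \<psi>" "\<And>y. \<bar>\<psi> y\<bar> \<le> A + B * \<bar>y\<bar> + C * y\<^sup>2"
  shows "integrable lborel (\<lambda>y. std_normal_density y * \<psi> y)"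
proof -
  have i: "integrable lborel (\<lambda>y. A * (std_normal_density y * \<bar>y\<bar> ^ 0) + B * (std_normal_density y * \<bar>y\<bar> ^ 1)
      + C * (std_normal_density y * \<bar>y\<bar> ^ 2))"
    by (intro Bochner_Integration.integrable_add integrable_mult_right integrable_std_normal_moment_abs)
  have m: "\<psi> \<in> borel_measurable borel" using assms(1) by (rule borel_measurable_continuous_onI)
  show ?thesis
  proof (rule Bochner_Integration.integrable_bound[OF i])
    show "(\<lambda>y. std_normal_density y * \<psi> y) \<in> borel_measurable lborel" using m by measurable
    show "AE y in lborel. norm (std_normal_density y * \<psi> y) \<le> norm (A * (std_normal_density y * \<bar>y\<bar> ^ 0) + B * (std_normal_density y * \<bar>y\<bar> ^ 1)
      + C * (std_normal_density y * \<bar>y\<bar> ^ 2))"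
    proof (rule AE_I2)
      fix y
      have "norm (std_normal_density y * \<psi> y) = std_normal_density y * \<bar>\<psi> y\<bar>"
        by (simp add: abs_mult)
      also have "\<dots> \<le> std_normal_density y * (A + B * \<bar>y\<bar> + C * y\<^sup>2)"
        by (intro mult_left_mono assms) simp
      also have "\<dots> \<le> norm \<dots>" by simp
      finally show "norm (std_normal_density y * \<psi> y) \<le> norm (A * (std_normal_density y * \<bar>y\<bar> ^ 0) + B * (std_normal_density y * \<bar>y\<bar> ^ 1)
      + C * (std_normal_density y * \<bar>y\<bar> ^ 2))" by (simp add: algebra_simps)
    qed
  qed
qed

text \<open>The coefficients 1, \<open>sqrt (2 / pi)\<close> and 1 are the absolute moments of
  orders 0, 1 and 2 of a standard normal variable.\<close>

lemma gexp_bound: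
  assumes "continuous_on UNIV \<psi>" "\<And>y. \<bar>\<psi> y\<bar> \<le> A + B * \<bar>y\<bar> + C * y\<^sup>2"
  shows "\<bar>gexp \<psi>\<bar> \<le> A + B * sqrt (2 / pi) + C"
proof -
  have 0: "has_bochner_integral lborel (\<lambda>y. std_normal_density y) 1"
    using std_normal_moment_even[of 0] by simp
  have 1: "has_bochner_integral lborel (\<lambda>y. std_normal_density y * \<bar>y\<bar>) (sqrt (2 / pi))"
    using std_normal_moment_abs_odd[of 0] by simp
  have 2: "has_bochner_integral lborel (\<lambda>y. std_normal_density y * y\<^sup>2) 1"
    using std_normal_moment_even[of 1] by simp
  have h: "has_bochner_integral lborel
      (\<lambda>y. A * std_normal_density y + B * (std_normal_density y * \<bar>y\<bar>) + C * (std_normal_density y * y\<^sup>2))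
      (A * 1 + B * sqrt (2 / pi) + C * 1)"
    by (intro has_bochner_integral_add has_bochner_integral_mult_right 0 1 2)
  have "\<bar>gexp \<psi>\<bar> \<le> (LINT y|lborel. norm (std_normal_density y * \<psi> y))"
    unfolding gexp_def real_norm_def[symmetric] by (rule integral_norm_bound)
  also have "\<dots> \<le> (LINT y|lborel. A * std_normal_density y + B * (std_normal_density y * \<bar>y\<bar>) + C * (std_normal_density y * y\<^sup>2))"
  proof (rule integral_mono)
    show "integrable lborel (\<lambda>y. norm (std_normal_density y * \<psi> y))"
      by (intro integrable_norm gexp_integrable[OF assms])
    show "integrable lborel (\<lambda>y. A * std_normal_density y + B * (std_normal_density y * \<bar>y\<bar>) + C * (std_normal_density y * y\<^sup>2))"
      using h by (simp add: has_bochner_integral_iff)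
    fix y
    have "norm (std_normal_density y * \<psi> y) = std_normal_density y * \<bar>\<psi> y\<bar>"
      by (simp add: abs_mult)
    also have "\<dots> \<le> std_normal_density y * (A + B * \<bar>y\<bar> + C * y\<^sup>2)"
      by (intro mult_left_mono assms) simp
    finally show "norm (std_normal_density y * \<psi> y) \<le> A * std_normal_density y + B * (std_normal_density y * \<bar>y\<bar>) + C * (std_normal_density y * y\<^sup>2)"
      by (simp add: algebra_simps)
  qed
  also have "\<dots> = A + B * sqrt (2 / pi) + C"
    using has_bochner_integral_integral_eq[OF h] by simp
  finally show ?thesis .
qed

text \<open>Stein's identity. The density \<open>d\<close> satisfies d' = - y d, so the difference
  of both integrands is the derivative of - d psi, which tends to zero at both ends.\<close>

lemma gaussian_integration_by_parts:
  assumes d: "\<And>y. (\<psi> has_real_derivative \<psi>' y) (at y)" and c: "continuous_on UNIV \<psi>'"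
    and b: "\<And>y. \<bar>\<psi> y\<bar> \<le> K" "\<And>y. \<bar>\<psi>' y\<bar> \<le> K'"
  shows "gexp (\<lambda>y. y * \<psi> y) = gexp \<psi>'"
proof -
  define F where "F y = - (std_normal_density y * \<psi> y)" for y
  have c0: "continuous_on UNIV \<psi>"
    using d by (meson DERIV_continuous continuous_at_imp_continuous_on)
  have K: "K \<ge> 0" using b(1)[of 0] by linarith
  have i1: "integrable lborel (\<lambda>y. std_normal_density y * (y * \<psi> y))"
  proof (rule gexp_integrable[of _ 0 K 0])
    show "\<bar>y * \<psi> y\<bar> \<le> 0 + K * \<bar>y\<bar> + 0 * y\<^sup>2" for y
      using mult_right_mono[OF b(1)[of y], of "\<bar>y\<bar>"] by (simp add: abs_mult mult.commute)
  qed (intro continuous_intros c0)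
  have i2: "integrable lborel (\<lambda>y. std_normal_density y * \<psi>' y)"
    by (rule gexp_integrable[of _ K' 0 0]) (use c b in auto)
  have F: "(F has_real_derivative std_normal_density y * (y * \<psi> y) - std_normal_density y * \<psi>' y) (at y)" for y
    unfolding F_def
    by (rule derivative_eq_intros std_normal_density_has_derivative d refl)+ (simp add: algebra_simps)
  have lim: "(F \<longlongrightarrow> 0) at_top" "(F \<longlongrightarrow> 0) at_bot"
  proof -
    have *: "norm (F y) \<le> norm (inverse y) * K" if "y \<noteq> 0" for y
      using mult_mono[OF std_normal_density_le_inverse[OF that] b(1)[of y]] K
      by (simp add: F_def abs_mult)
    have 1: "(inverse \<longlongrightarrow> (0::real)) at_top" "(inverse \<longlongrightarrow> (0::real)) at_bot"
      using tendsto_inverse_0 at_top_le_at_infinity at_bot_le_at_infinity by (blast intro: tendsto_mono)+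
    show "(F \<longlongrightarrow> 0) at_top"
      by (rule tendsto_0_le[OF 1(1), where K=K], rule eventually_mono[OF eventually_gt_at_top[of 0]], rule *) simp
    show "(F \<longlongrightarrow> 0) at_bot"
      by (rule tendsto_0_le[OF 1(2), where K=K], rule eventually_mono[OF eventually_gt_at_bot[of 0]], rule *) simp
  qed
  have "(LBINT y=-\<infinity>..\<infinity>. std_normal_density y * (y * \<psi> y) - std_normal_density y * \<psi>' y) = 0 - 0"
  proof (rule interval_integral_FTC_integrable[where F=F])
    show "(F has_vector_derivative std_normal_density y * (y * \<psi> y) - std_normal_density y * \<psi>' y) (at y)" for y
      using F by (simp add: has_real_derivative_iff_has_vector_derivative)
    show "isCont (\<lambda>y. std_normal_density y * (y * \<psi> y) - std_normal_density y * \<psi>' y) y" for y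
    proof -
      have "isCont \<psi> y" "isCont \<psi>' y" using c0 c by (auto simp: continuous_on_eq_continuous_at)
      moreover have "isCont std_normal_density y"
        using DERIV_isCont[OF std_normal_density_has_derivative] .
      ultimately show ?thesis by (intro continuous_intros)
    qed
    show "set_integrable lborel (einterval (-\<infinity>) \<infinity>) (\<lambda>y. std_normal_density y * (y * \<psi> y) - std_normal_density y * \<psi>' y)"
      using i1 i2 by (simp add: set_integrable_def)
    show "((F \<circ> real_of_ereal) \<longlongrightarrow> 0) (at_right (-\<infinity>))" "((F \<circ> real_of_ereal) \<longlongrightarrow> 0) (at_left \<infinity>)"
      using lim by (simp_all add: ereal_tendsto_simps)
  qed auto
  then have "(LINT y|lborel. std_normal_density y * (y * \<psi> y) - std_normal_density y * \<psi>' y) = 0"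
    by (simp add: interval_lebesgue_integral_def set_lebesgue_integral_def)
  then show ?thesis
    using Bochner_Integration.integral_diff[OF i1 i2] by (simp add: gexp_def)
qed

text \<open>Allows differentiation under an expectation without dominated convergence: a uniform
  Taylor estimate is averaged, and its remainder stays quadratic in \<open>h\<close>.\<close>

lemma has_derivative_of_quadratic_error:
  fixes f :: "real \<Rightarrow> real"
  assumes "\<And>h. \<bar>f (x + h) - f x - h * d\<bar> \<le> C * h\<^sup>2"
  shows "(f has_real_derivative d) (at x)"
  unfolding has_field_derivative_def has_derivative_at
proof
  show "bounded_linear ((*) d)" by (rule bounded_linear_mult_right)
  have "((\<lambda>h::real. norm h) \<longlongrightarrow> norm (0::real)) (at 0)" by (rule tendsto_norm[OF tendsto_ident_at])
  then have "((\<lambda>h::real. norm h) \<longlongrightarrow> 0) (at 0)" by simp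
  then show "(\<lambda>h. norm (f (x + h) - f x - d * h) / norm h) \<midarrow>0\<rightarrow> 0"
  proof (rule tendsto_0_le[where K=C])
    show "\<forall>\<^sub>F h in at 0. norm (norm (f (x + h) - f x - d * h) / norm h) \<le> norm (norm h) * C"
    proof (rule eventually_at_topological[THEN iffD2], intro exI[of _ UNIV] conjI ballI impI)
      fix h :: real assume "h \<noteq> 0"
      then show "norm (norm (f (x + h) - f x - d * h) / norm h) \<le> norm (norm h) * C"
        using assms[of h] by (simp add: field_simps power2_eq_square)
    qed auto
  qed
qed

section \<open>Derivative bounds and periodic functions\<close>

lemma lipschitz_of_bounded_derivative:
  fixes f :: "real \<Rightarrow> real"
  assumes "\<And>x. (f has_real_derivative f' x) (at x)" "\<And>x. \<bar>f' x\<bar> \<le> K"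
  shows "\<bar>f a - f b\<bar> \<le> K * \<bar>a - b\<bar>"
proof -
  have "norm (f a - f b) \<le> K * norm (a - b)"
    by (rule field_differentiable_bound[of UNIV]) (use assms in auto)
  then show ?thesis by simp
qed

lemma taylor1_bound:
  fixes f :: "real \<Rightarrow> real"
  assumes 1: "\<And>x. (f has_real_derivative f' x) (at x)"
    and 2: "\<And>x. (f' has_real_derivative f'' x) (at x)" "\<And>x. \<bar>f'' x\<bar> \<le> K"
  shows "\<bar>f (x + h) - f x - h * f' x\<bar> \<le> K * h\<^sup>2"
proof -
  have K: "K \<ge> 0" using 2(2)[of 0] by linarith
  \<comment> \<open>Mean value estimate for \<open>f\<close> minus its linear part; the factor 1/2
    of the sharp Taylor remainder is given up.\<close>
  have "norm ((\<lambda>y. f y - y * f' x) (x + h) - (\<lambda>y. f y - y * f' x) x) \<le> K * \<bar>h\<bar> * norm ((x + h) - x)"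
  proof (rule field_differentiable_bound[of "cball x \<bar>h\<bar>"])
    fix z assume z: "z \<in> cball x \<bar>h\<bar>"
    show "((\<lambda>y. f y - y * f' x) has_field_derivative f' z - f' x) (at z within cball x \<bar>h\<bar>)"
      by (rule has_field_derivative_at_within) (auto intro!: derivative_eq_intros 1)
    have "\<bar>f' z - f' x\<bar> \<le> K * \<bar>z - x\<bar>"
      by (rule lipschitz_of_bounded_derivative[OF 2])
    also have "\<dots> \<le> K * \<bar>h\<bar>" using z K by (intro mult_left_mono) (auto simp: dist_real_def)
    finally show "norm (f' z - f' x) \<le> K * \<bar>h\<bar>" by simp
  qed (auto simp: dist_real_def)
  then show ?thesis by (simp add: algebra_simps power2_eq_square)
qed

lemma periodic_int:
  fixes f :: "real \<Rightarrow> 'a"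
  assumes "\<And>x. f (x + P) = f x"
  shows "f (x + of_int j * P) = f x"
proof -
  have n: "f (x + real n * P) = f x" for n x
  proof (induction n)
    case (Suc n)
    then show ?case using assms(1)[of "x + real n * P"] by (simp add: algebra_simps)
  qed simp
  show ?thesis
  proof (cases "j \<ge> 0")
    case True
    then show ?thesis using n[of x "nat j"] by simp
  next
    case False
    then show ?thesis using n[of "x + of_int j * P" "nat (-j)"] by simp
  qed
qed

lemma periodic_representative:
  fixes f :: "real \<Rightarrow> 'a"
  assumes "P > 0" "\<And>x. f (x + P) = f x"
  obtains y where "y \<in> {0..P}" "f y = f x"
proof -
  let ?j = "- \<lfloor>x / P\<rfloor>"
  have "of_int \<lfloor>x / P\<rfloor> * P \<le> x" "x < (of_int \<lfloor>x / P\<rfloor> + 1) * P"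
    using assms(1) of_int_floor_le[of "x / P"] real_of_int_floor_add_one_gt[of "x / P"]
    by (simp_all only: pos_le_divide_eq pos_divide_less_eq)
  then have "x + of_int ?j * P \<in> {0..P}" by (simp add: algebra_simps)
  then show ?thesis using that periodic_int[of f P x ?j] assms(2) by blast
qed

lemma continuous_periodic_bounded:
  fixes f :: "real \<Rightarrow> real"
  assumes "continuous_on UNIV f" "P > 0" "\<And>x. f (x + P) = f x"
  obtains K where "\<And>x. \<bar>f x\<bar> \<le> K"
proof -
  have "compact (f ` {0..P})"
    using assms(1) by (intro compact_continuous_image) (auto intro: continuous_on_subset)
  then obtain K where K: "\<And>x. x \<in> {0..P} \<Longrightarrow> \<bar>f x\<bar> \<le> K"
    using compact_imp_bounded bounded_iff by (metis imageI real_norm_def)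
  have "\<bar>f x\<bar> \<le> K" for x
    using periodic_representative[OF assms(2), of f x] assms(3) K by metis
  then show ?thesis using that by blast
qed

lemma nderiv_periodic:
  assumes "smooth f" "\<And>x. f (x + P) = f x"
  shows "nderiv n f (x + P) = nderiv n f x"
proof -
  have "(\<lambda>x. f (x + P)) = f" using assms(2) by auto
  with nderiv_shift[OF assms(1), of n P] have "(\<lambda>x. nderiv n f (x + P)) = nderiv n f" by simp
  then show ?thesis by (rule fun_cong)
qed

lemma smooth_periodic_nderiv_bounded:
  fixes f :: "real \<Rightarrow> real"
  assumes "smooth f" "P > 0" "\<And>x. f (x + P) = f x"
  obtains K where "\<And>x. \<bar>nderiv n f x\<bar> \<le> K"
  using continuous_periodic_bounded[OF smooth_continuous_nderiv[OF assms(1)] assms(2) nderiv_periodic[OF assms(1) assms(3)]]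
  by blast

text \<open>The fundamental theorem with derivatives in the interior writes \<open>f\<close> as
  \<open>f 0\<close> plus the integral of \<open>f'\<close>, and this integral has the right
  one-sided derivative at 0.\<close>

lemma has_derivative_at_boundary:
  fixes f :: "real \<Rightarrow> real"
  assumes "continuous_on {0..} f" "continuous_on {0..} f'" "\<And>t. t > 0 \<Longrightarrow> (f has_real_derivative f' t) (at t)"
    and "t \<ge> 0"
  shows "(f has_real_derivative f' t) (at t within {0..})"
proof -
  have "((\<lambda>s. f 0 + integral {0..s} f') has_vector_derivative 0 + f' t) (at t within {0..})"
    using assms by (intro has_vector_derivative_add time_integral_has_time_derivative) auto
  moreover have "f 0 + integral {0..s} f' = f s" if "s \<in> {0..}" for s
  proof -
    have "(f' has_integral (f s - f 0)) {0..s}"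
      by (rule fundamental_theorem_of_calculus_interior)
        (use that assms in \<open>auto intro: continuous_on_subset simp: has_real_derivative_iff_has_vector_derivative\<close>)
    then show ?thesis by (simp add: integral_unique)
  qed
  ultimately have "(f has_vector_derivative 0 + f' t) (at t within {0..})"
    using assms(4) by (intro has_vector_derivative_transform[of t "{0..}" f]) auto
  then show ?thesis
    by (simp add: has_real_derivative_iff_has_vector_derivative)
qed

text \<open>The solution is \<open>exp (- k * t)\<close> times the mean of \<open>\<phi> (x + sqrt (2 * k * t) * y)\<close> over a standard
  normal variable \<open>y\<close>. Integration by parts cancels the singular factor \<open>1 / sqrt t\<close> of the time
  derivative, so the equation extends to \<open>t = 0\<close>.\<close>

lemma heat_solution_exists:
  fixes \<phi> :: "real \<Rightarrow> real"
  assumes \<phi>: "smooth \<phi>" and P: "P > 0" "\<And>x. \<phi> (x + P) = \<phi> x" and k: "k > 0"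
  shows "\<exists>U. csmooth U \<and> U 0 = \<phi> \<and> (\<forall>t x. U t (x + P) = U t x)
    \<and> (\<forall>n. \<forall>t\<ge>0. \<forall>x. ((\<lambda>s. nderiv n (U s) x) has_real_derivative
          k * (nderiv (n + 2) (U t) x - nderiv n (U t) x)) (at t within {0..}))
    \<and> (\<forall>n. \<exists>C. \<forall>t\<ge>0. \<forall>x. \<bar>nderiv n (U t) x\<bar> \<le> C * exp (- k * t))"
proof -
  obtain K where K: "\<And>n x. \<bar>nderiv n \<phi> x\<bar> \<le> K n"
  proof -
    have "\<forall>n. \<exists>K. \<forall>x. \<bar>nderiv n \<phi> x\<bar> \<le> K"
      using smooth_periodic_nderiv_bounded[OF \<phi> P] by meson
    then show ?thesis using that by metis
  qed
  have d: "(nderiv n \<phi> has_real_derivative nderiv (Suc n) \<phi> x) (at x)" for n x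
    using smooth_has_derivative[OF \<phi>] by (simp add: has_real_derivative_iff_has_vector_derivative)
  have c: "continuous_on S (\<lambda>y. nderiv n \<phi> (x + \<sigma> * y))" for S n x \<sigma>
    by (rule continuous_on_compose2[OF smooth_continuous_nderiv[OF \<phi>, of UNIV n]]) (auto intro!: continuous_intros)
  have K0: "K n \<ge> 0" for n using K[of n 0] by linarith
  \<comment> \<open>The standard deviation \<open>\<sigma>\<close> is used as variable in place of
    time, because the mean is differentiable in it at 0 as well. \<open>G\<close> is the formal
    derivative in \<open>\<sigma>\<close>.\<close>
  define H where "H n \<sigma> x = gexp (\<lambda>y. nderiv n \<phi> (x + \<sigma> * y))" for n \<sigma> x
  define G where "G n \<sigma> x = gexp (\<lambda>y. y * nderiv (Suc n) \<phi> (x + \<sigma> * y))" for n \<sigma> x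
  have iH: "integrable lborel (\<lambda>y. std_normal_density y * nderiv n \<phi> (x + \<sigma> * y))" for n x \<sigma>
    by (rule gexp_integrable[of _ "K n" 0 0]) (use c K in auto)
  have iG: "integrable lborel (\<lambda>y. std_normal_density y * (y * nderiv n \<phi> (x + \<sigma> * y)))" for n x \<sigma>
  proof (rule gexp_integrable[of _ 0 "K n" 0])
    show "\<bar>y * nderiv n \<phi> (x + \<sigma> * y)\<bar> \<le> 0 + K n * \<bar>y\<bar> + 0 * y\<^sup>2" for y
      using mult_right_mono[OF K[of n "x + \<sigma> * y"], of "\<bar>y\<bar>"] by (simp add: abs_mult mult.commute)
  qed (intro continuous_intros c)
  have H_bound: "\<bar>H n \<sigma> x\<bar> \<le> K n" for n \<sigma> x
    using gexp_bound[of "\<lambda>y. nderiv n \<phi> (x + \<sigma> * y)" "K n" 0 0] c K by (simp add: H_def)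
  \<comment> \<open>A joint Lipschitz estimate, from which joint continuity follows including the
    initial time.\<close>
  have H_lip: "\<bar>H n \<sigma> x - H n \<tau> z\<bar> \<le> K (Suc n) * \<bar>x - z\<bar> + K (Suc n) * \<bar>\<sigma> - \<tau>\<bar> * sqrt (2 / pi)" for n \<sigma> x \<tau> z
  proof -
    have "H n \<sigma> x - H n \<tau> z = gexp (\<lambda>y. nderiv n \<phi> (x + \<sigma> * y) - nderiv n \<phi> (z + \<tau> * y))"
      using Bochner_Integration.integral_diff[OF iH[of n x \<sigma>] iH[of n z \<tau>]]
      by (simp add: H_def gexp_def right_diff_distrib)
    also have "\<bar>\<dots>\<bar> \<le> K (Suc n) * \<bar>x - z\<bar> + K (Suc n) * \<bar>\<sigma> - \<tau>\<bar> * sqrt (2 / pi) + 0"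
    proof (rule gexp_bound)
      show "continuous_on UNIV (\<lambda>y. nderiv n \<phi> (x + \<sigma> * y) - nderiv n \<phi> (z + \<tau> * y))"
        by (intro continuous_intros c)
      fix y
      have "\<bar>nderiv n \<phi> (x + \<sigma> * y) - nderiv n \<phi> (z + \<tau> * y)\<bar> \<le> K (Suc n) * \<bar>(x + \<sigma> * y) - (z + \<tau> * y)\<bar>"
        by (rule lipschitz_of_bounded_derivative[OF d K])
      also have "\<dots> = K (Suc n) * \<bar>(x - z) + (\<sigma> - \<tau>) * y\<bar>" by (simp add: algebra_simps)
      also have "\<dots> \<le> K (Suc n) * (\<bar>x - z\<bar> + \<bar>(\<sigma> - \<tau>) * y\<bar>)"
        by (intro mult_left_mono K0 abs_triangle_ineq)
      finally show "\<bar>nderiv n \<phi> (x + \<sigma> * y) - nderiv n \<phi> (z + \<tau> * y)\<bar>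
          \<le> K (Suc n) * \<bar>x - z\<bar> + K (Suc n) * \<bar>\<sigma> - \<tau>\<bar> * \<bar>y\<bar> + 0 * y\<^sup>2"
        by (simp only: abs_mult distrib_left mult.assoc mult_zero_left add_0_right)
    qed
    finally show ?thesis by simp
  qed
  have H_x: "(H n \<sigma> has_real_derivative H (Suc n) \<sigma> x) (at x)" for n \<sigma> x
  proof (rule has_derivative_of_quadratic_error)
    fix h
    have "H n \<sigma> (x + h) - H n \<sigma> x - h * H (Suc n) \<sigma> x =
      gexp (\<lambda>y. nderiv n \<phi> ((x + \<sigma> * y) + h) - nderiv n \<phi> (x + \<sigma> * y) - h * nderiv (Suc n) \<phi> (x + \<sigma> * y))"
    proof -
      have "gexp (\<lambda>y. nderiv n \<phi> ((x + \<sigma> * y) + h) - nderiv n \<phi> (x + \<sigma> * y) - h * nderiv (Suc n) \<phi> (x + \<sigma> * y))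
        = (LINT y|lborel. std_normal_density y * nderiv n \<phi> ((x + h) + \<sigma> * y) - std_normal_density y * nderiv n \<phi> (x + \<sigma> * y)
             - h * (std_normal_density y * nderiv (Suc n) \<phi> (x + \<sigma> * y)))"
        unfolding gexp_def by (intro Bochner_Integration.integral_cong) (auto simp: algebra_simps)
      also have "\<dots> = H n \<sigma> (x + h) - H n \<sigma> x - h * H (Suc n) \<sigma> x"
        using iH by (simp add: H_def gexp_def)
      finally show ?thesis ..
    qed
    also have "\<bar>\<dots>\<bar> \<le> K (Suc (Suc n)) * h\<^sup>2 + 0 * sqrt (2 / pi) + 0"
    proof (rule gexp_bound)
      show "continuous_on UNIV (\<lambda>y. nderiv n \<phi> ((x + \<sigma> * y) + h) - nderiv n \<phi> (x + \<sigma> * y) - h * nderiv (Suc n) \<phi> (x + \<sigma> * y))"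
        using c[of UNIV n "x + h" \<sigma>] by (intro continuous_intros c) (simp add: algebra_simps)
      fix y show "\<bar>nderiv n \<phi> ((x + \<sigma> * y) + h) - nderiv n \<phi> (x + \<sigma> * y) - h * nderiv (Suc n) \<phi> (x + \<sigma> * y)\<bar>
          \<le> K (Suc (Suc n)) * h\<^sup>2 + 0 * \<bar>y\<bar> + 0 * y\<^sup>2"
        using taylor1_bound[OF d d K] by simp
    qed
    finally show "\<bar>H n \<sigma> (x + h) - H n \<sigma> x - h * H (Suc n) \<sigma> x\<bar> \<le> K (Suc (Suc n)) * h\<^sup>2" by simp
  qed
  have H_\<sigma>: "((\<lambda>\<sigma>. H n \<sigma> x) has_real_derivative G n \<sigma> x) (at \<sigma>)" for n \<sigma> x
  proof (rule has_derivative_of_quadratic_error)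
    fix h
    have "H n (\<sigma> + h) x - H n \<sigma> x - h * G n \<sigma> x =
      gexp (\<lambda>y. nderiv n \<phi> ((x + \<sigma> * y) + h * y) - nderiv n \<phi> (x + \<sigma> * y) - h * y * nderiv (Suc n) \<phi> (x + \<sigma> * y))"
    proof -
      have "gexp (\<lambda>y. nderiv n \<phi> ((x + \<sigma> * y) + h * y) - nderiv n \<phi> (x + \<sigma> * y) - h * y * nderiv (Suc n) \<phi> (x + \<sigma> * y))
        = (LINT y|lborel. std_normal_density y * nderiv n \<phi> (x + (\<sigma> + h) * y) - std_normal_density y * nderiv n \<phi> (x + \<sigma> * y)
             - h * (std_normal_density y * (y * nderiv (Suc n) \<phi> (x + \<sigma> * y))))"
        unfolding gexp_def by (intro Bochner_Integration.integral_cong) (auto simp: algebra_simps)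
      also have "\<dots> = H n (\<sigma> + h) x - H n \<sigma> x - h * G n \<sigma> x"
        using iH iG by (simp add: H_def G_def gexp_def)
      finally show ?thesis ..
    qed
    also have "\<bar>\<dots>\<bar> \<le> 0 + 0 * sqrt (2 / pi) + K (Suc (Suc n)) * h\<^sup>2"
    proof (rule gexp_bound)
      show "continuous_on UNIV (\<lambda>y. nderiv n \<phi> ((x + \<sigma> * y) + h * y) - nderiv n \<phi> (x + \<sigma> * y) - h * y * nderiv (Suc n) \<phi> (x + \<sigma> * y))"
        using c[of UNIV n "x" "\<sigma> + h"] by (intro continuous_intros c) (simp add: algebra_simps)
      fix y show "\<bar>nderiv n \<phi> ((x + \<sigma> * y) + h * y) - nderiv n \<phi> (x + \<sigma> * y) - h * y * nderiv (Suc n) \<phi> (x + \<sigma> * y)\<bar>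
          \<le> 0 + 0 * \<bar>y\<bar> + K (Suc (Suc n)) * h\<^sup>2 * y\<^sup>2"
        using taylor1_bound[OF d d K, of n "x + \<sigma> * y" "h * y"] by (simp add: power_mult_distrib mult.assoc)
    qed
    finally show "\<bar>H n (\<sigma> + h) x - H n \<sigma> x - h * G n \<sigma> x\<bar> \<le> K (Suc (Suc n)) * h\<^sup>2" by simp
  qed
  have G_eq: "G n \<sigma> x = \<sigma> * H (Suc (Suc n)) \<sigma> x" for n \<sigma> x
  proof -
    have "G n \<sigma> x = gexp (\<lambda>y. \<sigma> * nderiv (Suc (Suc n)) \<phi> (x + \<sigma> * y))"
      unfolding G_def
    proof (rule gaussian_integration_by_parts)
      show "((\<lambda>y. nderiv (Suc n) \<phi> (x + \<sigma> * y)) has_real_derivative \<sigma> * nderiv (Suc (Suc n)) \<phi> (x + \<sigma> * y)) (at y)" for y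
      proof -
        have "((\<lambda>y. x + \<sigma> * y) has_real_derivative \<sigma>) (at y)" by (auto intro!: derivative_eq_intros)
        from DERIV_chain2[OF d this] show ?thesis by (simp add: mult.commute)
      qed
      show "continuous_on UNIV (\<lambda>y. \<sigma> * nderiv (Suc (Suc n)) \<phi> (x + \<sigma> * y))" by (intro continuous_intros c)
      show "\<bar>nderiv (Suc n) \<phi> (x + \<sigma> * y)\<bar> \<le> K (Suc n)" for y by (rule K)
      show "\<bar>\<sigma> * nderiv (Suc (Suc n)) \<phi> (x + \<sigma> * y)\<bar> \<le> \<bar>\<sigma>\<bar> * K (Suc (Suc n))" for y
        unfolding abs_mult by (intro mult_left_mono K) simp
    qed
    also have "\<dots> = \<sigma> * H (Suc (Suc n)) \<sigma> x"
      unfolding H_def gexp_def by (simp add: mult.left_commute)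
    finally show ?thesis .
  qed
  \<comment> \<open>Variance 2 k t produces the equation v_t = k v''. The factor
    \<open>exp (- k * t)\<close> accounts for the term - k v and, as \<open>H\<close> is bounded,
    gives the exponential decay at once.\<close>
  define W where "W n t x = exp (- k * t) * H n (sqrt (2 * k * t)) x" for n t x
  have W_x: "(W n t has_vector_derivative W (Suc n) t x) (at x)" for n t x
    unfolding has_real_derivative_iff_has_vector_derivative[symmetric] W_def
    by (auto intro!: derivative_eq_intros H_x)
  have Hcont: "continuous_on UNIV (\<lambda>z. H n (fst z) (snd z))" for n
  proof (rule continuous_at_imp_continuous_on, rule ballI)
    fix z :: "real \<times> real"
    have "((\<lambda>w. K (Suc n) * \<bar>snd w - snd z\<bar> + K (Suc n) * \<bar>fst w - fst z\<bar> * sqrt (2 / pi))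
        \<longlongrightarrow> K (Suc n) * \<bar>snd z - snd z\<bar> + K (Suc n) * \<bar>fst z - fst z\<bar> * sqrt (2 / pi)) (at z)"
      by (intro tendsto_intros)
    then have "((\<lambda>w. K (Suc n) * \<bar>snd w - snd z\<bar> + K (Suc n) * \<bar>fst w - fst z\<bar> * sqrt (2 / pi)) \<longlongrightarrow> 0) (at z)"
      by simp
    then have "((\<lambda>w. H n (fst w) (snd w) - H n (fst z) (snd z)) \<longlongrightarrow> 0) (at z)"
      by (rule Lim_null_comparison[rotated]) (use H_lip in simp)
    then show "isCont (\<lambda>z. H n (fst z) (snd z)) z"
      unfolding isCont_def by (rule LIM_zero_cancel)
  qed
  have W_cont: "continuous_on UNIV (\<lambda>(t, x). W n t x)" for n
    unfolding W_def case_prod_unfold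
    by (intro continuous_intros continuous_on_compose2[OF Hcont, of _ "\<lambda>z. (sqrt (2 * k * fst z), snd z)", simplified])
  have "cdiff j (W n)" for j n
  proof (induction j arbitrary: n)
    case 0
    then show ?case using continuous_on_subset[OF W_cont] by simp
  next
    case (Suc j)
    then show ?case using W_x by (intro cdiff_SucI[where F'="W (Suc n)"])
  qed
  then have sm: "csmooth (W 0)" by (simp add: csmooth_def)
  have nd: "nderiv n (W 0 t) = W n t" for n t
  proof (induction n)
    case (Suc n)
    have "nderiv 1 (W n t) = W (Suc n) t" by (rule nderiv_1_eq) (rule W_x)
    with Suc show ?case by (simp add: nderiv_Suc' del: One_nat_def)
  qed simp
  have W_t: "((\<lambda>s. W n s x) has_real_derivative k * (W (n + 2) t x - W n t x)) (at t within {0..})" if "t \<ge> 0" for n t x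
  proof -
    have Wc: "continuous_on S (\<lambda>s. W n s x)" for n S
    proof -
      have "continuous_on S (\<lambda>s. (\<lambda>(t, x). W n t x) (s, x))"
        by (rule continuous_on_compose2[OF W_cont]) (auto intro!: continuous_intros)
      then show ?thesis by simp
    qed
    show ?thesis
    proof (rule has_derivative_at_boundary[OF Wc _ _ that])
      show "continuous_on {0..} (\<lambda>t. k * (W (n + 2) t x - W n t x))"
        by (intro continuous_intros Wc)
      fix t :: real assume t: "t > 0"
      have s: "((\<lambda>t. sqrt (2 * k * t)) has_real_derivative k / sqrt (2 * k * t)) (at t)"
      proof -
        have p: "2 * k * t > 0" using t k by simp
        have "((\<lambda>t. 2 * k * t) has_real_derivative 2 * k) (at t)" by (auto intro!: derivative_eq_intros)
        from DERIV_chain2[OF DERIV_real_sqrt[OF p] this]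
        have "((\<lambda>t. sqrt (2 * k * t)) has_real_derivative inverse (sqrt (2 * k * t)) / 2 * (2 * k)) (at t)" .
        moreover have "inverse z / 2 * (2 * k) = k / z" for z :: real by (cases "z = 0") (auto simp: field_simps)
        ultimately show ?thesis by (simp only:)
      qed
      have "((\<lambda>t. H n (sqrt (2 * k * t)) x) has_real_derivative G n (sqrt (2 * k * t)) x * (k / sqrt (2 * k * t))) (at t)"
        by (rule DERIV_chain2[OF H_\<sigma> s])
      then have h: "((\<lambda>t. H n (sqrt (2 * k * t)) x) has_real_derivative k * H (n + 2) (sqrt (2 * k * t)) x) (at t)"
        using t k by (simp add: G_eq mult.commute)
      show "((\<lambda>s. W n s x) has_real_derivative k * (W (n + 2) t x - W n t x)) (at t)"
        unfolding W_def by (rule derivative_eq_intros h refl)+ (simp add: algebra_simps)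
    qed
  qed
  show ?thesis
  proof (intro exI[of _ "W 0"] conjI allI impI)
    show "csmooth (W 0)" by (rule sm)
    show "W 0 0 = \<phi>"
    proof
      fix x
      have "has_bochner_integral lborel (\<lambda>y. std_normal_density y) 1"
        using std_normal_moment_even[of 0] by simp
      then show "W 0 0 x = \<phi> x"
        using has_bochner_integral_integral_eq by (auto simp: W_def H_def gexp_def)
    qed
    show "W 0 t (x + P) = W 0 t x" for t x
    proof -
      have "\<phi> (x + P + z) = \<phi> (x + z)" for z
        using P(2)[of "x + z"] by (simp add: add.assoc add.commute[of P])
      then show ?thesis by (simp add: W_def H_def)
    qed
    show "((\<lambda>s. nderiv n (W 0 s) x) has_real_derivative k * (nderiv (n + 2) (W 0 t) x - nderiv n (W 0 t) x)) (at t within {0..})"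
      if "0 \<le> t" for n t x
      using W_t[OF that] by (simp only: nd)
    show "\<exists>C. \<forall>t\<ge>0. \<forall>x. \<bar>nderiv n (W 0 t) x\<bar> \<le> C * exp (- k * t)" for n
      using H_bound by (intro exI[of _ "K n"]) (simp add: nd W_def abs_mult mult.commute)
  qed
qed

lemma integral_periodic:
  fixes f :: "real \<Rightarrow> real"
  assumes f: "continuous_on UNIV f" and P: "P > 0" "\<And>x. f (x + P) = f x"
  shows "integral {a..a + P} f = integral {0..P} f"
proof -
  have i: "f integrable_on {x..y}" for x y
    by (intro integrable_continuous_real continuous_on_subset[OF f]) auto
  have sh: "integral {x + P..y + P} f = integral {x..y} f" for x y
    using integral_shift_real_ivl[of "x + P" P "y + P" f] by (simp add: P(2))
  have c: "integral {x..y} f + integral {y..z} f = integral {x..z} f" if "x \<le> y" "y \<le> z" for x y z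
    using that by (intro Henstock_Kurzweil_Integration.integral_combine i)
  show ?thesis
  proof (cases "a \<ge> 0")
    case True
    then show ?thesis using c[of 0 a "a + P"] c[of 0 P "a + P"] sh[of 0 a] P(1) by simp
  next
    case False
    then show ?thesis using c[of a 0 P] c[of a "a + P" P] sh[of a 0] P(1) by simp
  qed
qed

lemma integral_positive:
  fixes f :: "real \<Rightarrow> real"
  assumes "continuous_on {0..P} f" "P > 0" "\<And>x. x \<in> {0..P} \<Longrightarrow> f x > 0"
  shows "integral {0..P} f > 0"
  using integral_less_real[of 0 P "\<lambda>_. 0" f] assms by auto

lemma continuous_on_space_integral:
  fixes f :: "'a::topological_space \<Rightarrow> real \<Rightarrow> real"
  assumes "continuous_on (S \<times> {0..P}) (\<lambda>(t, x). f t x)"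
  shows "continuous_on S (\<lambda>t. integral {0..P} (f t))"
  using integral_continuous_on_param[of S 0 P f] assms by simp

section \<open>Translating a function to prescribed mean of its reciprocal\<close>

text \<open>Near \<open>x0\<close> the function is at most \<open>r x0 + M * \<bar>x - x0\<bar>\<close>, whose reciprocal integrates to a
  logarithm that diverges as \<open>r x0\<close> tends to zero.\<close>

lemma lower_bound_from_reciprocal_integral:
  fixes r :: "real \<Rightarrow> real"
  assumes L: "L > 0" and M: "M > 0" and lip: "\<And>x y. \<bar>r x - r y\<bar> \<le> M * \<bar>x - y\<bar>"
    and per: "\<And>x. r (x + L) = r x" and pos: "\<And>x. r x > 0"
    and E: "integral {0..L} (\<lambda>x. 1 / r x) \<le> E"
  shows "M * L \<le> r x0 * (exp (M * E) - 1)"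
proof -
  have c: "continuous_on S r" for S
  proof (rule continuous_on_subset[of UNIV], rule continuous_at_imp_continuous_on, rule ballI)
    fix x
    have "((\<lambda>y. M * \<bar>y - x\<bar>) \<longlongrightarrow> M * \<bar>x - x\<bar>) (at x)" by (intro tendsto_intros)
    then have "((\<lambda>y. M * \<bar>y - x\<bar>) \<longlongrightarrow> 0) (at x)" by simp
    then have "((\<lambda>y. r y - r x) \<longlongrightarrow> 0) (at x)"
      by (rule Lim_null_comparison[rotated]) (use lip in simp)
    then show "isCont r x" unfolding isCont_def by (rule LIM_zero_cancel)
  qed simp
  have c': "continuous_on S (\<lambda>x. 1 / r x)" for S
    using pos by (intro continuous_intros c) (auto simp: less_imp_neq[THEN not_sym])
  have "((\<lambda>x. 1 / (r x0 + M * (x - x0))) has_integral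
      (ln (r x0 + M * (x0 + L - x0)) / M - ln (r x0 + M * (x0 - x0)) / M)) {x0..x0+L}"
  proof (rule fundamental_theorem_of_calculus)
    fix x assume x: "x \<in> {x0..x0 + L}"
    have p: "r x0 + M * (x - x0) > 0" using pos[of x0] M x by (auto intro: add_pos_nonneg)
    have "((\<lambda>x. r x0 + M * (x - x0)) has_real_derivative M) (at x)"
      by (auto intro!: derivative_eq_intros)
    from DERIV_cdivide[OF DERIV_chain2[OF DERIV_ln_divide[OF p] this], of M]
    have "((\<lambda>x. ln (r x0 + M * (x - x0)) / M) has_real_derivative 1 / (r x0 + M * (x - x0))) (at x)"
      using M by simp
    then have "((\<lambda>x. ln (r x0 + M * (x - x0)) / M) has_real_derivative 1 / (r x0 + M * (x - x0))) (at x within {x0..x0+L})"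
      by (rule has_field_derivative_at_within)
    then show "((\<lambda>x. ln (r x0 + M * (x - x0)) / M) has_vector_derivative 1 / (r x0 + M * (x - x0))) (at x within {x0..x0+L})"
      by (simp add: has_real_derivative_iff_has_vector_derivative)
  qed (use L in simp)
  then have h: "((\<lambda>x. 1 / (r x0 + M * (x - x0))) has_integral
      (ln (r x0 + M * L) / M - ln (r x0) / M)) {x0..x0+L}" by simp
  have "ln (r x0 + M * L) / M - ln (r x0) / M \<le> integral {x0..x0+L} (\<lambda>x. 1 / r x)"
  proof (rule has_integral_le[OF h])
    show "((\<lambda>x. 1 / r x) has_integral integral {x0..x0+L} (\<lambda>x. 1 / r x)) {x0..x0+L}"
      by (intro integrable_integral integrable_continuous_real c')
    fix x assume x: "x \<in> {x0..x0+L}"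
    have "r x \<le> r x0 + M * (x - x0)" using lip[of x x0] x by (auto simp: abs_if split: if_splits)
    then show "1 / (r x0 + M * (x - x0)) \<le> 1 / r x"
      using pos[of x] by (intro divide_left_mono) (auto intro: mult_pos_pos)
  qed
  also have "\<dots> = integral {0..L} (\<lambda>x. 1 / r x)"
    by (rule integral_periodic[OF c' L]) (simp add: per)
  also have "\<dots> \<le> E" by (rule E)
  finally have "ln (r x0 + M * L) - ln (r x0) \<le> M * E" using M by (simp add: field_simps)
  then have "ln ((r x0 + M * L) / r x0) \<le> M * E"
    using ln_divide_pos[of "r x0 + M * L" "r x0"] pos[of x0] mult_pos_pos[OF M L] by simp
  then have "exp (ln ((r x0 + M * L) / r x0)) \<le> exp (M * E)" by simp
  then have "(r x0 + M * L) / r x0 \<le> exp (M * E)"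
    using pos[of x0] mult_pos_pos[OF M L] by (subst (asm) exp_ln) auto
  then show ?thesis using pos[of x0] by (simp add: field_simps)
qed

text \<open>Intermediate value theorem for the integral as a function of \<open>c\<close>. If the
  minimum of g + c is \<open>L / E\<close>, the integrand is at most \<open>E / L\<close>; if the
  minimum is the small number \<open>\<delta>\<close>, the logarithmic lower bound makes the
  integral at least \<open>E\<close>.\<close>

lemma translation_exists:
  fixes g :: "real \<Rightarrow> real"
  assumes L: "L > 0" and M: "M > 0" and lip: "\<And>x y. \<bar>g x - g y\<bar> \<le> M * \<bar>x - y\<bar>"
    and c: "continuous_on UNIV g"
    and per: "\<And>x. g (x + L) = g x" and E: "E > 0"
  shows "\<exists>c. (\<forall>x. g x + c > 0) \<and> integral {0..L} (\<lambda>x. 1 / (g x + c)) = E"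
proof -
  have "compact {0..L}" "{0..L} \<noteq> {}" using L by auto
  then obtain x0 where x0: "x0 \<in> {0..L}" "\<And>x. x \<in> {0..L} \<Longrightarrow> g x0 \<le> g x"
    using continuous_attains_inf[OF _ _ continuous_on_subset[OF c]] by (metis subset_UNIV)
  have min: "g x0 \<le> g x" for x
    using periodic_representative[OF L, of g x] per x0 by metis
  \<comment> \<open>The value of the minimum for which
    \<open>lower_bound_from_reciprocal_integral\<close> forces the integral to be at least
    \<open>E\<close>.\<close>
  define \<delta> where "\<delta> = M * L / (exp (M * E) - 1)"
  have e: "exp (M * E) - 1 > 0" using M E by simp
  have e': "exp (M * E) - 1 \<ge> M * E"
    using exp_ge_add_one_self[of "M * E"] by linarith
  have \<delta>: "\<delta> > 0" using M L e by (simp add: \<delta>_def)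
  have \<delta>_le: "\<delta> \<le> L / E"
  proof -
    have "\<delta> \<le> M * L / (M * E)" unfolding \<delta>_def using e e' M L E by (intro divide_left_mono) auto
    then show ?thesis using M by simp
  qed
  define F where "F c = integral {0..L} (\<lambda>x. 1 / (g x + c))" for c
  have pos: "g x + c > 0" if "c \<ge> \<delta> - g x0" for x c
    using min[of x] that \<delta> by linarith
  have "\<exists>c. \<delta> - g x0 \<le> c \<and> c \<le> L / E - g x0 \<and> F c = E"
  proof (rule IVT2')
    show "F (L / E - g x0) \<le> E"
    proof -
      have "F (L / E - g x0) \<le> integral {0..L} (\<lambda>x. E / L)"
        unfolding F_def
      proof (rule Henstock_Kurzweil_Integration.integral_le)
        show "(\<lambda>x. 1 / (g x + (L / E - g x0))) integrable_on {0..L}"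
          using pos[of "L / E - g x0"] \<delta>_le
          by (intro integrable_continuous_real continuous_intros continuous_on_subset[OF c]) (auto simp: less_imp_neq[THEN not_sym])
        fix x
        have 1: "L / E \<le> g x + (L / E - g x0)" using min[of x] by simp
        have 2: "0 < L / E" using L E by simp
        have "1 / (g x + (L / E - g x0)) \<le> 1 / (L / E)"
          using le_imp_inverse_le[OF 1 2] unfolding inverse_eq_divide .
        then show "1 / (g x + (L / E - g x0)) \<le> E / L" by simp
      qed (rule integrable_continuous_real, rule continuous_on_const)
      also have "\<dots> = E" using L by simp
      finally show ?thesis .
    qed
    show "E \<le> F (\<delta> - g x0)"
    proof -
      let ?r = "\<lambda>x. g x + (\<delta> - g x0)"
      have "M * L \<le> ?r x0 * (exp (M * F (\<delta> - g x0)) - 1)"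
        by (rule lower_bound_from_reciprocal_integral[OF L M]) (use lip per pos in \<open>auto simp: F_def\<close>)
      then have "M * L / \<delta> \<le> exp (M * F (\<delta> - g x0)) - 1" using \<delta> by (simp add: field_simps)
      moreover have "M * L / \<delta> = exp (M * E) - 1" using M L by (simp add: \<delta>_def)
      ultimately show ?thesis using M by simp
    qed
    show "\<delta> - g x0 \<le> L / E - g x0" using \<delta>_le by simp
    show "continuous_on {\<delta> - g x0..L / E - g x0} F"
      unfolding F_def
    proof (rule continuous_on_space_integral)
      have "continuous_on ({\<delta> - g x0..L / E - g x0} \<times> {0..L}) (\<lambda>z. g (snd z))"
        by (rule continuous_on_compose2[OF c]) (auto intro!: continuous_intros)
      then show "continuous_on ({\<delta> - g x0..L / E - g x0} \<times> {0..L}) (\<lambda>(c, x). 1 / (g x + c))"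
        unfolding case_prod_unfold
        by (intro continuous_intros) (use pos in \<open>auto simp: less_imp_neq[THEN not_sym]\<close>)
    qed
  qed
  then show ?thesis using pos unfolding F_def by blast
qed

text \<open>Turns an equality of nonlinear integrals into a relation that is linear in the
  difference, with the positive weight 1 / (r1 r2).\<close>

lemma translation_difference:
  fixes r1 r2 :: "real \<Rightarrow> real"
  assumes L: "L > 0" and c: "continuous_on {0..L} r1" "continuous_on {0..L} r2"
    and pos: "\<And>x. x \<in> {0..L} \<Longrightarrow> r1 x > 0" "\<And>x. x \<in> {0..L} \<Longrightarrow> r2 x > 0"
    and eq: "integral {0..L} (\<lambda>x. 1 / r1 x) = integral {0..L} (\<lambda>x. 1 / r2 x)"
  shows "integral {0..L} (\<lambda>x. (r1 x - r2 x) / (r1 x * r2 x)) = 0"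
proof -
  have nz: "\<forall>x\<in>{0..L}. r1 x \<noteq> 0" "\<forall>x\<in>{0..L}. r2 x \<noteq> 0"
    by (metis order_less_irrefl pos(1), metis order_less_irrefl pos(2))
  have "integral {0..L} (\<lambda>x. 1 / r2 x - 1 / r1 x) = 0"
    using eq nz by (subst Henstock_Kurzweil_Integration.integral_diff) (auto intro!: integrable_continuous_real continuous_intros c)
  moreover have "1 / r2 x - 1 / r1 x = (r1 x - r2 x) / (r1 x * r2 x)" if "x \<in> {0..L}" for x
    using nz that by (simp add: field_simps)
  ultimately show ?thesis by (metis (no_types, lifting) Henstock_Kurzweil_Integration.integral_cong)
qed

text \<open>If c1 - c2 exceeded \<open>e\<close>, the first radius would exceed the second
  everywhere, contradicting \<open>translation_difference\<close>. With e = 0 this is uniqueness of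
  the translation; with small \<open>e\<close> it gives continuity in time and later the rate of
  convergence.\<close>

lemma translation_bound:
  fixes g1 g2 :: "real \<Rightarrow> real"
  assumes L: "L > 0" and c: "continuous_on {0..L} g1" "continuous_on {0..L} g2"
    and pos: "\<And>x. x \<in> {0..L} \<Longrightarrow> g1 x + c1 > 0" "\<And>x. x \<in> {0..L} \<Longrightarrow> g2 x + c2 > 0"
    and eq: "integral {0..L} (\<lambda>x. 1 / (g1 x + c1)) = integral {0..L} (\<lambda>x. 1 / (g2 x + c2))"
    and e: "\<And>x. x \<in> {0..L} \<Longrightarrow> \<bar>g1 x - g2 x\<bar> \<le> e"
  shows "\<bar>c1 - c2\<bar> \<le> e"
proof -
  have nz: "\<forall>x\<in>{0..L}. g1 x + c1 \<noteq> 0" "\<forall>x\<in>{0..L}. g2 x + c2 \<noteq> 0"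
    by (metis order_less_irrefl pos(1), metis order_less_irrefl pos(2))
  let ?q = "\<lambda>x. ((g1 x + c1) - (g2 x + c2)) / ((g1 x + c1) * (g2 x + c2))"
  have 0: "integral {0..L} ?q = 0"
    by (rule translation_difference[OF L _ _ _ _ eq]) (auto intro!: continuous_intros c pos)
  have cq: "continuous_on {0..L} ?q"
    by (intro continuous_intros c) (use nz in auto)
  have False if "c1 - c2 > e"
  proof -
    have "integral {0..L} ?q > 0"
    proof (rule integral_positive[OF cq L])
      fix x assume x: "x \<in> {0..L}"
      then have "(g1 x + c1) - (g2 x + c2) > 0" using e[OF x] that by (simp add: abs_le_iff)
      moreover have "(g1 x + c1) * (g2 x + c2) > 0" using pos x by simp
      ultimately show "?q x > 0" by (rule divide_pos_pos)
    qed
    with 0 show False by simp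
  qed
  moreover have False if "c2 - c1 > e"
  proof -
    have "integral {0..L} (\<lambda>x. - ?q x) > 0"
    proof (rule integral_positive[OF continuous_on_minus[OF cq] L])
      fix x assume x: "x \<in> {0..L}"
      then have "(g1 x + c1) - (g2 x + c2) < 0" using e[OF x] that by (simp add: abs_le_iff)
      moreover have "(g1 x + c1) * (g2 x + c2) > 0" using pos x by simp
      ultimately show "- ?q x > 0" by (simp add: divide_neg_pos)
    qed
    with 0 show False by simp
  qed
  ultimately show ?thesis by fastforce
qed

text \<open>Hadamard's lemma in the time variable: the quotient is the mean of \<open>g'\<close>
  over the segment from \<open>s\<close> to \<open>t\<close>, which makes sense and is continuous at
  t = s too.\<close>

lemma difference_quotient_continuous:
  fixes g g' :: "real \<Rightarrow> real \<Rightarrow> real"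
  assumes d: "\<And>t x. t \<ge> 0 \<Longrightarrow> ((\<lambda>s. g s x) has_real_derivative g' t x) (at t within {0..})"
    and c: "continuous_on ({0..} \<times> UNIV) (\<lambda>(t, x). g' t x)" and s: "s \<ge> 0"
  obtains Q where "\<And>t x. t \<ge> 0 \<Longrightarrow> g t x - g s x = (t - s) * Q t x" "\<And>x. Q s x = g' s x"
    "continuous_on ({0..} \<times> UNIV) (\<lambda>(t, x). Q t x)"
proof -
  define Q where "Q = (\<lambda>t x. integral {0..1} (\<lambda>\<sigma>. g' (s + \<sigma> * (t - s)) x))"
  have nn: "s + \<sigma> * (t - s) \<ge> 0" if "\<sigma> \<in> {0..1}" "t \<ge> 0" for \<sigma> t
  proof -
    have "s + \<sigma> * (t - s) = (1 - \<sigma>) * s + \<sigma> * t" by (simp add: algebra_simps)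
    then show ?thesis using that s by simp
  qed
  have 1: "Q s x = g' s x" for x by (simp add: Q_def)
  have 2: "continuous_on ({0..} \<times> UNIV) (\<lambda>(t, x). Q t x)"
  proof -
    have "continuous_on (({0..} \<times> UNIV) \<times> {0..1}) (\<lambda>y::(real\<times>real)\<times>real. (\<lambda>(t, x). g' t x) (s + snd y * (fst (fst y) - s), snd (fst y)))"
      by (rule continuous_on_compose2[OF c]) (use nn in \<open>auto intro!: continuous_intros\<close>)
    then have "continuous_on ({0..} \<times> UNIV) (\<lambda>z. integral {0..1} (\<lambda>\<sigma>. g' (s + \<sigma> * (fst z - s)) (snd z)))"
      by (intro continuous_on_space_integral) (simp add: case_prod_unfold)
    then show ?thesis by (simp add: case_prod_unfold Q_def)
  qed
  have 3: "g t x - g s x = (t - s) * Q t x" if t: "t \<ge> 0" for t x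
  proof -
  have "((\<lambda>\<sigma>. (t - s) * g' (s + \<sigma> * (t - s)) x) has_integral (g (s + 1 * (t - s)) x - g (s + 0 * (t - s)) x)) {0..1}"
  proof (rule fundamental_theorem_of_calculus)
    fix \<sigma> :: real assume \<sigma>: "\<sigma> \<in> {0..1}"
    have "((\<lambda>s. g s x) has_vector_derivative g' (s + \<sigma> * (t - s)) x) (at (s + \<sigma> * (t - s)) within {0..})"
      using d[OF nn[OF \<sigma> t]] by (simp add: has_real_derivative_iff_has_vector_derivative)
    then have 1: "((\<lambda>s. g s x) has_vector_derivative g' (s + \<sigma> * (t - s)) x) (at (s + \<sigma> * (t - s)) within (\<lambda>\<sigma>. s + \<sigma> * (t - s)) ` {0..1})"
      by (rule has_vector_derivative_within_subset) (use nn t in auto)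
    have 2: "((\<lambda>\<sigma>. s + \<sigma> * (t - s)) has_vector_derivative (t - s)) (at \<sigma> within {0..1})"
      unfolding has_real_derivative_iff_has_vector_derivative[symmetric] by (auto intro!: derivative_eq_intros)
    show "((\<lambda>\<sigma>. g (s + \<sigma> * (t - s)) x) has_vector_derivative (t - s) * g' (s + \<sigma> * (t - s)) x) (at \<sigma> within {0..1})"
      using vector_diff_chain_within[OF 2 1] by (simp add: o_def)
  qed simp
  from integral_unique[OF this] show ?thesis
    by (simp add: Q_def)
  qed
  show thesis by (rule that[OF 3 1 2])
qed

text \<open>Takes the place of the implicit function theorem. By
  \<open>translation_difference\<close>, c t - c s is exactly (t - s) times a quotient of two
  integrals that are continuous in \<open>t\<close>, so the derivative is the value of that quotient
  at t = s.\<close>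

lemma translation_has_derivative:
  fixes g g' :: "real \<Rightarrow> real \<Rightarrow> real"
  assumes L: "L > 0"
    and d: "\<And>t x. t \<ge> 0 \<Longrightarrow> ((\<lambda>s. g s x) has_real_derivative g' t x) (at t within {0..})"
    and cg: "continuous_on ({0..} \<times> UNIV) (\<lambda>(t, x). g t x)"
    and cg': "continuous_on ({0..} \<times> UNIV) (\<lambda>(t, x). g' t x)"
    and pos: "\<And>t x. t \<ge> 0 \<Longrightarrow> g t x + c t > 0"
    and eq: "\<And>t. t \<ge> 0 \<Longrightarrow> integral {0..L} (\<lambda>x. 1 / (g t x + c t)) = E"
    and s: "s \<ge> 0"
  shows "(c has_real_derivative - integral {0..L} (\<lambda>x. g' s x / (g s x + c s)\<^sup>2)
            / integral {0..L} (\<lambda>x. 1 / (g s x + c s)\<^sup>2)) (at s within {0..})"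
proof -
  have gslice: "continuous_on S (g t)" if "t \<ge> 0" for t S
  proof -
    have "continuous_on S (\<lambda>x. (\<lambda>(t, x). g t x) (t, x))"
      by (rule continuous_on_compose2[OF cg]) (use that in \<open>auto intro!: continuous_intros\<close>)
    then show ?thesis by simp
  qed
  \<comment> \<open>Uniform continuity of \<open>g\<close> on a bounded time interval times one
    period gives a supremum bound in \<open>x\<close>, which \<open>translation_bound\<close> passes
    on to \<open>c\<close>.\<close>
  have cc: "continuous_on {0..} c"
    unfolding continuous_on_iff
  proof (intro ballI allI impI)
    fix t e :: real assume t: "t \<in> {0..}" and e: "e > 0"
    have "uniformly_continuous_on ({0..t+1} \<times> {0..L}) (\<lambda>(t, x). g t x)"
      by (rule compact_uniformly_continuous) (auto intro!: compact_Times continuous_on_subset[OF cg])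
    then obtain \<delta> where \<delta>: "\<delta> > 0" "\<And>z z'. z \<in> {0..t+1} \<times> {0..L} \<Longrightarrow> z' \<in> {0..t+1} \<times> {0..L} \<Longrightarrow> dist z' z < \<delta> \<Longrightarrow>
       dist ((\<lambda>(t, x). g t x) z') ((\<lambda>(t, x). g t x) z) < e / 2"
      unfolding uniformly_continuous_on_def using e by (meson half_gt_zero)
    show "\<exists>\<delta>>0. \<forall>t'\<in>{0..}. dist t' t < \<delta> \<longrightarrow> dist (c t') (c t) < e"
    proof (intro exI[of _ "min \<delta> 1"] conjI ballI impI)
      fix t' :: real assume t': "t' \<in> {0..}" "dist t' t < min \<delta> 1"
      have "\<bar>c t' - c t\<bar> \<le> e / 2"
      proof (rule translation_bound[OF L, of "g t'" "g t"])
        fix x assume x: "x \<in> {0..L}"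
        have "dist (t', x) (t, x) = dist t' t" by (simp add: dist_prod_def)
        then have "dist (g t' x) (g t x) < e / 2"
          using \<delta>(2)[of "(t, x)" "(t', x)"] t t' x by (auto simp: dist_real_def)
        then show "\<bar>g t' x - g t x\<bar> \<le> e / 2" by (simp add: dist_real_def)
      qed (use t t' pos eq gslice in auto)
      then show "dist (c t') (c t) < e" using e by (simp add: dist_real_def)
    qed (use \<delta> in simp)
  qed
  obtain Q where Q: "\<And>t x. t \<ge> 0 \<Longrightarrow> g t x - g s x = (t - s) * Q t x" "\<And>x. Q s x = g' s x"
    "continuous_on ({0..} \<times> UNIV) (\<lambda>(t, x). Q t x)"
    using difference_quotient_continuous[OF d cg' s] by blast
  define r where "r t x = g t x + c t" for t x
  have rpos: "r t x > 0" "r t x \<noteq> 0" if "t \<ge> 0" for t x using pos[OF that, of x] by (auto simp: r_def)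
  have cr: "continuous_on ({0..} \<times> {0..L}) (\<lambda>z. r (fst z) (snd z))"
    unfolding r_def
    by (intro continuous_intros continuous_on_compose2[OF cc] continuous_on_subset[OF cg[unfolded case_prod_unfold]]) auto
  have crs: "continuous_on S (r t)" if "t \<ge> 0" for t S
    unfolding r_def by (intro continuous_intros gslice that)
  have crs2: "continuous_on ({0..} \<times> {0..L}) (\<lambda>z::real\<times>real. r s (snd z))"
    by (rule continuous_on_compose2[OF crs[OF s, of UNIV]]) (auto intro!: continuous_intros)
  have cQ: "continuous_on ({0..} \<times> {0..L}) (\<lambda>z. Q (fst z) (snd z))"
    by (rule continuous_on_subset[OF Q(3)[unfolded case_prod_unfold]]) auto
  define A where "A t = integral {0..L} (\<lambda>x. Q t x / (r t x * r s x))" for t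
  define B where "B t = integral {0..L} (\<lambda>x. 1 / (r t x * r s x))" for t
  have cA: "continuous_on {0..} A"
    unfolding A_def
    by (rule continuous_on_space_integral, unfold case_prod_unfold, intro continuous_intros cQ cr crs2)
      (use rpos s in auto)
  have cB: "continuous_on {0..} B"
    unfolding B_def
    by (rule continuous_on_space_integral, unfold case_prod_unfold, intro continuous_intros cr crs2)
      (use rpos s in auto)
  have Bpos: "B t > 0" if "t \<ge> 0" for t
    unfolding B_def using rpos that s by (intro integral_positive[OF _ L] continuous_intros crs) auto
  have key: "c t - c s = (t - s) * (- A t / B t)" if t: "t \<ge> 0" for t
  proof -
    have Qs: "continuous_on {0..L} (Q t)"
    proof -
      have "continuous_on {0..L} (\<lambda>x. (\<lambda>(t, x). Q t x) (t, x))"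
        by (rule continuous_on_compose2[OF Q(3)]) (use t in \<open>auto intro!: continuous_intros\<close>)
      then show ?thesis by simp
    qed
    have i1: "(\<lambda>x. Q t x / (r t x * r s x)) integrable_on {0..L}"
      using rpos t s by (intro integrable_continuous_real continuous_intros crs Qs) auto
    have i2: "(\<lambda>x. 1 / (r t x * r s x)) integrable_on {0..L}"
      using rpos t s by (intro integrable_continuous_real continuous_intros crs) auto
    have "0 = integral {0..L} (\<lambda>x. (r t x - r s x) / (r t x * r s x))"
      using translation_difference[OF L, of "r t" "r s"] crs rpos t s eq by (simp add: r_def)
    also have "\<dots> = integral {0..L} (\<lambda>x. (t - s) * (Q t x / (r t x * r s x)) + (c t - c s) * (1 / (r t x * r s x)))"
    proof (rule Henstock_Kurzweil_Integration.integral_cong)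
      fix x
      have "r t x - r s x = (t - s) * Q t x + (c t - c s)" using Q(1)[OF t, of x] by (simp add: r_def)
      then show "(r t x - r s x) / (r t x * r s x) = (t - s) * (Q t x / (r t x * r s x)) + (c t - c s) * (1 / (r t x * r s x))"
        by (simp add: add_divide_distrib)
    qed
    also have "\<dots> = (t - s) * A t + (c t - c s) * B t"
      unfolding A_def B_def
      by (intro integral_unique has_integral_add has_integral_mult_right integrable_integral i1 i2)
    finally show ?thesis using Bpos[OF t] by (simp add: field_simps)
  qed
  have "continuous_on {0..} (\<lambda>t. - A t / B t)"
    using Bpos by (intro continuous_intros cA cB) (auto simp: less_imp_neq[THEN not_sym])
  then have "((\<lambda>t. - A t / B t) \<longlongrightarrow> - A s / B s) (at s within {0..})"
    using s by (simp add: continuous_on)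
  moreover have "\<forall>\<^sub>F t in at s within {0..}. - A t / B t = (c t - c s) / (t - s)"
    unfolding eventually_at_topological using key by (intro exI[of _ UNIV]) auto
  ultimately have "((\<lambda>t. (c t - c s) / (t - s)) \<longlongrightarrow> - A s / B s) (at s within {0..})"
    by (rule Lim_transform_eventually)
  then have "(c has_real_derivative - A s / B s) (at s within {0..})"
    by (simp add: has_field_derivative_iff)
  then show ?thesis by (simp add: A_def B_def r_def Q(2) power2_eq_square)
qed

section \<open>Flow of a time-dependent vector field on the line\<close>

lemma continuous_on_time_slice:
  assumes "continuous_on ({0..} \<times> UNIV) (\<lambda>(t, x). F t x)" "continuous_on S \<tau>" "continuous_on S f" "\<tau> ` S \<subseteq> {0..}"
  shows "continuous_on S (\<lambda>z. F (\<tau> z) (f z))"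
proof -
  have "continuous_on S (\<lambda>z. (\<lambda>(t, x). F t x) (\<tau> z, f z))"
    by (rule continuous_on_compose2[OF assms(1)]) (use assms in \<open>auto intro!: continuous_intros\<close>)
  then show ?thesis by simp
qed

text \<open>Banach's fixed point theorem for \<open>\<eta> t u = exp (- 2 * K * t) * (\<theta> t u - u)\<close>: the weight makes
  the Picard operator a contraction on the whole time axis.\<close>

lemma picard_solution_exists:
  fixes F :: "real \<Rightarrow> real \<Rightarrow> real"
  assumes F: "continuous_on ({0..} \<times> UNIV) (\<lambda>(t, x). F t x)"
    and B: "\<And>t x. t \<ge> 0 \<Longrightarrow> \<bar>F t x\<bar> \<le> B"
    and K: "K > 0" "\<And>t x y. t \<ge> 0 \<Longrightarrow> \<bar>F t x - F t y\<bar> \<le> K * \<bar>x - y\<bar>"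
  obtains \<theta> where "continuous_on ({0..} \<times> UNIV) (\<lambda>(t, u). \<theta> t u)"
    "\<And>t u. t \<ge> 0 \<Longrightarrow> \<theta> t u = u + integral {0..t} (\<lambda>s. F s (\<theta> s u))"
proof -
  define I where "I \<eta> t u = integral {0..t} (\<lambda>s. F s (u + exp (2 * K * s) * \<eta> (s, u)))" for \<eta> :: "real \<times> real \<Rightarrow> real" and t u
  \<comment> \<open>Bounded continuous functions live on the whole plane; replacing negative times
    by 0 extends the operator to it.\<close>
  define \<Phi> where "\<Phi> \<eta> z = exp (- (2 * K * max 0 (fst z))) * I \<eta> (max 0 (fst z)) (snd z)" for \<eta> and z :: "real \<times> real"
  have B0: "B \<ge> 0" using B[of 0 0] by linarith
  have cF: "continuous_on S (\<lambda>s. F s (u + exp (2 * K * s) * \<eta> (s, u)))" if "continuous_on UNIV \<eta>" "S \<subseteq> {0..}" for \<eta> u S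
    by (rule continuous_on_time_slice[OF F])
      (use that in \<open>auto intro!: continuous_intros continuous_on_compose2[OF that(1)]\<close>)
  have cI: "continuous_on ({0..} \<times> UNIV) (\<lambda>(t, u). I \<eta> t u)" if "continuous_on UNIV \<eta>" for \<eta>
    unfolding I_def
  proof (rule continuous_on_time_integral)
    have "continuous_on ({0..} \<times> UNIV) (\<lambda>z::real \<times> real. F (fst z) (snd z + exp (2 * K * fst z) * \<eta> (fst z, snd z)))"
      by (rule continuous_on_time_slice[OF F])
        (auto intro!: continuous_intros continuous_on_compose2[OF that])
    then show "continuous_on ({0..} \<times> UNIV) (\<lambda>(t, x). F t (x + exp (2 * K * t) * \<eta> (t, x)))"
      by (simp add: case_prod_unfold)
  qed
  have \<Phi>_in: "\<Phi> \<eta> \<in> bcontfun" if "continuous_on UNIV \<eta>" for \<eta>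
    unfolding bcontfun_def
  proof (intro CollectI conjI)
    show "continuous_on UNIV (\<Phi> \<eta>)"
      unfolding \<Phi>_def
      by (intro continuous_intros continuous_on_time_slice[OF cI[OF that]]) auto
    \<comment> \<open>The integral grows at most like B t, and t * exp (- 2 K t) is at most 1 / (2
      K).\<close>
    have "norm (\<Phi> \<eta> z) \<le> B / (2 * K)" for z
    proof -
      define t where "t = max 0 (fst z)"
      have t: "t \<ge> 0" by (simp add: t_def)
      have "norm (I \<eta> t (snd z)) \<le> B * (t - 0)"
        unfolding I_def by (rule integral_bound[OF t cF[OF that]]) (auto simp: B)
      then have "norm (\<Phi> \<eta> z) \<le> exp (- (2 * K * t)) * (B * t)"
        unfolding \<Phi>_def t_def[symmetric] norm_mult by (intro mult_mono) (auto simp: B0)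
      also have "\<dots> \<le> exp (- (2 * K * t)) * (B * (exp (2 * K * t) / (2 * K)))"
      proof (intro mult_left_mono B0)
        have "2 * K * t \<le> exp (2 * K * t)" using exp_ge_add_one_self[of "2 * K * t"] by linarith
        then show "t \<le> exp (2 * K * t) / (2 * K)" using K(1) by (simp add: field_simps)
      qed simp
      also have "\<dots> = B / (2 * K)" by (simp add: exp_minus field_simps)
      finally show ?thesis .
    qed
    then show "bounded (range (\<Phi> \<eta>))" unfolding bounded_iff by auto
  qed
  have contr: "dist (\<Phi> (apply_bcontfun \<eta>1) z) (\<Phi> (apply_bcontfun \<eta>2) z) \<le> 1 / 2 * dist \<eta>1 \<eta>2" for \<eta>1 \<eta>2 z
  proof -
    define t where "t = max 0 (fst z)"
    define u where "u = snd z"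
    define d where "d = dist \<eta>1 \<eta>2"
    have t: "t \<ge> 0" by (simp add: t_def)
    let ?f = "\<lambda>\<eta> s. F s (u + exp (2 * K * s) * apply_bcontfun \<eta> (s, u))"
    have c: "continuous_on {0..t} (?f \<eta>)" for \<eta> by (intro cF) auto
    \<comment> \<open>The exponent 2 K is twice the Lipschitz constant, so integrating K d exp (2 K
      s) yields the factor 1/2 of the contraction.\<close>
    have h: "((\<lambda>s. K * d * exp (2 * K * s)) has_integral (d / 2 * exp (2 * K * t) - d / 2 * exp (2 * K * 0))) {0..t}"
      by (rule fundamental_theorem_of_calculus[OF t], unfold has_real_derivative_iff_has_vector_derivative[symmetric])
        (auto intro!: derivative_eq_intros)
    have "norm (I \<eta>1 t u - I \<eta>2 t u) = norm (integral {0..t} (\<lambda>s. ?f \<eta>1 s - ?f \<eta>2 s))"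
      unfolding I_def using c by (simp add: Henstock_Kurzweil_Integration.integral_diff integrable_continuous_real)
    also have "\<dots> \<le> integral {0..t} (\<lambda>s. K * d * exp (2 * K * s))"
    proof (rule Henstock_Kurzweil_Integration.integral_norm_bound_integral)
      show "(\<lambda>s. ?f \<eta>1 s - ?f \<eta>2 s) integrable_on {0..t}"
        by (intro integrable_continuous_real continuous_intros c)
      show "(\<lambda>s. K * d * exp (2 * K * s)) integrable_on {0..t}" using h by blast
      fix s assume s: "s \<in> {0..t}"
      have "norm (?f \<eta>1 s - ?f \<eta>2 s) \<le> K * \<bar>(u + exp (2 * K * s) * apply_bcontfun \<eta>1 (s, u)) - (u + exp (2 * K * s) * apply_bcontfun \<eta>2 (s, u))\<bar>"
        using K(2)[of s "u + exp (2 * K * s) * apply_bcontfun \<eta>1 (s, u)" "u + exp (2 * K * s) * apply_bcontfun \<eta>2 (s, u)"] s by simp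
      also have "\<dots> = K * (exp (2 * K * s) * dist (apply_bcontfun \<eta>1 (s, u)) (apply_bcontfun \<eta>2 (s, u)))"
        by (simp add: dist_real_def abs_mult flip: right_diff_distrib)
      also have "\<dots> \<le> K * (exp (2 * K * s) * d)"
        unfolding d_def using K(1) by (intro mult_left_mono dist_bounded) auto
      finally show "norm (?f \<eta>1 s - ?f \<eta>2 s) \<le> K * d * exp (2 * K * s)" by (simp add: mult_ac)
    qed
    also have "\<dots> = d / 2 * exp (2 * K * t) - d / 2" using integral_unique[OF h] by simp
    also have "\<dots> \<le> d / 2 * exp (2 * K * t)" by (simp add: d_def)
    finally have *: "norm (I \<eta>1 t u - I \<eta>2 t u) \<le> d / 2 * exp (2 * K * t)" .
    have "dist (\<Phi> (apply_bcontfun \<eta>1) z) (\<Phi> (apply_bcontfun \<eta>2) z) = exp (- (2 * K * t)) * norm (I \<eta>1 t u - I \<eta>2 t u)"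
      unfolding \<Phi>_def t_def[symmetric] u_def[symmetric] dist_norm right_diff_distrib[symmetric] norm_mult by simp
    also have "\<dots> \<le> exp (- (2 * K * t)) * (d / 2 * exp (2 * K * t))"
      by (intro mult_left_mono *) simp
    also have "\<dots> = 1 / 2 * d" by (simp add: exp_minus field_simps)
    finally show ?thesis by (simp add: d_def)
  qed
  have "\<exists>!\<eta>. Bcontfun (\<Phi> (apply_bcontfun \<eta>)) = \<eta>"
  proof (rule banach_fix_type[of "1/2"])
    show "\<forall>x y. dist (Bcontfun (\<Phi> (apply_bcontfun x))) (Bcontfun (\<Phi> (apply_bcontfun y))) \<le> 1 / 2 * dist x y"
    proof (intro allI dist_bound)
      fix x y z
      show "dist (apply_bcontfun (Bcontfun (\<Phi> (apply_bcontfun x))) z) (apply_bcontfun (Bcontfun (\<Phi> (apply_bcontfun y))) z) \<le> 1 / 2 * dist x y"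
        using contr[of x z y] by (subst (1 2) Bcontfun_inverse) (auto intro: \<Phi>_in)
    qed
  qed auto
  then obtain \<eta> where "Bcontfun (\<Phi> (apply_bcontfun \<eta>)) = \<eta>" by blast
  then have fp: "\<Phi> (apply_bcontfun \<eta>) = apply_bcontfun \<eta>"
    using Bcontfun_inverse[OF \<Phi>_in[of "apply_bcontfun \<eta>"]] by simp
  define \<theta> where "\<theta> t u = u + exp (2 * K * t) * apply_bcontfun \<eta> (t, u)" for t u
  show thesis
  proof
    show "continuous_on ({0..} \<times> UNIV) (\<lambda>(t, u). \<theta> t u)"
      unfolding \<theta>_def case_prod_unfold by (auto intro!: continuous_intros)
    fix t u :: real assume t: "t \<ge> 0"
    have "apply_bcontfun \<eta> (t, u) = exp (- (2 * K * t)) * I \<eta> t u"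
      using t fun_cong[OF fp, of "(t, u)"] by (simp add: \<Phi>_def)
    then have "exp (2 * K * t) * apply_bcontfun \<eta> (t, u) = I \<eta> t u" by (simp add: exp_minus)
    then show "\<theta> t u = u + integral {0..t} (\<lambda>s. F s (\<theta> s u))"
      by (simp add: I_def \<theta>_def)
  qed
qed

text \<open>The difference of two solutions solves a linear equation whose coefficient is the difference
  quotient of the vector field.\<close>

lemma solution_difference:
  fixes F Q :: "real \<Rightarrow> real \<Rightarrow> real \<Rightarrow> real" and G :: "real \<Rightarrow> real \<Rightarrow> real"
  assumes Q: "continuous_on ({0..} \<times> UNIV) (\<lambda>(t, z). Q t (fst z) (snd z))"
    "\<And>t x y. t \<ge> 0 \<Longrightarrow> G t y - G t x = (y - x) * Q t x y"
    and a: "\<And>t. t \<ge> 0 \<Longrightarrow> (a has_real_derivative G t (a t)) (at t within {0..})"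
    and b: "\<And>t. t \<ge> 0 \<Longrightarrow> (b has_real_derivative G t (b t)) (at t within {0..})"
    and t: "t \<ge> 0"
  shows "b t - a t = (b 0 - a 0) * exp (integral {0..t} (\<lambda>s. Q s (a s) (b s)))"
proof -
  have ca: "continuous_on {0..} a" and cb: "continuous_on {0..} b"
    using a b by (auto intro!: DERIV_continuous_on)
  have cq: "continuous_on {0..} (\<lambda>s. Q s (a s) (b s))"
    using continuous_on_time_slice[OF Q(1), of "{0..}" "\<lambda>s. s" "\<lambda>s. (a s, b s)"] ca cb
    by (auto intro!: continuous_intros)
  \<comment> \<open>Integrating factor: the weighted difference of the two solutions has derivative
    zero.\<close>
  define E where "E t = exp (- integral {0..t} (\<lambda>s. Q s (a s) (b s)))" for t
  have "((\<lambda>t. (b t - a t) * E t) has_real_derivative 0) (at t within {0..})" if t: "t \<in> {0..}" for t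
  proof -
    have 1: "((\<lambda>t. integral {0..t} (\<lambda>s. Q s (a s) (b s))) has_real_derivative Q t (a t) (b t)) (at t within {0..})"
      using time_integral_has_time_derivative[OF cq, of t] t
      by (simp add: has_real_derivative_iff_has_vector_derivative)
    from t have t': "t \<ge> 0" by simp
    from DERIV_mult[OF DERIV_diff[OF b[OF t'] a[OF t']] DERIV_chain2[OF DERIV_exp DERIV_minus[OF 1]]]
    have "((\<lambda>t. (b t - a t) * E t) has_real_derivative
        (G t (b t) - G t (a t)) * E t + E t * - Q t (a t) (b t) * (b t - a t)) (at t within {0..})"
      by (simp add: E_def)
    moreover have "(G t (b t) - G t (a t)) * E t + E t * - Q t (a t) (b t) * (b t - a t) = 0"
      using Q(2)[of t "b t" "a t"] t by simp
    ultimately show ?thesis by (simp only:)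
  qed
  then obtain C where "\<forall>t\<in>{0..}. (b t - a t) * E t = C"
    using has_field_derivative_zero_constant[of "{0..}" "\<lambda>t. (b t - a t) * E t"] by (auto simp: convex_real_interval)
  then have "(b t - a t) * E t = (b 0 - a 0) * E 0" using t by force
  then show ?thesis by (simp add: E_def exp_minus field_simps)
qed

text \<open>The averaging of \<open>difference_quotient_continuous\<close> in the space variable. On
  the diagonal the quotient is the derivative, so continuity of \<open>Q\<close> replaces limits of
  difference quotients.\<close>

lemma spatial_difference_quotient:
  fixes F :: "real \<Rightarrow> real \<Rightarrow> real"
  assumes F: "csmooth F"
  obtains Q where "continuous_on ({0..} \<times> UNIV) (\<lambda>(t, z). Q t (fst z) (snd z))"
    "\<And>t x y. t \<ge> 0 \<Longrightarrow> F t y - F t x = (y - x) * Q t x y"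
    "\<And>t x. Q t x x = nderiv 1 (F t) x"
proof -
  define Q where "Q t x y = integral {0..1} (\<lambda>\<sigma>. nderiv 1 (F t) (x + \<sigma> * (y - x)))" for t x y
  have "continuous_on (({0..} \<times> UNIV) \<times> {0..1})
      (\<lambda>y::(real \<times> real \<times> real) \<times> real. nderiv 1 (F (fst (fst y))) (fst (snd (fst y)) + snd y * (snd (snd (fst y)) - fst (snd (fst y)))))"
    by (rule continuous_on_time_slice[OF csmooth_continuous[OF csmooth_nderiv1[OF F]]])
       (auto intro!: continuous_intros)
  then have "continuous_on ({0..} \<times> UNIV)
      (\<lambda>w. integral {0..1} (\<lambda>\<sigma>. nderiv 1 (F (fst w)) (fst (snd w) + \<sigma> * (snd (snd w) - fst (snd w)))))"
    by (intro continuous_on_space_integral) (simp add: case_prod_unfold)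
  then have 1: "continuous_on ({0..} \<times> UNIV) (\<lambda>(t, z). Q t (fst z) (snd z))"
    by (simp add: Q_def case_prod_unfold)
  have 2: "F t y - F t x = (y - x) * Q t x y" if t: "t \<ge> 0" for t x y
  proof -
    have "((\<lambda>\<sigma>. (y - x) * nderiv 1 (F t) (x + \<sigma> * (y - x))) has_integral (F t (x + 1 * (y - x)) - F t (x + 0 * (y - x)))) {0..1}"
    proof (rule fundamental_theorem_of_calculus)
      fix \<sigma> :: real
      have 1: "((\<lambda>\<sigma>. x + \<sigma> * (y - x)) has_vector_derivative (y - x)) (at \<sigma> within {0..1})"
        unfolding has_real_derivative_iff_has_vector_derivative[symmetric] by (auto intro!: derivative_eq_intros)
      have "(F t has_vector_derivative nderiv 1 (F t) (x + \<sigma> * (y - x))) (at (x + \<sigma> * (y - x)) within (\<lambda>\<sigma>. x + \<sigma> * (y - x)) ` {0..1})"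
        using csmooth_has_derivative1[OF F t] by (rule has_vector_derivative_at_within)
      from vector_diff_chain_within[OF 1 this]
      show "((\<lambda>\<sigma>. F t (x + \<sigma> * (y - x))) has_vector_derivative (y - x) * nderiv 1 (F t) (x + \<sigma> * (y - x))) (at \<sigma> within {0..1})"
        by (simp add: o_def)
    qed simp
    from integral_unique[OF this] show ?thesis by (simp add: Q_def)
  qed
  have 3: "Q t x x = nderiv 1 (F t) x" for t x by (simp add: Q_def)
  show thesis by (rule that[OF 1 2 3])
qed

text \<open>Differentiability in the label comes from \<open>solution_difference\<close>: the
  difference of two trajectories is (v - u) times a factor continuous in \<open>v\<close>, which is
  Caratheodory's form of the derivative. That factor is an exponential, hence positive.\<close>

lemma periodic_flow_exists:
  fixes F :: "real \<Rightarrow> real \<Rightarrow> real"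
  assumes F: "csmooth F" and per: "\<And>t x. t \<ge> 0 \<Longrightarrow> F t (x + L) = F t x"
    and B: "\<And>t x. t \<ge> 0 \<Longrightarrow> \<bar>F t x\<bar> \<le> B"
    and K: "\<And>t x. t \<ge> 0 \<Longrightarrow> \<bar>nderiv 1 (F t) x\<bar> \<le> K"
  obtains \<theta> where "csmooth \<theta>" "\<And>u. \<theta> 0 u = u"
    "\<And>t u. t \<ge> 0 \<Longrightarrow> ((\<lambda>s. \<theta> s u) has_real_derivative F t (\<theta> t u)) (at t within {0..})"
    "\<And>t u. t \<ge> 0 \<Longrightarrow> \<theta> t (u + L) = \<theta> t u + L"
    "\<And>t u. t \<ge> 0 \<Longrightarrow> nderiv 1 (\<theta> t) u > 0"
    "\<And>t. t \<ge> 0 \<Longrightarrow> strict_mono (\<theta> t)" "\<And>t. t \<ge> 0 \<Longrightarrow> surj (\<theta> t)"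
proof -
  have K0: "K \<ge> 0" using K[of 0 0] by linarith
  have Fx: "(F t has_real_derivative nderiv 1 (F t) x) (at x)" if "t \<ge> 0" for t x
    using csmooth_has_derivative1[OF F that] by (simp add: has_real_derivative_iff_has_vector_derivative)
  have lip: "\<bar>F t x - F t y\<bar> \<le> (K + 1) * \<bar>x - y\<bar>" if "t \<ge> 0" for t x y
  proof -
    have "\<bar>F t x - F t y\<bar> \<le> K * \<bar>x - y\<bar>"
      by (rule lipschitz_of_bounded_derivative[OF Fx[OF that] K[OF that]])
    also have "\<dots> \<le> (K + 1) * \<bar>x - y\<bar>" by (intro mult_right_mono) auto
    finally show ?thesis .
  qed
  obtain \<theta> where c\<theta>: "continuous_on ({0..} \<times> UNIV) (\<lambda>(t, u). \<theta> t u)"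
    and \<theta>: "\<And>t u. t \<ge> 0 \<Longrightarrow> \<theta> t u = u + integral {0..t} (\<lambda>s. F s (\<theta> s u))"
  proof -
    have "K + 1 > 0" using K0 by simp
    from picard_solution_exists[OF csmooth_continuous[OF F] B this lip] show ?thesis
      using that by blast
  qed
  have cs: "continuous_on {0..} (\<lambda>s. \<theta> s u)" for u
    by (rule continuous_on_time_slice[OF c\<theta>]) (auto intro!: continuous_intros)
  have cFs: "continuous_on {0..} (\<lambda>s. F s (\<theta> s u))" for u
    by (rule continuous_on_time_slice[OF csmooth_continuous[OF F]]) (auto intro!: continuous_intros cs)
  have \<theta>0: "\<theta> 0 u = u" for u using \<theta>[of 0 u] by simp
  have \<theta>t: "((\<lambda>s. \<theta> s u) has_real_derivative F t (\<theta> t u)) (at t within {0..})" if t: "t \<ge> 0" for t u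
  proof -
    have "((\<lambda>t. u + integral {0..t} (\<lambda>s. F s (\<theta> s u))) has_vector_derivative 0 + F t (\<theta> t u)) (at t within {0..})"
      by (intro has_vector_derivative_add time_integral_has_time_derivative cFs t) simp
    then have "((\<lambda>s. \<theta> s u) has_vector_derivative 0 + F t (\<theta> t u)) (at t within {0..})"
      by (rule has_vector_derivative_transform[rotated 2]) (use t \<theta> in auto)
    then show ?thesis by (simp add: has_real_derivative_iff_has_vector_derivative)
  qed
  obtain Q where Q: "continuous_on ({0..} \<times> UNIV) (\<lambda>(t, z). Q t (fst z) (snd z))"
    "\<And>t x y. t \<ge> 0 \<Longrightarrow> F t y - F t x = (y - x) * Q t x y"
    "\<And>t x. Q t x x = nderiv 1 (F t) x"
    using spatial_difference_quotient[OF F] by blast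
  define E where "E t u v = exp (integral {0..t} (\<lambda>s. Q s (\<theta> s u) (\<theta> s v)))" for t u v
  have diff: "\<theta> t v - \<theta> t u = (v - u) * E t u v" if "t \<ge> 0" for t u v
    using solution_difference[OF Q(1,2) \<theta>t \<theta>t that, of v u] by (simp add: E_def \<theta>0)
  have E_cont: "isCont (E t u) v" if t: "t \<ge> 0" for t u v
  proof -
    have "continuous_on ({0..} \<times> UNIV) (\<lambda>w::real \<times> real. (\<lambda>s z. Q s (fst z) (snd z)) (fst w) (\<theta> (fst w) u, \<theta> (fst w) (snd w)))"
      by (rule continuous_on_time_slice[OF Q(1)])
        (auto intro!: continuous_intros continuous_on_time_slice[OF c\<theta>])
    then have "continuous_on ({0..} \<times> UNIV) (\<lambda>(s, v). Q s (\<theta> s u) (\<theta> s v))"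
      by (simp add: case_prod_unfold)
    then have "continuous_on ({0..} \<times> UNIV) (\<lambda>(t, v). integral {0..t} (\<lambda>s. Q s (\<theta> s u) (\<theta> s v)))"
      by (rule continuous_on_time_integral)
    then have "continuous_on UNIV (\<lambda>v. integral {0..t} (\<lambda>s. Q s (\<theta> s u) (\<theta> s v)))"
      by (rule continuous_on_time_slice) (use t in \<open>auto intro!: continuous_intros\<close>)
    then have "continuous_on UNIV (E t u)" unfolding E_def by (intro continuous_intros)
    then show ?thesis by (simp add: continuous_on_eq_continuous_at)
  qed
  have \<theta>u: "(\<theta> t has_vector_derivative exp (integral {0..t} (\<lambda>s. nderiv 1 (F s) (\<theta> s u)))) (at u)" if t: "t \<ge> 0" for t u
    unfolding has_real_derivative_iff_has_vector_derivative[symmetric] CARAT_DERIV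
  proof (intro exI[of _ "E t u"] conjI allI)
    show "\<theta> t z - \<theta> t u = E t u z * (z - u)" for z using diff[OF t] by (simp add: mult.commute)
    show "isCont (E t u) u" by (rule E_cont[OF t])
    show "E t u u = exp (integral {0..t} (\<lambda>s. nderiv 1 (F s) (\<theta> s u)))" by (simp add: E_def Q)
  qed
  \<comment> \<open>Bootstrapping: the derivative in \<open>u\<close> is the exponential of a time
    integral involving only \<open>\<theta>\<close> itself, so each order of regularity yields the
    next.\<close>
  have cd: "cdiff n \<theta>" for n
  proof (induction n)
    case 0
    then show ?case using c\<theta> by simp
  next
    case (Suc n)
    have "cdiff n (\<lambda>s. nderiv 1 (F s))" using csmooth_nderiv1[OF F] by (simp only: csmooth_def)
    from cdiff_SucI[OF Suc \<theta>u cdiff_exp[OF cdiff_time_integral[OF cdiff_compose[OF this Suc]]]]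
    show ?case .
  qed
  have nd: "nderiv 1 (\<theta> t) = (\<lambda>u. exp (integral {0..t} (\<lambda>s. nderiv 1 (F s) (\<theta> s u))))" if "t \<ge> 0" for t
    by (rule nderiv_1_eq) (rule \<theta>u[OF that])
  show thesis
  proof (rule that)
    show "csmooth \<theta>" using cd by (simp add: csmooth_def)
    show "\<theta> 0 u = u" for u by (rule \<theta>0)
    show "((\<lambda>s. \<theta> s u) has_real_derivative F t (\<theta> t u)) (at t within {0..})" if "t \<ge> 0" for t u by (rule \<theta>t[OF that])
    show "\<theta> t (u + L) = \<theta> t u + L" if t: "t \<ge> 0" for t u
    proof -
      \<comment> \<open>The trajectory of u + L lowered by \<open>L\<close> solves the same equation
        from the same initial value, so it is the trajectory of \<open>u\<close>.\<close>
      have "((\<lambda>s. \<theta> s (u + L) - L) has_real_derivative F t (\<theta> t (u + L) - L)) (at t within {0..})" if "t \<ge> 0" for t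
      proof -
        have "((\<lambda>s. \<theta> s (u + L) - L) has_real_derivative F t (\<theta> t (u + L)) - 0) (at t within {0..})"
          by (intro DERIV_diff \<theta>t that) simp
        then show ?thesis using per[OF that, of "\<theta> t (u + L) - L"] by simp
      qed
      from solution_difference[OF Q(1,2) \<theta>t this t, of u] show ?thesis by (simp add: \<theta>0)
    qed
    show "nderiv 1 (\<theta> t) u > 0" if "t \<ge> 0" for t u using nd[OF that] by simp
    show "strict_mono (\<theta> t)" if t: "t \<ge> 0" for t
    proof (rule strict_monoI)
      fix u v :: real assume "u < v"
      then have "(v - u) * E t u v > 0" by (simp add: E_def)
      then show "\<theta> t u < \<theta> t v" using diff[OF t, of v u] by linarith
    qed
    show "surj (\<theta> t)" if t: "t \<ge> 0" for t
    proof (unfold surj_def, rule allI)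
      fix y
      \<comment> \<open>In time \<open>t\<close> a label moves by at most B t, so an interval of
        this radius around \<open>y\<close> contains a preimage.\<close>
      have bd: "\<bar>\<theta> t u - u\<bar> \<le> B * t" for u
        using integral_bound[OF t continuous_on_subset[OF cFs[of u]], of B] B \<theta>[OF t, of u] by auto
      have "B * t \<ge> 0" using bd[of 0] by linarith
      moreover have "continuous_on {y - B * t..y + B * t} (\<theta> t)"
        by (rule continuous_on_time_slice[OF c\<theta>]) (use t in \<open>auto intro!: continuous_intros\<close>)
      moreover have "\<theta> t (y - B * t) \<le> y" "y \<le> \<theta> t (y + B * t)"
        using bd[of "y - B * t"] bd[of "y + B * t"] by linarith+
      ultimately show "\<exists>u. y = \<theta> t u" using IVT'[of "\<theta> t" "y - B * t" y "y + B * t"] by force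
    qed
  qed
qed

declare One_nat_def [simp del]

lemma nderiv_2: "nderiv 2 g = nderiv 1 (nderiv 1 g)"
  by (metis Suc_1 nderiv_Suc')

section \<open>Plane curves and their tangent angle\<close>

lemma tangent_eq_cis: "tangent \<theta> = cis \<theta>"
  by (simp add: tangent_def complex_eq_iff)

lemma normal_eq_cis: "normal \<theta> = \<i> * cis \<theta>"
  by (simp add: normal_def complex_eq_iff)

lemma tangent_has_derivative: "(tangent has_vector_derivative normal \<theta>) (at \<theta>)"
proof -
  have "((\<lambda>x. (complex_of_real (cos x) + \<i> * complex_of_real (sin x))) has_vector_derivative
      (complex_of_real (- sin \<theta>) + \<i> * complex_of_real (cos \<theta>))) (at \<theta>)"
    by (intro has_vector_derivative_add has_vector_derivative_mult_right has_vector_derivative_of_real)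
      (auto intro!: derivative_eq_intros simp flip: has_real_derivative_iff_has_vector_derivative)
  moreover have "tangent = (\<lambda>x. (complex_of_real (cos x) + \<i> * complex_of_real (sin x)))"
    by (auto simp: tangent_def complex_eq_iff)
  moreover have "normal \<theta> = complex_of_real (- sin \<theta>) + \<i> * complex_of_real (cos \<theta>)"
    by (auto simp: normal_def complex_eq_iff)
  ultimately show ?thesis by simp
qed

lemma normal_has_derivative: "(normal has_vector_derivative - tangent \<theta>) (at \<theta>)"
proof -
  have "normal = (\<lambda>x. \<i> * tangent x)" "- tangent \<theta> = \<i> * normal \<theta>"
    by (auto simp: normal_def tangent_def complex_eq_iff)
  then show ?thesis using has_vector_derivative_mult_right[OF tangent_has_derivative, of \<i>] by simp
qed

lemma smooth_tangent: "smooth tangent" and smooth_normal: "smooth normal"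
proof -
  have b: "bounded_linear (\<lambda>z::complex. - z)" by (rule bounded_linear_minus[OF bounded_linear_ident])
  have 0: "cdiff 0 (\<lambda>t. tangent)" "cdiff 0 (\<lambda>t. normal)"
    by (auto simp: tangent_def normal_def case_prod_unfold intro!: continuous_intros)
  have "cdiff n (\<lambda>t. tangent) \<and> cdiff n (\<lambda>t. normal)" for n
  proof (induction n)
    case (Suc n)
    then have "cdiff n (\<lambda>t x. - tangent x)" using cdiff_bounded_linear[OF b] by blast
    with Suc cdiff_SucI[OF _ tangent_has_derivative] cdiff_SucI[OF _ normal_has_derivative]
    show ?case by blast
  qed (use 0 in blast)
  then show "smooth tangent" "smooth normal" unfolding smooth_iff_csmooth csmooth_def by blast+
qed

lemma inner_frame [simp]:
  "inner (tangent \<theta>) (tangent \<theta>) = 1" "inner (normal \<theta>) (normal \<theta>) = 1"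
  "inner (tangent \<theta>) (normal \<theta>) = 0" "inner (normal \<theta>) (tangent \<theta>) = 0"
  by (auto simp: inner_complex_def tangent_def normal_def simp flip: power2_eq_square)

lemma norm_tangent [simp]: "norm (tangent \<theta>) = 1"
  by (simp add: tangent_eq_cis)

lemma inner_tangent_normal: "inner (tangent \<phi>) (normal \<theta>) = sin (\<phi> - \<theta>)"
  and inner_tangent_tangent: "inner (tangent \<phi>) (tangent \<theta>) = cos (\<phi> - \<theta>)"
  by (simp_all add: inner_complex_def tangent_def normal_def sin_diff cos_diff)

lemma frame_decomposition: "z = inner z (tangent \<theta>) *\<^sub>R tangent \<theta> + inner z (normal \<theta>) *\<^sub>R normal \<theta>"
proof (rule complex_eqI)
  have e: "sin \<theta> * sin \<theta> = 1 - cos \<theta> * cos \<theta>"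
    using sin_cos_squared_add[of \<theta>] by (simp add: power2_eq_square)
  show "Re z = Re (inner z (tangent \<theta>) *\<^sub>R tangent \<theta> + inner z (normal \<theta>) *\<^sub>R normal \<theta>)"
    using e by (simp add: inner_complex_def tangent_def normal_def) (algebra)
  show "Im z = Im (inner z (tangent \<theta>) *\<^sub>R tangent \<theta> + inner z (normal \<theta>) *\<^sub>R normal \<theta>)"
    using e by (simp add: inner_complex_def tangent_def normal_def) (algebra)
qed

lemma csmooth_inner:
  fixes F G :: "real \<Rightarrow> real \<Rightarrow> complex"
  assumes "csmooth F" "csmooth G" shows "csmooth (\<lambda>t x. inner (F t x) (G t x))"
  unfolding inner_complex_def
  using csmooth_add[OF csmooth_mult[OF csmooth_bounded_linear[OF bounded_linear_Re assms(1)] csmooth_bounded_linear[OF bounded_linear_Re assms(2)]]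
    csmooth_mult[OF csmooth_bounded_linear[OF bounded_linear_Im assms(1)] csmooth_bounded_linear[OF bounded_linear_Im assms(2)]]] .

text \<open>In the determinant of the first two derivatives the part r' along the tangent drops out,
  and only the normal part r theta' remains.\<close>

lemma curvature_of_polar_derivative:
  assumes g: "nderiv 1 g = (\<lambda>u. r u *\<^sub>R tangent (\<theta> u))" and r: "(r has_real_derivative r') (at u)"
    and \<theta>: "(\<theta> has_real_derivative \<theta>') (at u)" and pos: "r u > 0"
  shows "curvature g u = \<theta>' / r u"
proof -
  have "((\<lambda>u. tangent (\<theta> u)) has_vector_derivative \<theta>' *\<^sub>R normal (\<theta> u)) (at u)"
    using vector_diff_chain_at[OF _ tangent_has_derivative, of \<theta> \<theta>' u] \<theta>
    by (simp add: has_real_derivative_iff_has_vector_derivative o_def)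
  from has_vector_derivative_scaleR[OF r this]
  have "((\<lambda>u. r u *\<^sub>R tangent (\<theta> u)) has_vector_derivative r u *\<^sub>R \<theta>' *\<^sub>R normal (\<theta> u) + r' *\<^sub>R tangent (\<theta> u)) (at u)" .
  then have 2: "nderiv 2 g u = r u *\<^sub>R \<theta>' *\<^sub>R normal (\<theta> u) + r' *\<^sub>R tangent (\<theta> u)"
    unfolding nderiv_2 g nderiv_1 by (rule vector_derivative_at)
  have "Re (nderiv 1 g u) * Im (nderiv 2 g u) - Im (nderiv 1 g u) * Re (nderiv 2 g u)
      = r u * r u * \<theta>' * (cos (\<theta> u) * cos (\<theta> u) + sin (\<theta> u) * sin (\<theta> u))"
    unfolding g 2 by (simp add: tangent_def normal_def algebra_simps del: sin_cos_squared_add3)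
  also have "\<dots> = r u * r u * \<theta>'" by (simp only: sin_cos_squared_add3 mult_1_right)
  finally show ?thesis
    using pos by (simp add: curvature_def g power3_eq_cube)
qed

text \<open>The angle is merely continuous at \<open>u\<close>. In the frame at \<open>u\<close> the
  quotient of the normal and tangential components of g' is the tangent function of the angle
  increment; continuity keeps this increment within pi / 2, so near \<open>u\<close> the angle is an
  arctangent of a differentiable function.\<close>

lemma tangent_angle_has_derivative:
  assumes d: "(nderiv 1 g has_vector_derivative nderiv 2 g u) (at u)"
    and nz: "\<And>v. nderiv 1 g v \<noteq> 0" and \<theta>: "tangent_angle g \<theta>" and c: "isCont \<theta> u"
  shows "(\<theta> has_real_derivative curvature g u * norm (nderiv 1 g u)) (at u)"
proof -
  define T where "T = tangent (\<theta> u)"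
  define N where "N = normal (\<theta> u)"
  define R where "R = norm (nderiv 1 g u)"
  have polar: "nderiv 1 g v = norm (nderiv 1 g v) *\<^sub>R tangent (\<theta> v)" for v
    using \<theta> nz[of v] unfolding tangent_angle_def by (metis divideR_right norm_eq_zero sgn_div_norm)
  have R: "R > 0" using nz by (simp add: R_def)
  have gN: "inner (nderiv 1 g v) N = norm (nderiv 1 g v) * sin (\<theta> v - \<theta> u)"
    and gT: "inner (nderiv 1 g v) T = norm (nderiv 1 g v) * cos (\<theta> v - \<theta> u)" for v
    by (subst polar, simp add: N_def T_def inner_tangent_normal inner_tangent_tangent)+
  have dN: "((\<lambda>v. inner (nderiv 1 g v) N) has_real_derivative inner (nderiv 2 g u) N) (at u)"
    using bounded_linear.has_vector_derivative[OF bounded_linear_inner_left d]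
    by (simp add: has_real_derivative_iff_has_vector_derivative)
  have dT: "((\<lambda>v. inner (nderiv 1 g v) T) has_real_derivative inner (nderiv 2 g u) T) (at u)"
    using bounded_linear.has_vector_derivative[OF bounded_linear_inner_left d]
    by (simp add: has_real_derivative_iff_has_vector_derivative)
  have "((\<lambda>v. inner (nderiv 1 g v) N / inner (nderiv 1 g v) T) has_real_derivative inner (nderiv 2 g u) N / R) (at u)"
    using DERIV_divide[OF dN dT] R by (simp add: gN gT R_def[symmetric])
  then have "((\<lambda>v. \<theta> u + arctan (inner (nderiv 1 g v) N / inner (nderiv 1 g v) T)) has_real_derivative
      0 + inverse (1 + (inner (nderiv 1 g u) N / inner (nderiv 1 g u) T)\<^sup>2) * (inner (nderiv 2 g u) N / R)) (at u)"
    by (intro DERIV_add DERIV_const DERIV_chain2[OF DERIV_arctan])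
  then have 1: "((\<lambda>v. \<theta> u + arctan (inner (nderiv 1 g v) N / inner (nderiv 1 g v) T)) has_real_derivative inner (nderiv 2 g u) N / R) (at u)"
    by (simp add: gN)
  have "\<forall>\<^sub>F v in nhds u. dist (\<theta> v) (\<theta> u) < pi / 2"
    using c pi_half_gt_zero unfolding isCont_def tendsto_iff eventually_at_filter
    by (auto elim!: allE[of _ "pi / 2"] eventually_mono)
  then have "\<forall>\<^sub>F v in nhds u. \<theta> u + arctan (inner (nderiv 1 g v) N / inner (nderiv 1 g v) T) = \<theta> v"
  proof (rule eventually_mono)
    fix v assume "dist (\<theta> v) (\<theta> u) < pi / 2"
    then have "\<theta> v - \<theta> u < pi / 2" "- (pi / 2) < \<theta> v - \<theta> u"
      unfolding dist_real_def by linarith+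
    then have "arctan (tan (\<theta> v - \<theta> u)) = \<theta> v - \<theta> u"
      by (intro arctan_tan)
    moreover have "inner (nderiv 1 g v) N / inner (nderiv 1 g v) T = tan (\<theta> v - \<theta> u)"
      using nz[of v] by (simp add: gN gT tan_def)
    ultimately show "\<theta> u + arctan (inner (nderiv 1 g v) N / inner (nderiv 1 g v) T) = \<theta> v" by simp
  qed
  from 1 this have 2: "(\<theta> has_real_derivative inner (nderiv 2 g u) N / R) (at u)"
    by (subst (asm) DERIV_cong_ev[OF refl _ refl])
  have "curvature g u = R * inner (nderiv 2 g u) N / R ^ 3"
    unfolding curvature_def R_def[symmetric]
    by (subst (1 2) polar) (simp add: R_def N_def inner_complex_def tangent_def normal_def algebra_simps)
  then have "curvature g u * R = inner (nderiv 2 g u) N / R"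
    using R by (simp add: power3_eq_cube)
  with 2 show ?thesis by (simp add: R_def)
qed

text \<open>Substitution d theta = kappa ds turns the energy into the integral of the curvature over
  the angle; the resulting interval is one period.\<close>

lemma elastic_energy_by_angle:
  assumes \<theta>: "\<And>u. (\<theta> has_real_derivative curvature g u * norm (nderiv 1 g u)) (at u)"
    and f: "\<And>u. curvature g u = f (\<theta> u)" "continuous_on UNIV f" "\<And>x. f (x + L) = f x"
    and L: "L > 0" "\<theta> L = \<theta> 0 + L" and mono: "mono \<theta>"
  shows "elastic_energy L g = integral {0..L} f"
proof -
  have "((\<lambda>u. (curvature g u * norm (nderiv 1 g u)) *\<^sub>R f (\<theta> u)) has_integral integral {\<theta> 0..\<theta> L} f) {0..L}"
  proof (rule has_integral_substitution)
    show "\<theta> ` {0..L} \<subseteq> {\<theta> 0..\<theta> L}" using mono by (auto simp: mono_def)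
    show "(\<theta> has_field_derivative curvature g u * norm (nderiv 1 g u)) (at u within {0..L})" for u
      using \<theta> by (rule has_field_derivative_at_within)
  qed (use f L in \<open>auto intro: continuous_on_subset\<close>)
  from integral_unique[OF this] have "elastic_energy L g = integral {\<theta> 0..\<theta> L} f"
    by (simp add: elastic_energy_def f(1)[symmetric] power2_eq_square mult_ac)
  also have "\<dots> = integral {0..L} f"
    unfolding L(2) by (rule integral_periodic[OF f(2) L(1) f(3)])
  finally show ?thesis .
qed

section \<open>Recovering a curve from its support function\<close>

text \<open>Frame expansion of a curve parametrized by its tangent angle: the normal component is -p
  by the sign convention for the support function, and the tangential component is p'.\<close>

definition curve_of :: "(real \<Rightarrow> real) \<Rightarrow> real \<Rightarrow> complex" where
  "curve_of p \<theta> = nderiv 1 p \<theta> *\<^sub>R tangent \<theta> - p \<theta> *\<^sub>R normal \<theta>"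

lemma support_curve_of: "support (curve_of p) = p"
  by (auto simp: support_def curve_of_def inner_diff_left)

lemma curve_of_has_derivative:
  assumes "(p has_real_derivative nderiv 1 p \<theta>) (at \<theta>)" "(nderiv 1 p has_real_derivative nderiv 2 p \<theta>) (at \<theta>)"
  shows "(curve_of p has_vector_derivative (p \<theta> + nderiv 2 p \<theta>) *\<^sub>R tangent \<theta>) (at \<theta>)"
proof -
  have "(curve_of p has_vector_derivative (nderiv 1 p \<theta> *\<^sub>R normal \<theta> + nderiv 2 p \<theta> *\<^sub>R tangent \<theta>)
      - (p \<theta> *\<^sub>R - tangent \<theta> + nderiv 1 p \<theta> *\<^sub>R normal \<theta>)) (at \<theta>)"
    unfolding curve_of_def[abs_def]
    by (intro has_vector_derivative_diff has_vector_derivative_scaleR assms tangent_has_derivative normal_has_derivative)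
  then show ?thesis by (simp add: algebra_simps)
qed

lemma csmooth_curve_of:
  assumes "csmooth p" shows "csmooth (\<lambda>t. curve_of (p t))"
  unfolding curve_of_def[abs_def]
  by (rule csmooth_diff[OF csmooth_scaleR[OF csmooth_nderiv1[OF assms] csmooth_static[OF smooth_tangent]]
        csmooth_scaleR[OF assms csmooth_static[OF smooth_normal]]])

text \<open>Because the velocity is parallel to the tangent, it is orthogonal to the normal. Hence
  p' contains only the rotation of the frame, and a second differentiation brings in
  \<open>r\<close>, giving r = p + p''.\<close>

lemma
  assumes Y: "\<And>\<theta>. (Y has_vector_derivative r \<theta> *\<^sub>R tangent \<theta>) (at \<theta>)"
  shows support_has_derivative: "(support Y has_real_derivative inner (Y \<theta>) (tangent \<theta>)) (at \<theta>)"
    and nderiv1_support: "nderiv 1 (support Y) = (\<lambda>\<theta>. inner (Y \<theta>) (tangent \<theta>))"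
    and nderiv1_support_has_derivative: "(nderiv 1 (support Y) has_real_derivative r \<theta> - support Y \<theta>) (at \<theta>)"
    and nderiv2_support: "nderiv 2 (support Y) = (\<lambda>\<theta>. r \<theta> - support Y \<theta>)"
    and curve_of_support: "curve_of (support Y) = Y"
proof -
  have d1: "(support Y has_real_derivative inner (Y \<theta>) (tangent \<theta>)) (at \<theta>)" for \<theta>
  proof -
    have "((\<lambda>\<theta>. - inner (Y \<theta>) (normal \<theta>)) has_vector_derivative - (inner (Y \<theta>) (- tangent \<theta>) + inner (r \<theta> *\<^sub>R tangent \<theta>) (normal \<theta>))) (at \<theta>)"
      by (intro has_vector_derivative_minus bounded_bilinear.has_vector_derivative[OF bounded_bilinear_inner] Y normal_has_derivative)
    then show ?thesis by (simp add: support_def[abs_def] has_real_derivative_iff_has_vector_derivative)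
  qed
  have n1: "nderiv 1 (support Y) = (\<lambda>\<theta>. inner (Y \<theta>) (tangent \<theta>))"
    by (rule nderiv_1_eq) (use d1 in \<open>simp add: has_real_derivative_iff_has_vector_derivative\<close>)
  have d2: "(nderiv 1 (support Y) has_real_derivative r \<theta> - support Y \<theta>) (at \<theta>)" for \<theta>
  proof -
    have "((\<lambda>\<theta>. inner (Y \<theta>) (tangent \<theta>)) has_vector_derivative (inner (Y \<theta>) (normal \<theta>) + inner (r \<theta> *\<^sub>R tangent \<theta>) (tangent \<theta>))) (at \<theta>)"
      by (intro bounded_bilinear.has_vector_derivative[OF bounded_bilinear_inner] Y tangent_has_derivative)
    then show ?thesis by (simp add: n1 support_def has_real_derivative_iff_has_vector_derivative add.commute)
  qed
  have n2: "nderiv 2 (support Y) = (\<lambda>\<theta>. r \<theta> - support Y \<theta>)"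
    unfolding nderiv_2 using nderiv_1_eq[of "nderiv 1 (support Y)", OF d2[unfolded has_real_derivative_iff_has_vector_derivative]] .
  show "(support Y has_real_derivative inner (Y \<theta>) (tangent \<theta>)) (at \<theta>)"
    "nderiv 1 (support Y) = (\<lambda>\<theta>. inner (Y \<theta>) (tangent \<theta>))"
    "(nderiv 1 (support Y) has_real_derivative r \<theta> - support Y \<theta>) (at \<theta>)"
    "nderiv 2 (support Y) = (\<lambda>\<theta>. r \<theta> - support Y \<theta>)"
    by (fact d1 n1 d2 n2)+
  show "curve_of (support Y) = Y"
  proof
    fix \<theta> show "curve_of (support Y) \<theta> = Y \<theta>"
      using frame_decomposition[of "Y \<theta>" \<theta>] by (simp add: curve_of_def n1 support_def)
  qed
qed

section \<open>Sums over rotated arguments\<close>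

lemma k_sum_eq: "k_sum k m h \<theta> = (\<Sum>i<k. h (\<theta> + real i * (2 * real m * pi / real k)))"
  unfolding k_sum_def by (intro sum.cong refl arg_cong[of _ _ h]) simp

text \<open>Cyclic reindexing: the summand pushed out at the end returns at the beginning because
  \<open>k\<close> shifts make up a full period.\<close>

lemma k_sum_shift:
  assumes "k > 0" "\<And>x. h (x + 2 * real m * pi) = h x"
  shows "k_sum k m h (\<theta> + 2 * real m * pi / real k) = k_sum k m h \<theta>"
proof -
  define a where "a = 2 * real m * pi / real k"
  have ka: "real k * a = 2 * real m * pi" using assms(1) by (simp add: a_def)
  obtain j where j: "k = Suc j" using assms(1) gr0_implies_Suc by blast
  have "k_sum k m h (\<theta> + a) = (\<Sum>i<k. h (\<theta> + real (Suc i) * a))"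
    unfolding k_sum_eq a_def[symmetric] by (simp add: algebra_simps)
  also have "\<dots> = (\<Sum>i<j. h (\<theta> + real (Suc i) * a)) + h (\<theta> + real k * a)"
    by (simp add: j)
  also have "h (\<theta> + real k * a) = h \<theta>" by (simp add: ka assms(2))
  also have "(\<Sum>i<j. h (\<theta> + real (Suc i) * a)) + h \<theta> = k_sum k m h \<theta>"
    unfolding k_sum_eq a_def[symmetric] unfolding j sum.lessThan_Suc_shift by (simp add: add.commute)
  finally show ?thesis by (simp add: a_def)
qed

lemma k_sum_of_periodic:
  assumes "\<And>x. h (x + 2 * real m * pi / real k) = h x"
  shows "k_sum k m h \<theta> = real k * h \<theta>"
proof -
  have "h (\<theta> + real i * (2 * real m * pi / real k)) = h \<theta>" for i
    using periodic_int[of h "2 * real m * pi / real k" \<theta> "int i"] assms by simp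
  then show ?thesis by (simp add: k_sum_eq)
qed

lemma k_sum_add: "k_sum k m (\<lambda>x. f x + g x) \<theta> = k_sum k m f \<theta> + k_sum k m g \<theta>"
  by (simp add: k_sum_def sum.distrib)

lemma k_sum_diff: "k_sum k m (\<lambda>x. f x - g x) \<theta> = k_sum k m f \<theta> - k_sum k m g \<theta>"
  by (simp add: k_sum_def sum_subtractf)

lemma k_sum_cmult: "k_sum k m (\<lambda>x. b * f x) \<theta> = b * k_sum k m f \<theta>"
  by (simp add: k_sum_def sum_distrib_left)

lemma k_sum_const: "k_sum k m (\<lambda>x. b) \<theta> = real k * b"
  by (simp add: k_sum_def)

lemma smooth_k_sum: "smooth h \<Longrightarrow> smooth (k_sum k m h)"
  unfolding k_sum_def[abs_def] by (intro smooth_sum smooth_shift)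

lemma nderiv_k_sum: "smooth h \<Longrightarrow> nderiv n (k_sum k m h) = k_sum k m (nderiv n h)"
  unfolding k_sum_def[abs_def] by (simp add: nderiv_sum nderiv_shift smooth_shift)

declare add_2_eq_Suc [simp del] add_2_eq_Suc' [simp del]

section \<open>The evolution of the support function\<close>

locale initial_curve =
  fixes k m :: nat and X0 :: "real \<Rightarrow> complex"
  assumes k_ge_2: "k \<ge> 2" and smooth_X0: "smooth X0"
    and convex_X0: "locally_convex_curve (2 * real m * pi) X0" and angle_X0: "by_tangent_angle X0"
begin

definition "L = 2 * real m * pi"
definition "a = 2 * real m * pi / real k"
definition "p0 = support X0"
definition "r0 \<theta> = norm (nderiv 1 X0 \<theta>)"
definition "w0 = k_sum k m p0"
definition "b0 x = p0 x - 1 / real k * w0 x"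

lemma k_pos: "real k > 0" "k > 0"
  using k_ge_2 by auto

lemma L_pos: "L > 0"
  using convex_X0 by (simp add: L_def locally_convex_curve_def closed_curve_def)

lemma m_pos: "m > 0"
  using L_pos unfolding L_def by (cases m) auto

lemma a_pos: "a > 0"
  using m_pos k_pos by (simp add: a_def)

lemma L_eq: "L = real k * a"
  using k_pos by (simp add: a_def L_def)

lemma cis_periodic: "cis (x + L) = cis x"
proof -
  have "cis (x + of_int (int m) * (2 * pi)) = cis x"
    by (rule periodic_int) (simp add: complex_eq_iff)
  then show ?thesis by (simp add: L_def mult_ac)
qed

lemma tangent_periodic: "tangent (x + L) = tangent x" and normal_periodic: "normal (x + L) = normal x"
  by (simp_all add: tangent_eq_cis normal_eq_cis cis_periodic)

lemma X0_periodic: "X0 (x + L) = X0 x"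
  using convex_X0 by (simp add: L_def locally_convex_curve_def closed_curve_def)

lemma r0_pos: "r0 x > 0"
  using convex_X0 by (simp add: r0_def locally_convex_curve_def immersed_def)

lemma X0_has_derivative: "(X0 has_vector_derivative r0 x *\<^sub>R tangent x) (at x)"
proof -
  have "nderiv 1 X0 x = r0 x *\<^sub>R tangent x"
    using angle_X0 r0_pos[of x] unfolding by_tangent_angle_def tangent_angle_def r0_def
    by (metis divideR_right less_irrefl sgn_div_norm)
  then show ?thesis using smooth_has_derivative[OF smooth_X0, of 0 x] by (simp flip: One_nat_def)
qed

lemma p0_periodic: "p0 (x + L) = p0 x"
  by (simp add: p0_def support_def X0_periodic normal_periodic)

lemma smooth_p0: "smooth p0"
proof -
  have "csmooth (\<lambda>t x. - inner (X0 x) (normal x))"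
    by (intro csmooth_minus csmooth_inner csmooth_static smooth_X0 smooth_normal)
  then show ?thesis by (simp add: smooth_iff_csmooth p0_def support_def[abs_def])
qed

lemma r0_eq: "r0 x = p0 x + nderiv 2 p0 x"
  using nderiv2_support[OF X0_has_derivative] by (simp add: p0_def)

lemma smooth_w0: "smooth w0"
  unfolding w0_def by (rule smooth_k_sum[OF smooth_p0])

lemma w0_periodic: "w0 (x + a) = w0 x"
  unfolding w0_def a_def using k_pos p0_periodic by (intro k_sum_shift) (auto simp: L_def)

lemma periodic_a_imp_L: "(\<And>x. h (x + a) = h x) \<Longrightarrow> h (x + L) = (h x :: real)"
  using periodic_int[of h a x "int k"] by (simp add: L_eq)

lemma smooth_b0: "smooth b0"
  unfolding b0_def[abs_def] by (intro smooth_diff smooth_mult smooth_const smooth_p0 smooth_w0)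

lemma b0_periodic: "b0 (x + L) = b0 x"
  using periodic_a_imp_L[of w0, OF w0_periodic] by (simp add: b0_def p0_periodic)

text \<open>Summing \<open>w0\<close>, which already has period \<open>a\<close>, just multiplies it
  by \<open>k\<close>; so \<open>b0\<close> is the part of the support function with zero mean over
  the rotations.\<close>

lemma k_sum_b0: "k_sum k m b0 x = 0"
proof -
  have "k_sum k m b0 x = k_sum k m p0 x - 1 / real k * k_sum k m w0 x"
    unfolding b0_def[abs_def] by (simp only: k_sum_diff k_sum_cmult)
  also have "k_sum k m w0 x = real k * w0 x"
    by (rule k_sum_of_periodic) (use w0_periodic in \<open>simp add: a_def\<close>)
  finally show ?thesis using k_pos by (simp add: w0_def)
qed

text \<open>The damped heat flow with initial value w_k / k. It is solved on the circle of length
  \<open>a\<close> rather than \<open>L\<close>, so the symmetry of the initial value is kept at all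
  times.\<close>

definition "U = (SOME U. csmooth U \<and> U 0 = (\<lambda>x. 1 / real k * w0 x) \<and> (\<forall>t x. U t (x + a) = U t x)
    \<and> (\<forall>n. \<forall>t\<ge>0. \<forall>x. ((\<lambda>s. nderiv n (U s) x) has_real_derivative
          real k * (nderiv (n + 2) (U t) x - nderiv n (U t) x)) (at t within {0..}))
    \<and> (\<forall>n. \<exists>C. \<forall>t\<ge>0. \<forall>x. \<bar>nderiv n (U t) x\<bar> \<le> C * exp (- real k * t)))"

lemma U_spec: "csmooth U \<and> U 0 = (\<lambda>x. 1 / real k * w0 x) \<and> (\<forall>t x. U t (x + a) = U t x)
    \<and> (\<forall>n. \<forall>t\<ge>0. \<forall>x. ((\<lambda>s. nderiv n (U s) x) has_real_derivative
          real k * (nderiv (n + 2) (U t) x - nderiv n (U t) x)) (at t within {0..}))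
    \<and> (\<forall>n. \<exists>C. \<forall>t\<ge>0. \<forall>x. \<bar>nderiv n (U t) x\<bar> \<le> C * exp (- real k * t))"
  unfolding U_def
  by (rule someI_ex[OF heat_solution_exists[OF _ a_pos _ k_pos(1)]])
    (rule smooth_mult[OF smooth_const smooth_w0], simp add: w0_periodic)

lemma csmooth_U: "csmooth U"
  and U_0: "U 0 x = 1 / real k * w0 x"
  and U_periodic: "U t (x + a) = U t x"
  and U_time: "t \<ge> 0 \<Longrightarrow> ((\<lambda>s. nderiv n (U s) x) has_real_derivative
          real k * (nderiv (n + 2) (U t) x - nderiv n (U t) x)) (at t within {0..})"
  and U_decay: "\<exists>C. \<forall>t\<ge>0. \<forall>x. \<bar>nderiv n (U t) x\<bar> \<le> C * exp (- real k * t)"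
  using U_spec by auto

lemma smooth_U: "t \<ge> 0 \<Longrightarrow> smooth (U t)"
  by (rule csmooth_smooth[OF csmooth_U])

text \<open>With \<open>p\<close> the support function, \<open>b0 = p - w\<^sub>k / k\<close> is stationary and \<open>U + c\<close> is \<open>w\<^sub>k / k\<close>. The
  radius of curvature is \<open>r = g + c\<close>, and the number \<open>c t\<close> is determined by the conserved energy
  \<open>E0\<close>, the integral of \<open>1 / r\<close>.\<close>

definition "q t x = b0 x + U t x"
definition "g t x = q t x + nderiv 2 (q t) x"
definition "g' t x = real k * (nderiv 4 (U t) x - U t x)"
definition "E0 = integral {0..L} (\<lambda>x. 1 / r0 x)"

lemma csmooth_q: "csmooth q"
  using csmooth_add[OF csmooth_static[OF smooth_b0] csmooth_U] by (simp add: q_def[abs_def])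

lemma smooth_q: "t \<ge> 0 \<Longrightarrow> smooth (q t)"
  by (rule csmooth_smooth[OF csmooth_q])

lemma nderiv_q: "t \<ge> 0 \<Longrightarrow> nderiv n (q t) x = nderiv n b0 x + nderiv n (U t) x"
  unfolding q_def[abs_def] by (simp add: nderiv_add[OF smooth_b0 smooth_U])

lemma q_periodic: "q t (x + L) = q t x"
  using periodic_a_imp_L[of "U t", OF U_periodic] by (simp add: q_def b0_periodic)

lemma k_sum_q: "k_sum k m (q t) x = real k * U t x"
proof -
  have "k_sum k m (U t) x = real k * U t x"
    by (rule k_sum_of_periodic) (use U_periodic in \<open>simp add: a_def\<close>)
  then show ?thesis unfolding q_def[abs_def] by (simp add: k_sum_add k_sum_b0)
qed

lemma q_0: "q 0 = p0"
  by (auto simp: q_def b0_def U_0)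

lemma csmooth_g: "csmooth g"
  using csmooth_add[OF csmooth_q csmooth_nderiv[OF csmooth_q, of 2]] by (simp add: g_def[abs_def])

lemma g_0: "g 0 x = r0 x"
  by (simp add: g_def q_0 r0_eq)

lemma g_periodic: "t \<ge> 0 \<Longrightarrow> g t (x + L) = g t x"
  by (simp add: g_def q_periodic nderiv_periodic[OF smooth_q q_periodic])

lemma g_has_time_derivative:
  assumes t: "t \<ge> 0" shows "((\<lambda>s. g s x) has_real_derivative g' t x) (at t within {0..})"
proof -
  have "((\<lambda>s. (b0 x + nderiv 0 (U s) x) + (nderiv 2 b0 x + nderiv 2 (U s) x)) has_real_derivative
     (0 + real k * (nderiv (0 + 2) (U t) x - nderiv 0 (U t) x)) + (0 + real k * (nderiv (2 + 2) (U t) x - nderiv 2 (U t) x)))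
     (at t within {0..})"
    by (intro DERIV_add DERIV_const U_time t)
  \<comment> \<open>The second derivatives from k (U'' - U) and k (U'''' - U'') cancel.\<close>
  moreover have "(0 + real k * (nderiv (0 + 2) (U t) x - nderiv 0 (U t) x)) + (0 + real k * (nderiv (2 + 2) (U t) x - nderiv 2 (U t) x)) = g' t x"
    by (simp add: g'_def algebra_simps)
  ultimately have "((\<lambda>s. (b0 x + nderiv 0 (U s) x) + (nderiv 2 b0 x + nderiv 2 (U s) x)) has_real_derivative g' t x) (at t within {0..})"
    by (simp only:)
  then show ?thesis
    unfolding has_real_derivative_iff_has_vector_derivative by (rule has_vector_derivative_transform[rotated 2]) (use t in \<open>auto simp: g_def nderiv_q q_def\<close>)
qed

lemma csmooth_g': "csmooth g'"
  unfolding g'_def[abs_def]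
  by (rule csmooth_mult[OF csmooth_const csmooth_diff[OF csmooth_nderiv[OF csmooth_U] csmooth_U]])

lemma U_bounded: "\<exists>C. \<forall>t\<ge>0. \<forall>x. \<bar>nderiv n (U t) x\<bar> \<le> C"
proof -
  obtain C where C: "\<And>t x. t \<ge> 0 \<Longrightarrow> \<bar>nderiv n (U t) x\<bar> \<le> C * exp (- real k * t)" using U_decay by blast
  have C0: "C \<ge> 0" using C[of 0 0] by simp
  have "\<bar>nderiv n (U t) x\<bar> \<le> C" if "t \<ge> 0" for t x
  proof -
    have "C * exp (- real k * t) \<le> C * 1" using C0 that by (intro mult_left_mono) auto
    with C[OF that, of x] show ?thesis by simp
  qed
  then show ?thesis by blast
qed

lemma q_bounded: "\<exists>C. \<forall>t\<ge>0. \<forall>x. \<bar>nderiv n (q t) x\<bar> \<le> C"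
proof -
  obtain C where C: "\<And>t x. t \<ge> 0 \<Longrightarrow> \<bar>nderiv n (U t) x\<bar> \<le> C" using U_bounded by blast
  obtain K where K: "\<And>x. \<bar>nderiv n b0 x\<bar> \<le> K"
    using smooth_periodic_nderiv_bounded[OF smooth_b0 L_pos b0_periodic] by blast
  have "\<bar>nderiv n (q t) x\<bar> \<le> K + C" if "t \<ge> 0" for t x
    using C[OF that, of x] K[of x] by (simp add: nderiv_q[OF that])
  then show ?thesis by blast
qed

lemma nderiv_g:
  assumes "t \<ge> 0" shows "nderiv n (g t) x = nderiv n (q t) x + nderiv (n + 2) (q t) x"
  unfolding g_def[abs_def]
  using nderiv_add[OF smooth_q[OF assms] smooth_nderiv[OF smooth_q[OF assms], of 2], of n]
  by (simp add: nderiv_add_index)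

lemma g_bounded: "\<exists>C. \<forall>t\<ge>0. \<forall>x. \<bar>nderiv n (g t) x\<bar> \<le> C"
proof -
  obtain C1 C2 where C: "\<And>t x. t \<ge> 0 \<Longrightarrow> \<bar>nderiv n (q t) x\<bar> \<le> C1" "\<And>t x. t \<ge> 0 \<Longrightarrow> \<bar>nderiv (n + 2) (q t) x\<bar> \<le> C2"
    using q_bounded[of n] q_bounded[of "n + 2"] by blast
  have "\<bar>nderiv n (g t) x\<bar> \<le> C1 + C2" if "t \<ge> 0" for t x
    using C(1)[OF that, of x] C(2)[OF that, of x] by (simp add: nderiv_g[OF that])
  then show ?thesis by blast
qed

lemma g_lipschitz: "\<exists>M>0. \<forall>t\<ge>0. \<forall>x y. \<bar>g t x - g t y\<bar> \<le> M * \<bar>x - y\<bar>"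
proof -
  obtain C where C: "\<And>t x. t \<ge> 0 \<Longrightarrow> \<bar>nderiv 1 (g t) x\<bar> \<le> C" using g_bounded by blast
  have "C \<ge> 0" using C[of 0 0] by linarith
  moreover have "\<bar>g t x - g t y\<bar> \<le> (C + 1) * \<bar>x - y\<bar>" if t: "t \<ge> 0" for t x y
  proof (rule lipschitz_of_bounded_derivative)
    show "(g t has_real_derivative nderiv 1 (g t) x) (at x)" for x
      using csmooth_has_derivative1[OF csmooth_g t] by (simp add: has_real_derivative_iff_has_vector_derivative)
    show "\<bar>nderiv 1 (g t) x\<bar> \<le> C + 1" for x using C[OF t, of x] by simp
  qed
  ultimately show ?thesis by (intro exI[of _ "C + 1"]) auto
qed

lemma g_continuous: "t \<ge> 0 \<Longrightarrow> continuous_on S (g t)"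
  using smooth_continuous_nderiv[OF csmooth_smooth[OF csmooth_g], of t S 0] by simp

lemma E0_pos: "E0 > 0"
  unfolding E0_def
proof (rule integral_positive[OF _ L_pos])
  have "continuous_on {0..L} r0" using g_continuous[of 0 "{0..L}"] by (simp add: g_0 cong: continuous_on_cong)
  then show "continuous_on {0..L} (\<lambda>x. 1 / r0 x)"
    using r0_pos by (intro continuous_intros) (auto simp: less_imp_neq[THEN not_sym])
qed (simp add: r0_pos)

definition "c t = (SOME c. (\<forall>x. g t x + c > 0) \<and> integral {0..L} (\<lambda>x. 1 / (g t x + c)) = E0)"

lemma c_spec:
  assumes t: "t \<ge> 0"
  shows "(\<forall>x. g t x + c t > 0) \<and> integral {0..L} (\<lambda>x. 1 / (g t x + c t)) = E0"
proof -
  obtain M where M: "M > 0" "\<And>x y. \<bar>g t x - g t y\<bar> \<le> M * \<bar>x - y\<bar>" using g_lipschitz t by blast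
  have "\<exists>c. (\<forall>x. g t x + c > 0) \<and> integral {0..L} (\<lambda>x. 1 / (g t x + c)) = E0"
    by (rule translation_exists[OF L_pos M g_continuous[OF t] g_periodic[OF t] E0_pos])
  then show ?thesis unfolding c_def by (rule someI_ex)
qed

text \<open>\<open>translation_bound\<close> for the same function \<open>g t\<close> twice, with
  error 0.\<close>

lemma c_unique:
  assumes "t \<ge> 0" "\<And>x. g t x + C > 0" "integral {0..L} (\<lambda>x. 1 / (g t x + C)) = E0"
  shows "C = c t"
proof -
  have "\<bar>C - c t\<bar> \<le> 0"
    by (rule translation_bound[OF L_pos, of "g t" "g t"]) (use assms c_spec g_continuous in auto)
  then show ?thesis by simp
qed

lemma c_0: "c 0 = 0"
  by (rule c_unique[symmetric]) (auto simp: g_0 r0_pos E0_def)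

definition "r t x = g t x + c t"
definition "c' t = - integral {0..L} (\<lambda>x. g' t x / (r t x)\<^sup>2) / integral {0..L} (\<lambda>x. 1 / (r t x)\<^sup>2)"

lemma r_pos: "t \<ge> 0 \<Longrightarrow> r t x > 0" and r_integral: "t \<ge> 0 \<Longrightarrow> integral {0..L} (\<lambda>x. 1 / r t x) = E0"
  using c_spec by (auto simp: r_def)

text \<open>The bound is uniform in time because the Lipschitz constant of \<open>g t\<close> is,
  and the integral of the reciprocal is always \<open>E0\<close>.\<close>

lemma r_lower_bound: "\<exists>\<delta>>0. \<forall>t\<ge>0. \<forall>x. r t x \<ge> \<delta>"
proof -
  obtain M where M: "M > 0" "\<And>t x y. t \<ge> 0 \<Longrightarrow> \<bar>g t x - g t y\<bar> \<le> M * \<bar>x - y\<bar>" using g_lipschitz by blast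
  have e: "exp (M * E0) - 1 > 0" using M E0_pos by simp
  have "r t x \<ge> M * L / (exp (M * E0) - 1)" if t: "t \<ge> 0" for t x
  proof -
    have "M * L \<le> r t x * (exp (M * E0) - 1)"
      by (rule lower_bound_from_reciprocal_integral[OF L_pos M(1)])
        (use t M(2) r_pos r_integral g_periodic in \<open>auto simp: r_def\<close>)
    then show ?thesis using e by (simp add: field_simps)
  qed
  moreover have "M * L / (exp (M * E0) - 1) > 0" using e M L_pos by simp
  ultimately show ?thesis by blast
qed

lemma c_has_derivative: "t \<ge> 0 \<Longrightarrow> (c has_real_derivative c' t) (at t within {0..})"
  unfolding c'_def r_def
  by (rule translation_has_derivative[OF L_pos g_has_time_derivative csmooth_continuous[OF csmooth_g] csmooth_continuous[OF csmooth_g']])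
    (use c_spec in auto)

lemma c_continuous: "continuous_on {0..} c"
  using c_has_derivative by (auto intro!: DERIV_continuous_on)

lemma csmooth_r: "csmooth r"
  unfolding r_def[abs_def] by (rule csmooth_add[OF csmooth_g csmooth_const_space[OF c_continuous]])

lemma r_continuous: "t \<ge> 0 \<Longrightarrow> continuous_on S (r t)"
  using smooth_continuous_nderiv[OF csmooth_smooth[OF csmooth_r], of t S 0] by simp

lemma r_periodic: "t \<ge> 0 \<Longrightarrow> r t (x + L) = r t x"
  by (simp add: r_def g_periodic)

lemma c'_continuous: "continuous_on {0..} c'"
proof -
  have cr: "continuous_on ({0..} \<times> {0..L}) (\<lambda>z. r (fst z) (snd z))"
    by (rule continuous_on_subset[OF csmooth_continuous[OF csmooth_r, unfolded case_prod_unfold]]) auto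
  have cg: "continuous_on ({0..} \<times> {0..L}) (\<lambda>z. g' (fst z) (snd z))"
    by (rule continuous_on_subset[OF csmooth_continuous[OF csmooth_g', unfolded case_prod_unfold]]) auto
  have nz: "r t x \<noteq> 0" if "t \<ge> 0" for t x using r_pos[OF that, of x] by simp
  have 1: "continuous_on {0..} (\<lambda>t. integral {0..L} (\<lambda>x. g' t x / (r t x)\<^sup>2))"
    by (rule continuous_on_space_integral, unfold case_prod_unfold, intro continuous_intros cr cg) (auto simp: nz)
  have 2: "continuous_on {0..} (\<lambda>t. integral {0..L} (\<lambda>x. 1 / (r t x)\<^sup>2))"
    by (rule continuous_on_space_integral, unfold case_prod_unfold, intro continuous_intros cr) (auto simp: nz)
  have "integral {0..L} (\<lambda>x. 1 / (r t x)\<^sup>2) > 0" if "t \<ge> 0" for t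
    by (rule integral_positive[OF _ L_pos], intro continuous_intros r_continuous that) (use nz that in \<open>auto simp: nz\<close>)
  then show ?thesis unfolding c'_def by (intro continuous_intros 1 2) (auto simp: less_imp_neq[THEN not_sym])
qed

section \<open>The evolving support function, its curve and its normal speed\<close>

definition "p t x = q t x + c t"
definition "V t x = real k * (U t x - nderiv 2 (U t) x) - c' t"
definition "Y t = curve_of (p t)"

lemma csmooth_p: "csmooth p"
  unfolding p_def[abs_def] by (rule csmooth_add[OF csmooth_q csmooth_const_space[OF c_continuous]])

lemma csmooth_V: "csmooth V"
  unfolding V_def[abs_def]
  by (intro csmooth_diff csmooth_mult csmooth_const csmooth_const_space c'_continuous csmooth_nderiv csmooth_U)

lemma csmooth_Y: "csmooth Y"
  unfolding Y_def[abs_def] by (rule csmooth_curve_of[OF csmooth_p])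

lemma nderiv_p: "t \<ge> 0 \<Longrightarrow> nderiv n (p t) x = nderiv n (q t) x + (if n = 0 then c t else 0)"
  unfolding p_def[abs_def] by (simp add: nderiv_add[OF smooth_q smooth_const] nderiv_const)

lemma p_periodic: "p t (x + L) = p t x"
  by (simp add: p_def q_periodic)

lemma r_eq: "t \<ge> 0 \<Longrightarrow> r t x = p t x + nderiv 2 (p t) x"
  by (simp add: r_def g_def nderiv_p) (simp add: p_def)

lemma Y_has_derivative:
  assumes t: "t \<ge> 0" shows "(Y t has_vector_derivative r t x *\<^sub>R tangent x) (at x)"
  unfolding Y_def r_eq[OF t]
  using csmooth_has_derivative[OF csmooth_p t, of 0] csmooth_has_derivative[OF csmooth_p t, of 1]
  by (intro curve_of_has_derivative)
    (auto simp: has_real_derivative_iff_has_vector_derivative Suc_1 simp flip: One_nat_def)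

lemma Y_periodic:
  assumes t: "t \<ge> 0" shows "Y t (x + L) = Y t x"
  using nderiv_periodic[OF csmooth_smooth[OF csmooth_p t] p_periodic]
  by (simp add: Y_def curve_of_def tangent_periodic normal_periodic p_periodic)

lemma support_Y: "support (Y t) = p t"
  by (simp add: Y_def support_curve_of)

lemma Y_0: "Y 0 = X0"
proof -
  have "p 0 = p0" by (auto simp: p_def q_0 c_0)
  then show ?thesis using curve_of_support[OF X0_has_derivative] by (simp add: Y_def p0_def)
qed

text \<open>Stated for an arbitrary admissible translation \<open>C\<close>: in the uniqueness proof
  the formulas are applied before \<open>C\<close> is known to be \<open>c t\<close>.\<close>

lemma
  assumes t: "t \<ge> 0" and pos: "\<And>x. g t x + C > 0"
  shows k_sum_radius: "k_sum k m (\<lambda>x. 1 / (1 / (g t x + C))) x = real k * (U t x + nderiv 2 (U t) x) + real k * C"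
    and nonlocal_term_eq: "nonlocal_term k m (\<lambda>x. 1 / (g t x + C)) =
      integral {0..L} (\<lambda>x. g' t x / (g t x + C)\<^sup>2) / integral {0..L} (\<lambda>x. 1 / (g t x + C)\<^sup>2) - real k * C"
proof -
  have kg: "k_sum k m (g t) x = real k * (U t x + nderiv 2 (U t) x)" for x
  proof -
    have "k_sum k m (q t) = (\<lambda>x. real k * U t x)" by (auto simp: k_sum_q)
    moreover have "k_sum k m (nderiv 2 (q t)) = nderiv 2 (k_sum k m (q t))"
      using nderiv_k_sum[OF smooth_q[OF t]] by simp
    ultimately show ?thesis
      unfolding g_def[abs_def] by (simp add: k_sum_add nderiv_cmult[OF smooth_U[OF t]] distrib_left)
  qed
  show ks: "k_sum k m (\<lambda>x. 1 / (1 / (g t x + C))) x = real k * (U t x + nderiv 2 (U t) x) + real k * C" for x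
    by (simp add: k_sum_add kg k_sum_const)
  let ?K = "\<lambda>x. 1 / (g t x + C)"
  let ?R = "\<lambda>x. real k * (U t x + nderiv 2 (U t) x) + real k * C"
  have nz: "g t x + C \<noteq> 0" for x using pos[of x] by simp
  have sU: "smooth (\<lambda>x. U t x + nderiv 2 (U t) x)" by (intro smooth_add smooth_U smooth_nderiv t)
  have "nderiv 2 ?R x = real k * (nderiv 2 (U t) x + nderiv 4 (U t) x)" for x
    by (simp add: nderiv_add nderiv_cmult smooth_mult smooth_const sU smooth_U smooth_nderiv t nderiv_const flip: nderiv_add_index)
  then have R2: "nderiv 2 ?R = (\<lambda>x. real k * (nderiv 2 (U t) x + nderiv 4 (U t) x))" by auto
  have cU: "continuous_on S (nderiv n (U t))" for n S by (rule smooth_continuous_nderiv[OF smooth_U[OF t]])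
  have cU0: "continuous_on S (U t)" for S using cU[of S 0] by simp
  have cg': "continuous_on S (g' t)" for S unfolding g'_def[abs_def] by (intro continuous_intros cU cU0)
  have cg: "continuous_on S (g t)" for S by (rule g_continuous[OF t])
  have "integral {0..L} (\<lambda>x. (?K x)\<^sup>2 * nderiv 2 ?R x) - integral {0..L} (\<lambda>x. (?K x)\<^sup>2 * ?R x)
      = integral {0..L} (\<lambda>x. (?K x)\<^sup>2 * nderiv 2 ?R x - (?K x)\<^sup>2 * ?R x)"
    unfolding R2 using nz
    by (intro Henstock_Kurzweil_Integration.integral_diff[symmetric] integrable_continuous_real continuous_intros cU cU0 cg) auto
  \<comment> \<open>With rho_k = k (U + U'') + k C, the difference rho_k'' - rho_k is k (U'''' - U)
    - k C = g' - k C.\<close>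
  also have "\<dots> = integral {0..L} (\<lambda>x. g' t x / (g t x + C)\<^sup>2 - real k * C * (1 / (g t x + C)\<^sup>2))"
    unfolding R2 g'_def
    by (intro Henstock_Kurzweil_Integration.integral_cong) (simp add: power_divide algebra_simps add_divide_distrib diff_divide_distrib)
  also have "\<dots> = integral {0..L} (\<lambda>x. g' t x / (g t x + C)\<^sup>2) - integral {0..L} (\<lambda>x. real k * C * (1 / (g t x + C)\<^sup>2))"
    using nz by (intro Henstock_Kurzweil_Integration.integral_diff integrable_continuous_real continuous_intros cg cg') auto
  also have "integral {0..L} (\<lambda>x. real k * C * (1 / (g t x + C)\<^sup>2)) = real k * C * integral {0..L} (\<lambda>x. 1 / (g t x + C)\<^sup>2)"
    by (rule integral_mult_right)
  finally have *: "integral {0..L} (\<lambda>x. (?K x)\<^sup>2 * nderiv 2 ?R x) - integral {0..L} (\<lambda>x. (?K x)\<^sup>2 * ?R x) =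
     integral {0..L} (\<lambda>x. g' t x / (g t x + C)\<^sup>2) - real k * C * integral {0..L} (\<lambda>x. 1 / (g t x + C)\<^sup>2)" .
  have pos2: "integral {0..L} (\<lambda>x. 1 / (g t x + C)\<^sup>2) > 0"
    by (rule integral_positive[OF _ L_pos], intro continuous_intros cg) (use nz in auto)
  have R: "k_sum k m (\<lambda>\<theta>. 1 / ?K \<theta>) = ?R" using ks by auto
  show "nonlocal_term k m (\<lambda>x. 1 / (g t x + C)) =
      integral {0..L} (\<lambda>x. g' t x / (g t x + C)\<^sup>2) / integral {0..L} (\<lambda>x. 1 / (g t x + C)\<^sup>2) - real k * C"
    unfolding nonlocal_term_def Let_def R L_def[symmetric] *
    using pos2 by (simp add: power_divide diff_divide_distrib)
qed

text \<open>The contributions 2 k c, - k c and - k c of the translation to 2 w_k, - rho_k and f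
  cancel; what is left of it is - c'.\<close>

lemma normal_speed_eq:
  assumes t: "t \<ge> 0" shows "normal_speed k m (p t) (\<lambda>x. 1 / r t x) x = V t x"
proof -
  have "k_sum k m (p t) x = real k * U t x + real k * c t"
    unfolding p_def[abs_def] by (simp add: k_sum_add k_sum_q k_sum_const)
  moreover have "nonlocal_term k m (\<lambda>x. 1 / r t x) = - c' t - real k * c t"
    unfolding r_def using nonlocal_term_eq[OF t, of "c t"] c_spec[OF t] by (simp add: c'_def r_def)
  moreover have "k_sum k m (\<lambda>x. 1 / (1 / r t x)) x = real k * (U t x + nderiv 2 (U t) x) + real k * c t"
    unfolding r_def using k_sum_radius[OF t, of "c t"] c_spec[OF t] by simp
  ultimately show ?thesis by (simp add: normal_speed_def V_def algebra_simps)
qed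

text \<open>At fixed angle p decreases at the normal speed, in accordance with p = - <X, N>. All
  spatial orders are included, as the first derivative of p enters the curve.\<close>

lemma p_has_time_derivative:
  assumes t: "t \<ge> 0" shows "((\<lambda>s. nderiv n (p s) x) has_real_derivative - nderiv n (V t) x) (at t within {0..})"
proof -
  have V: "nderiv n (V t) x = real k * (nderiv n (U t) x - nderiv (n + 2) (U t) x) - (if n = 0 then c' t else 0)"
  proof -
    have s: "smooth (\<lambda>x. U t x - nderiv 2 (U t) x)" by (intro smooth_diff smooth_U smooth_nderiv t)
    show ?thesis
      unfolding V_def[abs_def]
      by (simp add: nderiv_diff nderiv_cmult s smooth_mult smooth_const smooth_U smooth_nderiv t nderiv_const nderiv_add_index)
  qed
  have "((\<lambda>s. if n = 0 then c s else 0) has_real_derivative (if n = 0 then c' t else 0)) (at t within {0..})"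
    using c_has_derivative[OF t] by (cases "n = 0") auto
  then have "((\<lambda>s. nderiv n b0 x + nderiv n (U s) x + (if n = 0 then c s else 0)) has_real_derivative
      0 + real k * (nderiv (n + 2) (U t) x - nderiv n (U t) x) + (if n = 0 then c' t else 0)) (at t within {0..})"
    by (intro DERIV_add DERIV_const U_time t)
  then have "((\<lambda>s. nderiv n b0 x + nderiv n (U s) x + (if n = 0 then c s else 0)) has_real_derivative - nderiv n (V t) x) (at t within {0..})"
    by (simp add: V algebra_simps)
  then show ?thesis
    unfolding has_real_derivative_iff_has_vector_derivative by (rule has_vector_derivative_transform[rotated 2]) (use t in \<open>auto simp: nderiv_p nderiv_q\<close>)
qed

end

section \<open>Existence of the flow\<close>

text \<open>Chain rule with a time derivative at the single point \<open>\<theta> t\<close>: the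
  increment is split at \<open>F s (\<theta> t)\<close>, and the spatial part is handled by the
  continuous difference quotient.\<close>

lemma has_derivative_along_curve:
  fixes F :: "real \<Rightarrow> real \<Rightarrow> real"
  assumes F: "csmooth F" and t: "t \<ge> 0"
    and d: "((\<lambda>s. F s (\<theta> t)) has_real_derivative D) (at t within {0..})"
    and \<theta>: "(\<theta> has_real_derivative \<theta>') (at t within {0..})" "continuous_on {0..} \<theta>"
  shows "((\<lambda>s. F s (\<theta> s)) has_real_derivative D + nderiv 1 (F t) (\<theta> t) * \<theta>') (at t within {0..})"
proof -
  obtain Q where Q: "continuous_on ({0..} \<times> UNIV) (\<lambda>(t, z). Q t (fst z) (snd z))"
    "\<And>t x y. t \<ge> 0 \<Longrightarrow> F t y - F t x = (y - x) * Q t x y"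
    "\<And>t x. Q t x x = nderiv 1 (F t) x"
    using spatial_difference_quotient[OF F] by blast
  have "continuous_on {0..} (\<lambda>s. (\<lambda>s z. Q s (fst z) (snd z)) s (\<theta> t, \<theta> s))"
    by (rule continuous_on_time_slice[OF Q(1)]) (auto intro!: continuous_intros \<theta>(2))
  then have c: "((\<lambda>s. Q s (\<theta> t) (\<theta> s)) \<longlongrightarrow> nderiv 1 (F t) (\<theta> t)) (at t within {0..})"
    using t by (simp add: continuous_on Q(3)[symmetric])
  have "((\<lambda>s. Q s (\<theta> t) (\<theta> s) * ((\<theta> s - \<theta> t) / (s - t))) \<longlongrightarrow> nderiv 1 (F t) (\<theta> t) * \<theta>') (at t within {0..})"
    by (intro tendsto_mult c) (use \<theta>(1) in \<open>simp add: has_field_derivative_iff\<close>)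
  moreover have "\<forall>\<^sub>F s in at t within {0..}. Q s (\<theta> t) (\<theta> s) * ((\<theta> s - \<theta> t) / (s - t)) = ((F s (\<theta> s) - F s (\<theta> t)) - (F t (\<theta> t) - F t (\<theta> t))) / (s - t)"
    unfolding eventually_at_topological by (intro exI[of _ UNIV]) (auto simp: Q(2))
  ultimately have "((\<lambda>s. F s (\<theta> s) - F s (\<theta> t)) has_real_derivative nderiv 1 (F t) (\<theta> t) * \<theta>') (at t within {0..})"
    unfolding has_field_derivative_iff by (rule Lim_transform_eventually)
  from DERIV_add[OF d this] show ?thesis by simp
qed

text \<open>The order of differentiation is exchanged by writing X as its initial value plus a time
  integral of \<open>G\<close>, which may be differentiated in space under the integral
  sign.\<close>

lemma nderiv_has_time_derivative:
  fixes X G :: "real \<Rightarrow> real \<Rightarrow> 'a::euclidean_space"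
  assumes G: "csmooth G" and X: "\<And>t u. t \<ge> 0 \<Longrightarrow> ((\<lambda>s. X s u) has_vector_derivative G t u) (at t within {0..})"
    and X0: "smooth (X 0)" and t: "t \<ge> 0"
  shows "((\<lambda>s. nderiv n (X s) u) has_vector_derivative nderiv n (G t) u) (at t within {0..})"
proof -
  have eq: "X s = (\<lambda>u. X 0 u + integral {0..s} (\<lambda>s. G s u))" if "s \<ge> 0" for s
  proof
    fix u
    have "((\<lambda>s. G s u) has_integral (X s u - X 0 u)) {0..s}"
      by (rule fundamental_theorem_of_calculus[OF that])
        (auto intro: has_vector_derivative_within_subset[OF X])
    then show "X s u = X 0 u + integral {0..s} (\<lambda>s. G s u)" by (simp add: integral_unique)
  qed
  have n: "nderiv n (X s) u = nderiv n (X 0) u + integral {0..s} (\<lambda>s. nderiv n (G s) u)" if s: "s \<ge> 0" for s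
  proof -
    have "smooth (\<lambda>u. integral {0..s} (\<lambda>s. G s u))"
      by (rule csmooth_smooth[OF csmooth_time_integral[OF G] s])
    then show ?thesis
      by (subst eq[OF s]) (simp add: nderiv_add[OF X0] nderiv_time_integral[OF G s])
  qed
  have "((\<lambda>s. nderiv n (X 0) u + integral {0..s} (\<lambda>s. nderiv n (G s) u)) has_vector_derivative 0 + nderiv n (G t) u) (at t within {0..})"
    by (rule has_vector_derivative_add[OF has_vector_derivative_const
        time_integral_has_time_derivative[OF csmooth_continuous_time[OF csmooth_nderiv[OF G]] t]])
  then have "((\<lambda>s. nderiv n (X s) u) has_vector_derivative 0 + nderiv n (G t) u) (at t within {0..})"
    by (rule has_vector_derivative_transform[rotated 2, of _ _ t "{0..}"]) (use t in \<open>auto intro: n\<close>)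
  then show ?thesis by simp
qed

lemma at_within_atLeast_neq_bot: "t \<ge> 0 \<Longrightarrow> at t within {0..} \<noteq> (bot :: real filter)"
proof -
  assume "t \<ge> 0"
  have "t islimpt {t<..<t+1}" by (rule islimpt_greaterThanLessThan1) simp
  then have "t islimpt {0..}" by (rule islimpt_subset) (use \<open>t \<ge> 0\<close> in auto)
  then show ?thesis by (simp add: trivial_limit_within)
qed

lemma time_dom_infinity: "time_dom \<infinity> = {0..}"
  by (auto simp: time_dom_def)

context initial_curve
begin

lemma V_periodic: "t \<ge> 0 \<Longrightarrow> V t (x + L) = V t x"
  using periodic_a_imp_L[of "U t", OF U_periodic]
  by (simp add: V_def nderiv_periodic[OF smooth_U])

text \<open>The tangent angle of a point moving with normal velocity \<open>V\<close> changes at the rate \<open>V' / r\<close>.\<close>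

definition "F t x = nderiv 1 (V t) x * inverse (r t x)"

lemma csmooth_F: "csmooth F"
  unfolding F_def[abs_def]
  by (rule csmooth_mult[OF csmooth_nderiv1[OF csmooth_V] csmooth_inverse[OF csmooth_r]])
    (use r_pos in \<open>metis less_irrefl\<close>)

lemma F_periodic: "t \<ge> 0 \<Longrightarrow> F t (x + L) = F t x"
  by (simp add: F_def r_periodic nderiv_periodic[OF csmooth_smooth[OF csmooth_V] V_periodic])

lemma nderiv_V:
  assumes t: "t \<ge> 0" and n: "n > 0"
  shows "nderiv n (V t) x = real k * (nderiv n (U t) x - nderiv (n + 2) (U t) x)"
proof -
  have s: "smooth (\<lambda>x. U t x - nderiv 2 (U t) x)" by (intro smooth_diff smooth_U smooth_nderiv t)
  show ?thesis
    using n unfolding V_def[abs_def]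
    by (simp add: nderiv_diff nderiv_cmult s smooth_mult smooth_const smooth_U smooth_nderiv t nderiv_const nderiv_add_index)
qed

text \<open>Differentiation in space removes \<open>c'\<close>, so the bounds for \<open>U\<close>
  suffice; hence the restriction to positive orders.\<close>

lemma V_derivative_bounded:
  assumes n: "n > 0" shows "\<exists>C. \<forall>t\<ge>0. \<forall>x. \<bar>nderiv n (V t) x\<bar> \<le> C"
proof -
  obtain C1 C2 where C: "\<And>t x. t \<ge> 0 \<Longrightarrow> \<bar>nderiv n (U t) x\<bar> \<le> C1" "\<And>t x. t \<ge> 0 \<Longrightarrow> \<bar>nderiv (n + 2) (U t) x\<bar> \<le> C2"
    using U_bounded[of n] U_bounded[of "n + 2"] by blast
  have "\<bar>nderiv n (V t) x\<bar> \<le> real k * (C1 + C2)" if t: "t \<ge> 0" for t x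
    unfolding nderiv_V[OF t n] abs_mult
    using C(1)[OF t, of x] C(2)[OF t, of x] by (intro mult_mono) auto
  then show ?thesis by blast
qed

text \<open>Bounds uniform in time, resting on the lower bound for \<open>r\<close>. They make the
  angle equation globally Lipschitz, so it is solvable on the whole half-line.\<close>

lemma F_bounded: "\<exists>C. \<forall>t\<ge>0. \<forall>x. \<bar>F t x\<bar> \<le> C \<and> \<bar>nderiv 1 (F t) x\<bar> \<le> C"
proof -
  obtain V1 where V1: "\<And>t x. t \<ge> 0 \<Longrightarrow> \<bar>nderiv 1 (V t) x\<bar> \<le> V1" using V_derivative_bounded[of 1] by auto
  obtain V2 where V2: "\<And>t x. t \<ge> 0 \<Longrightarrow> \<bar>nderiv 2 (V t) x\<bar> \<le> V2" using V_derivative_bounded[of 2] by auto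
  obtain R where R: "\<And>t x. t \<ge> 0 \<Longrightarrow> \<bar>nderiv 1 (g t) x\<bar> \<le> R" using g_bounded by blast
  obtain \<delta> where \<delta>: "\<delta> > 0" "\<And>t x. t \<ge> 0 \<Longrightarrow> r t x \<ge> \<delta>" using r_lower_bound by blast
  have nn: "V1 \<ge> 0" "V2 \<ge> 0" "R \<ge> 0" using V1[of 0 0] V2[of 0 0] R[of 0 0] by linarith+
  have inv: "\<bar>inverse (r t x)\<bar> \<le> inverse \<delta>" if "t \<ge> 0" for t x
    using le_imp_inverse_le[OF \<delta>(2)[OF that] \<delta>(1)] r_pos[OF that, of x] by simp
  have 1: "\<bar>F t x\<bar> \<le> V1 * inverse \<delta>" if t: "t \<ge> 0" for t x
    unfolding F_def abs_mult by (intro mult_mono V1 inv t) (use nn in auto)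
  have 2: "\<bar>nderiv 1 (F t) x\<bar> \<le> V2 * inverse \<delta> + V1 * (R * (inverse \<delta> * inverse \<delta>))" if t: "t \<ge> 0" for t x
  proof -
    have "nderiv 1 (r t) x = nderiv 1 (g t) x"
      unfolding r_def[abs_def] using nderiv_add[OF csmooth_smooth[OF csmooth_g t] smooth_const] by (simp add: nderiv_const)
    then have r': "(r t has_real_derivative nderiv 1 (g t) x) (at x)"
      using csmooth_has_derivative1[OF csmooth_r t, of x] by (simp add: has_real_derivative_iff_has_vector_derivative)
    have V': "(nderiv 1 (V t) has_real_derivative nderiv 2 (V t) x) (at x)"
      using csmooth_has_derivative[OF csmooth_V t, of 1 x] by (simp add: has_real_derivative_iff_has_vector_derivative Suc_1)
    have nz: "r t x \<noteq> 0" using r_pos[OF t, of x] by simp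
    from DERIV_mult[OF V' DERIV_inverse_fun[OF r' nz]]
    have d: "(F t has_real_derivative (nderiv 2 (V t) x * inverse (r t x) + - (inverse (r t x) * nderiv 1 (g t) x * inverse (r t x)) * nderiv 1 (V t) x)) (at x)"
      by (simp add: F_def[abs_def] mult_ac)
    have "nderiv 1 (F t) x = nderiv 2 (V t) x * inverse (r t x) - nderiv 1 (V t) x * (nderiv 1 (g t) x * (inverse (r t x) * inverse (r t x)))"
      using vector_derivative_at[OF d[unfolded has_real_derivative_iff_has_vector_derivative]]
      by (simp add: nderiv_1 mult_ac)
    moreover have "\<bar>nderiv 2 (V t) x * inverse (r t x)\<bar> \<le> V2 * inverse \<delta>"
      unfolding abs_mult by (intro mult_mono V2 inv t) (use nn in auto)
    moreover have "\<bar>nderiv 1 (V t) x * (nderiv 1 (g t) x * (inverse (r t x) * inverse (r t x)))\<bar> \<le> V1 * (R * (inverse \<delta> * inverse \<delta>))"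
      unfolding abs_mult by (intro mult_mono V1 R inv t) (use nn \<delta> in auto)
    ultimately show ?thesis by linarith
  qed
  show ?thesis
    by (rule exI[of _ "max (V1 * inverse \<delta>) (V2 * inverse \<delta> + V1 * (R * (inverse \<delta> * inverse \<delta>)))"])
      (use 1 2 in \<open>auto simp: le_max_iff_disj\<close>)
qed

text \<open>Differentiating p' T - p N along \<open>\<theta>\<close> gives V N plus a tangential
  term with coefficient r F - V', which is zero by the choice of \<open>F\<close>. So the motion is
  purely normal.\<close>

lemma Y_along_curve:
  assumes t: "t \<ge> 0" and \<theta>: "\<And>t. t \<ge> 0 \<Longrightarrow> (\<theta> has_real_derivative F t (\<theta> t)) (at t within {0..})"
  shows "((\<lambda>s. Y s (\<theta> s)) has_vector_derivative V t (\<theta> t) *\<^sub>R normal (\<theta> t)) (at t within {0..})"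
proof -
  have c: "continuous_on {0..} \<theta>" using \<theta> by (auto intro!: DERIV_continuous_on)
  have v: "(\<theta> has_vector_derivative F t (\<theta> t)) (at t within {0..})"
    using \<theta>[OF t] by (simp add: has_real_derivative_iff_has_vector_derivative)
  have d0: "((\<lambda>s. p s (\<theta> s)) has_real_derivative - V t (\<theta> t) + nderiv 1 (p t) (\<theta> t) * F t (\<theta> t)) (at t within {0..})"
    using p_has_time_derivative[OF t, of 0 "\<theta> t"] by (intro has_derivative_along_curve[OF csmooth_p t _ \<theta>[OF t] c]) simp
  have d1: "((\<lambda>s. nderiv 1 (p s) (\<theta> s)) has_real_derivative - nderiv 1 (V t) (\<theta> t) + nderiv 1 (nderiv 1 (p t)) (\<theta> t) * F t (\<theta> t)) (at t within {0..})"
    using p_has_time_derivative[OF t, of 1 "\<theta> t"] by (intro has_derivative_along_curve[OF csmooth_nderiv1[OF csmooth_p] t _ \<theta>[OF t] c])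
  have T: "((\<lambda>s. tangent (\<theta> s)) has_vector_derivative F t (\<theta> t) *\<^sub>R normal (\<theta> t)) (at t within {0..})"
    using vector_diff_chain_within[OF v has_vector_derivative_at_within[OF tangent_has_derivative]] by (simp add: o_def)
  have N: "((\<lambda>s. normal (\<theta> s)) has_vector_derivative F t (\<theta> t) *\<^sub>R (- tangent (\<theta> t))) (at t within {0..})"
    using vector_diff_chain_within[OF v has_vector_derivative_at_within[OF normal_has_derivative]] by (simp add: o_def)
  have "((\<lambda>s. nderiv 1 (p s) (\<theta> s) *\<^sub>R tangent (\<theta> s) - p s (\<theta> s) *\<^sub>R normal (\<theta> s)) has_vector_derivative
      (nderiv 1 (p t) (\<theta> t) *\<^sub>R F t (\<theta> t) *\<^sub>R normal (\<theta> t) + (- nderiv 1 (V t) (\<theta> t) + nderiv 1 (nderiv 1 (p t)) (\<theta> t) * F t (\<theta> t)) *\<^sub>R tangent (\<theta> t))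
      - (p t (\<theta> t) *\<^sub>R F t (\<theta> t) *\<^sub>R (- tangent (\<theta> t)) + (- V t (\<theta> t) + nderiv 1 (p t) (\<theta> t) * F t (\<theta> t)) *\<^sub>R normal (\<theta> t))) (at t within {0..})"
    by (intro has_vector_derivative_diff has_vector_derivative_scaleR d0 d1 T N)
  moreover have "(nderiv 1 (p t) (\<theta> t) *\<^sub>R F t (\<theta> t) *\<^sub>R normal (\<theta> t) + (- nderiv 1 (V t) (\<theta> t) + nderiv 1 (nderiv 1 (p t)) (\<theta> t) * F t (\<theta> t)) *\<^sub>R tangent (\<theta> t))
      - (p t (\<theta> t) *\<^sub>R F t (\<theta> t) *\<^sub>R (- tangent (\<theta> t)) + (- V t (\<theta> t) + nderiv 1 (p t) (\<theta> t) * F t (\<theta> t)) *\<^sub>R normal (\<theta> t))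
    = V t (\<theta> t) *\<^sub>R normal (\<theta> t) + (r t (\<theta> t) * F t (\<theta> t) - nderiv 1 (V t) (\<theta> t)) *\<^sub>R tangent (\<theta> t)"
    unfolding r_eq[OF t] nderiv_2 by (simp add: algebra_simps)
  moreover have "r t (\<theta> t) * F t (\<theta> t) = nderiv 1 (V t) (\<theta> t)"
    using r_pos[OF t, of "\<theta> t"] by (simp add: F_def)
  ultimately show ?thesis by (simp add: Y_def curve_of_def)
qed

lemma flow_exists: "\<exists>X \<theta>. flow_solution k m X0 \<infinity> X \<theta>"
proof -
  obtain C where C: "\<And>t x. t \<ge> 0 \<Longrightarrow> \<bar>F t x\<bar> \<le> C" "\<And>t x. t \<ge> 0 \<Longrightarrow> \<bar>nderiv 1 (F t) x\<bar> \<le> C"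
    using F_bounded by blast
  obtain \<theta> where \<theta>: "csmooth \<theta>" "\<And>u. \<theta> 0 u = u"
    "\<And>t u. t \<ge> 0 \<Longrightarrow> ((\<lambda>s. \<theta> s u) has_real_derivative F t (\<theta> t u)) (at t within {0..})"
    "\<And>t u. t \<ge> 0 \<Longrightarrow> \<theta> t (u + L) = \<theta> t u + L"
    "\<And>t u. t \<ge> 0 \<Longrightarrow> nderiv 1 (\<theta> t) u > 0"
    "\<And>t. t \<ge> 0 \<Longrightarrow> strict_mono (\<theta> t)" "\<And>t. t \<ge> 0 \<Longrightarrow> surj (\<theta> t)"
    by (rule periodic_flow_exists[OF csmooth_F F_periodic C]; (assumption | rule that))
  \<comment> \<open>The point with label \<open>u\<close> is placed on the curve \<open>Y t\<close>
    at its current tangent angle.\<close>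
  define X where "X t u = Y t (\<theta> t u)" for t u
  define G where "G t u = V t (\<theta> t u) *\<^sub>R normal (\<theta> t u)" for t u
  have sX: "csmooth X" unfolding X_def[abs_def] by (rule csmooth_compose[OF csmooth_Y \<theta>(1)])
  have sG: "csmooth G" unfolding G_def[abs_def]
    by (rule csmooth_scaleR[OF csmooth_compose[OF csmooth_V \<theta>(1)] csmooth_compose[OF csmooth_static[OF smooth_normal] \<theta>(1)]])
  have X_0: "X 0 = X0" by (auto simp: X_def \<theta>(2) Y_0)
  have X_t: "((\<lambda>s. X s u) has_vector_derivative G t u) (at t within {0..})" if "t \<ge> 0" for t u
    unfolding X_def G_def by (rule Y_along_curve[OF that \<theta>(3)])
  have X_nt: "((\<lambda>s. nderiv n (X s) u) has_vector_derivative nderiv n (G t) u) (at t within {0..})" if "t \<ge> 0" for t u n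
    by (rule nderiv_has_time_derivative[OF sG X_t _ that]) (use smooth_X0 X_0 in simp_all)
  define \<rho> where "\<rho> t u = r t (\<theta> t u) * nderiv 1 (\<theta> t) u" for t u
  have \<rho>_pos: "\<rho> t u > 0" if "t \<ge> 0" for t u using r_pos[OF that] \<theta>(5)[OF that] by (simp add: \<rho>_def)
  have \<theta>u: "(\<theta> t has_vector_derivative nderiv 1 (\<theta> t) u) (at u)" if "t \<ge> 0" for t u
    by (rule csmooth_has_derivative1[OF \<theta>(1) that])
  have X_u: "nderiv 1 (X t) = (\<lambda>u. \<rho> t u *\<^sub>R tangent (\<theta> t u))" if t: "t \<ge> 0" for t
  proof (rule nderiv_1_eq)
    fix u show "(X t has_vector_derivative \<rho> t u *\<^sub>R tangent (\<theta> t u)) (at u)"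
      using vector_diff_chain_at[OF \<theta>u[OF t] Y_has_derivative[OF t]]
      by (simp add: X_def[abs_def] o_def \<rho>_def mult.commute)
  qed
  have curv: "curvature (X t) u = 1 / r t (\<theta> t u)" if t: "t \<ge> 0" for t u
  proof -
    have s: "csmooth \<rho>" unfolding \<rho>_def[abs_def]
      by (rule csmooth_mult[OF csmooth_compose[OF csmooth_r \<theta>(1)] csmooth_nderiv1[OF \<theta>(1)]])
    have "curvature (X t) u = nderiv 1 (\<theta> t) u / \<rho> t u"
      by (rule curvature_of_polar_derivative[OF X_u[OF t] _ _ \<rho>_pos[OF t]])
        (use csmooth_has_derivative1[OF s t] \<theta>u[OF t] in \<open>auto simp: has_real_derivative_iff_has_vector_derivative\<close>)
    then show ?thesis using \<theta>(5)[OF t, of u] by (simp add: \<rho>_def)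
  qed
  have inv: "\<theta> t (inv (\<theta> t) x) = x" if "t \<ge> 0" for t x by (rule surj_f_inv_f[OF \<theta>(7)[OF that]])
  have XY: "X t \<circ> inv (\<theta> t) = Y t" if "t \<ge> 0" for t by (auto simp: X_def inv[OF that])
  have K: "curvature (X t) \<circ> inv (\<theta> t) = (\<lambda>x. 1 / r t x)" if "t \<ge> 0" for t by (auto simp: curv[OF that] inv[OF that])
  have "flow_solution k m X0 \<infinity> X \<theta>"
    unfolding flow_solution_def time_dom_infinity
  proof (intro conjI ballI allI)
    fix t :: real assume "t \<in> {0..}"
    then have t: "t \<ge> 0" by simp
    show "smooth (X t)" by (rule csmooth_smooth[OF sX t])
    show "closed_curve (2 * real m * pi) (X t)"
      using L_pos Y_periodic[OF t] \<theta>(4)[OF t] by (simp add: closed_curve_def X_def L_def)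
    show "immersed (X t)"
      unfolding immersed_def X_u[OF t] using \<rho>_pos[OF t] norm_tangent by (metis less_irrefl norm_zero scaleR_eq_0_iff zero_neq_one)
    show "tangent_angle (X t) (\<theta> t)"
      unfolding tangent_angle_def X_u[OF t]
    proof
      fix u show "sgn (\<rho> t u *\<^sub>R tangent (\<theta> t u)) = tangent (\<theta> t u)"
        using \<rho>_pos[OF t, of u] by (simp add: sgn_div_norm)
    qed
    show "strict_mono (\<theta> t)" by (rule \<theta>(6)[OF t])
    show "(\<lambda>s. nderiv n (X s) u) differentiable at t within {0..}" for n u
      using X_nt[OF t] by (rule differentiableI_vector)
    show "((\<lambda>s. X s u) has_vector_derivative
          normal_speed k m (support (X t \<circ> inv (\<theta> t))) (curvature (X t) \<circ> inv (\<theta> t)) (\<theta> t u) *\<^sub>R normal (\<theta> t u)) (at t within {0..})" for u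
      using X_t[OF t, of u] by (simp add: XY[OF t] K[OF t] support_Y normal_speed_eq[OF t] G_def)
  next
    show "continuous_on ({0..} \<times> UNIV) (\<lambda>(t, u). vector_derivative (\<lambda>s. nderiv n (X s) u) (at t within {0..}))" for n
    proof (rule continuous_on_eq[OF csmooth_continuous[OF csmooth_nderiv[OF sG]]])
      fix z :: "real \<times> real" assume "z \<in> {0..} \<times> UNIV"
      then show "(\<lambda>(t, u). nderiv n (G t) u) z = (\<lambda>(t, u). vector_derivative (\<lambda>s. nderiv n (X s) u) (at t within {0..})) z"
        using vector_derivative_within[OF at_within_atLeast_neq_bot X_nt] by auto
    qed
  qed (use X_0 \<theta>(2) csmooth_continuous[OF \<theta>(1)] csmooth_continuous[OF csmooth_nderiv[OF sX]] in auto)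
  then show ?thesis by blast
qed

end

section \<open>Uniqueness of the flow\<close>

text \<open>Envelope theorem with a maximizer that is only continuous. The increment of the maximum
  lies between the increments of A at the two fixed points \<open>\<omega> t\<close> and
  \<open>\<omega> s\<close>, and both are A' (s - t) up to an arbitrarily small multiple of s -
  t.\<close>

lemma envelope_has_derivative:
  fixes A A' :: "real \<Rightarrow> real \<Rightarrow> real"
  assumes I: "convex I" "t \<in> I"
    and d: "\<And>s u. s \<in> I \<Longrightarrow> ((\<lambda>s. A s u) has_real_derivative A' s u) (at s within I)"
    and cA: "continuous_on (I \<times> UNIV) (\<lambda>(s, u). A' s u)" and c\<omega>: "continuous_on I \<omega>"
    and \<epsilon>: "\<epsilon> > 0"
    and max: "\<And>s s'. s \<in> I \<Longrightarrow> s' \<in> I \<Longrightarrow> \<bar>s - t\<bar> < \<epsilon> \<Longrightarrow> \<bar>s' - t\<bar> < \<epsilon> \<Longrightarrow> A s (\<omega> s') \<le> A s (\<omega> s)"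
  shows "((\<lambda>s. A s (\<omega> s)) has_real_derivative A' t (\<omega> t)) (at t within I)"
  unfolding has_field_derivative_def has_derivative_within_alt2
proof (intro conjI allI impI)
  show "bounded_linear ((*) (A' t (\<omega> t)))" by (rule bounded_linear_mult_right)
  fix e :: real assume e: "e > 0"
  let ?d = "A' t (\<omega> t)"
  have "(t, \<omega> t) \<in> I \<times> UNIV" using I by simp
  then obtain \<delta> where \<delta>: "\<delta> > 0" "\<And>s u. s \<in> I \<Longrightarrow> dist (s, u) (t, \<omega> t) < \<delta> \<Longrightarrow> dist (A' s u) ?d < e"
    using cA[unfolded continuous_on_iff] e by (metis (mono_tags, lifting) SigmaI UNIV_I case_prod_conv)
  obtain \<eta> where \<eta>: "\<eta> > 0" "\<And>s. s \<in> I \<Longrightarrow> dist s t < \<eta> \<Longrightarrow> dist (\<omega> s) (\<omega> t) < \<delta> / 2"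
    using c\<omega>[unfolded continuous_on_iff] I(2) \<delta>(1) by (metis half_gt_zero)
  define \<nu> where "\<nu> = min \<epsilon> (min \<eta> (\<delta> / 2))"
  have \<nu>: "\<nu> > 0" using \<epsilon> \<eta> \<delta> by (simp add: \<nu>_def)
  have est: "\<bar>A s u - A t u - (s - t) * ?d\<bar> \<le> e * \<bar>s - t\<bar>"
    if s: "s \<in> I" "dist s t < \<nu>" and u: "dist u (\<omega> t) < \<delta> / 2" for s u
  proof -
    have "norm ((\<lambda>s. A s u - s * ?d) s - (\<lambda>s. A s u - s * ?d) t) \<le> e * norm (s - t)"
    proof (rule field_differentiable_bound[of "I \<inter> ball t \<nu>"])
      show "convex (I \<inter> ball t \<nu>)" using I by (intro convex_Int) auto
      fix y assume y: "y \<in> I \<inter> ball t \<nu>"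
      have "((\<lambda>s. s * ?d) has_real_derivative ?d) (at y within I)"
        by (auto intro!: derivative_eq_intros)
      from DERIV_diff[OF d[of y u] this]
      have "((\<lambda>s. A s u - s * ?d) has_real_derivative A' y u - ?d) (at y within I)"
        using y by simp
      then show "((\<lambda>s. A s u - s * ?d) has_field_derivative A' y u - ?d) (at y within I \<inter> ball t \<nu>)"
        by (rule DERIV_subset) simp
      have "dist y t < \<delta> / 2" using y by (simp add: dist_commute \<nu>_def)
      then have "dist (y, u) (t, \<omega> t) < \<delta>"
        using u dist_Pair_Pair[of y u t "\<omega> t"] sqrt_sum_squares_le_sum[of "dist y t" "dist u (\<omega> t)"] by simp
      then show "norm (A' y u - ?d) \<le> e" using \<delta>(2) y by (force simp: dist_real_def)
    qed (use s I \<nu> in \<open>auto simp: dist_commute\<close>)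
    then show ?thesis by (simp add: algebra_simps)
  qed
  have "\<bar>A s (\<omega> s) - A t (\<omega> t) - (s - t) * ?d\<bar> \<le> e * \<bar>s - t\<bar>" if s: "s \<in> I" "dist s t < \<nu>" for s
  proof -
    \<comment> \<open>Maximality at the times \<open>s\<close> and \<open>t\<close>: one inequality
      bounds the increment from below, the other from above.\<close>
    have 1: "A s (\<omega> t) \<le> A s (\<omega> s)" and 2: "A t (\<omega> s) \<le> A t (\<omega> t)"
      using s I \<epsilon> by (auto intro!: max simp: \<nu>_def dist_real_def)
    have "dist (\<omega> s) (\<omega> t) < \<delta> / 2" using \<eta>(2)[OF s(1)] s(2) by (simp add: \<nu>_def)
    from est[OF s this] est[OF s, of "\<omega> t"] 1 2 \<delta>(1) show ?thesis by (simp add: abs_le_iff)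
  qed
  then show "\<forall>\<^sub>F s in at t within I. norm (A s (\<omega> s) - A t (\<omega> t) - ?d * (s - t)) \<le> e * norm (s - t)"
    unfolding eventually_at using \<nu> by (auto simp: mult.commute)
qed

lemma DERIV_nonpos_imp_le:
  fixes f :: "real \<Rightarrow> real"
  assumes d: "\<And>t. t \<in> {0..\<tau>} \<Longrightarrow> (f has_real_derivative f' t) (at t within {0..\<tau>})" "\<And>t. t \<in> {0..\<tau>} \<Longrightarrow> f' t \<le> 0"
    and t: "t \<in> {0..\<tau>}"
  shows "f t \<le> f 0"
proof (rule DERIV_nonpos_imp_decreasing_open[of 0 t f])
  have "continuous_on {0..\<tau>} f" by (rule DERIV_continuous_on[OF d(1)])
  then show "continuous_on {0..t} f" by (rule continuous_on_subset) (use t in auto)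
  fix x assume x: "0 < x" "x < t"
  then have "at x within {0..\<tau>} = at x" using t by (intro at_within_Icc_at) auto
  then show "\<exists>y. DERIV f x :> y \<and> y \<le> 0" using d[of x] x t by auto
qed (use t in auto)

lemma DERIV_zero_imp_eq:
  fixes f :: "real \<Rightarrow> real"
  assumes d: "\<And>t. t \<in> {0..\<tau>} \<Longrightarrow> (f has_real_derivative 0) (at t within {0..\<tau>})" and t: "t \<in> {0..\<tau>}"
  shows "f t = f 0"
proof -
  obtain C where "\<And>t. t \<in> {0..\<tau>} \<Longrightarrow> f t = C"
    using has_field_derivative_zero_constant[of "{0..\<tau>}" f] d by auto
  then show ?thesis using t by auto
qed

text \<open>Energy method. Integration by parts over a period shows that the integral of D^2 has the
  derivative - 2 kappa times the integral of D'^2 + D^2, so it cannot grow from its initial value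
  0.\<close>

lemma periodic_heat_unique:
  fixes D D1 D2 :: "real \<Rightarrow> real \<Rightarrow> real"
  assumes L: "L > 0" and \<kappa>: "\<kappa> > 0"
    and time: "\<And>t x. t \<in> {0..\<tau>} \<Longrightarrow> ((\<lambda>s. D s x) has_real_derivative \<kappa> * (D2 t x - D t x)) (at t within {0..\<tau>})"
    and d1: "\<And>t x. t \<in> {0..\<tau>} \<Longrightarrow> (D t has_real_derivative D1 t x) (at x)"
    and d2: "\<And>t x. t \<in> {0..\<tau>} \<Longrightarrow> (D1 t has_real_derivative D2 t x) (at x)"
    and c: "continuous_on ({0..\<tau>} \<times> UNIV) (\<lambda>(t, x). D t x)" and c2: "continuous_on ({0..\<tau>} \<times> UNIV) (\<lambda>(t, x). D2 t x)"
    and per: "\<And>t x. t \<in> {0..\<tau>} \<Longrightarrow> D t (x + L) = D t x" "\<And>t x. t \<in> {0..\<tau>} \<Longrightarrow> D1 t (x + L) = D1 t x"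
    and init: "\<And>x. D 0 x = 0" and t: "t \<in> {0..\<tau>}"
  shows "D t x = 0"
proof -
  define e where "e t = integral {0..L} (\<lambda>x. (D t x)\<^sup>2)" for t
  define e' where "e' t = integral {0..L} (\<lambda>x. 2 * \<kappa> * (D t x * (D2 t x - D t x)))" for t
  have cx: "continuous_on S (D s)" "continuous_on S (D1 s)" if "s \<in> {0..\<tau>}" for s S
    using d1[OF that] d2[OF that] by (meson DERIV_continuous continuous_at_imp_continuous_on)+
  have e_deriv: "(e has_real_derivative e' s) (at s within {0..\<tau>})" if s: "s \<in> {0..\<tau>}" for s
  proof -
    have "((\<lambda>t. integral (cbox 0 L) (\<lambda>x. (D t x)\<^sup>2)) has_vector_derivative
        integral (cbox 0 L) (\<lambda>x. 2 * \<kappa> * (D s x * (D2 s x - D s x)))) (at s within {0..\<tau>})"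
    proof (rule leibniz_rule_vector_derivative)
      fix t x assume t: "t \<in> {0..\<tau>}"
      have "((\<lambda>t. (D t x)\<^sup>2) has_real_derivative 2 * \<kappa> * (D t x * (D2 t x - D t x))) (at t within {0..\<tau>})"
        using DERIV_power[OF time[OF t, of x], of 2] by (simp add: mult_ac)
      then show "((\<lambda>t. (D t x)\<^sup>2) has_vector_derivative 2 * \<kappa> * (D t x * (D2 t x - D t x))) (at t within {0..\<tau>})"
        by (simp add: has_real_derivative_iff_has_vector_derivative)
    next
      show "(\<lambda>x. (D t x)\<^sup>2) integrable_on cbox 0 L" if "t \<in> {0..\<tau>}" for t
        unfolding box_real by (intro integrable_continuous_real continuous_intros cx that)
      show "continuous_on ({0..\<tau>} \<times> cbox 0 L) (\<lambda>(t, x). 2 * \<kappa> * (D t x * (D2 t x - D t x)))"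
        using continuous_on_subset[OF c, of "{0..\<tau>} \<times> cbox 0 L"] continuous_on_subset[OF c2, of "{0..\<tau>} \<times> cbox 0 L"]
        unfolding case_prod_unfold by (intro continuous_intros) auto
    qed (use s in auto)
    then show ?thesis by (simp add: e_def[abs_def] e'_def has_real_derivative_iff_has_vector_derivative)
  qed
  have e_le: "e' s \<le> 0" if s: "s \<in> {0..\<tau>}" for s
  proof -
    have "((\<lambda>x. D1 s x * D1 s x + D2 s x * D s x) has_integral (D s L * D1 s L - D s 0 * D1 s 0)) {0..L}"
    proof (rule fundamental_theorem_of_calculus)
      show "((\<lambda>x. D s x * D1 s x) has_vector_derivative D1 s x * D1 s x + D2 s x * D s x) (at x within {0..L})" for x
        using has_field_derivative_at_within[OF DERIV_mult[OF d1[OF s] d2[OF s]]]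
        by (simp add: has_real_derivative_iff_has_vector_derivative)
    qed (use L in simp)
    then have h: "((\<lambda>x. D1 s x * D1 s x + D2 s x * D s x) has_integral 0) {0..L}"
      using per[OF s, of 0] by simp
    have "((\<lambda>x. D1 s x * D1 s x + D s x * D s x) has_integral integral {0..L} (\<lambda>x. D1 s x * D1 s x + D s x * D s x)) {0..L}"
      by (intro integrable_integral integrable_continuous_real continuous_intros cx s)
    from has_integral_mult_right[OF has_integral_diff[OF h this], of "2 * \<kappa>"]
    have "e' s = - 2 * \<kappa> * integral {0..L} (\<lambda>x. D1 s x * D1 s x + D s x * D s x)"
      unfolding e'_def by (intro integral_unique) (simp add: algebra_simps)
    moreover have "integral {0..L} (\<lambda>x. D1 s x * D1 s x + D s x * D s x) \<ge> 0"
      by (intro Henstock_Kurzweil_Integration.integral_nonneg integrable_continuous_real continuous_intros cx s) auto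
    ultimately show ?thesis using \<kappa> by (simp add: mult_nonneg_nonneg)
  qed
  have "e t \<le> e 0" by (rule DERIV_nonpos_imp_le[OF e_deriv e_le t])
  then have "e t \<le> 0" by (simp add: e_def init)
  moreover have "e t \<ge> 0"
    unfolding e_def by (intro Henstock_Kurzweil_Integration.integral_nonneg integrable_continuous_real continuous_intros cx t) auto
  ultimately have "\<forall>x\<in>{0..L}. (D t x)\<^sup>2 = 0"
    using integral_eq_0_iff[of 0 L "\<lambda>x. (D t x)\<^sup>2"] L cx(1)[OF t] by (auto simp: e_def intro: continuous_intros)
  then show ?thesis using periodic_representative[OF L, of "D t" x] per(1)[OF t] by (metis zero_eq_power2)
qed

locale flow = initial_curve +
  fixes T :: ereal and X :: "real \<Rightarrow> real \<Rightarrow> complex" and \<theta> :: "real \<Rightarrow> real \<Rightarrow> real"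
  assumes solution: "flow_solution k m X0 T X \<theta>"
begin

section \<open>Regularity of an arbitrary solution and of its tangent angle\<close>

abbreviation "D \<equiv> time_dom T"

lemma D_0: "0 \<in> D" and D_nonneg: "t \<in> D \<Longrightarrow> t \<ge> 0"
  using solution by (auto simp: flow_solution_def time_dom_def zero_ereal_def)

lemma D_down: "t \<in> D \<Longrightarrow> {0..t} \<subseteq> D"
  by (auto simp: time_dom_def) (meson ereal_less_eq(3) le_less_trans)

lemma D_up:
  assumes "t \<in> D" obtains t' where "t' \<in> D" "t < t'"
proof -
  have "ereal t < T" using assms by (simp add: time_dom_def)
  then obtain s where s: "ereal t < s" "s < T" using dense by blast
  then obtain t' where "s = ereal t'" by (cases s) auto
  then show ?thesis using s assms that[of t'] by (simp add: time_dom_def)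
qed

lemma at_D_neq_bot:
  assumes "t \<in> D" shows "at t within D \<noteq> bot"
proof -
  obtain t' where t': "t' \<in> D" "t < t'" using D_up[OF assms] .
  have "t islimpt {t<..<t'}" by (rule islimpt_greaterThanLessThan1) (use t' in simp)
  then have "t islimpt D"
    by (rule islimpt_subset) (use D_down[OF t'(1)] D_nonneg[OF assms] in auto)
  then show ?thesis by (simp add: trivial_limit_within)
qed

lemma X_0: "X 0 = X0" and \<theta>_0: "\<theta> 0 u = u"
  using solution by (auto simp: flow_solution_def)

lemma smooth_X: "t \<in> D \<Longrightarrow> smooth (X t)"
  and X_periodic: "t \<in> D \<Longrightarrow> X t (u + L) = X t u"
  and X_regular: "t \<in> D \<Longrightarrow> nderiv 1 (X t) u \<noteq> 0"
  and X_angle: "t \<in> D \<Longrightarrow> tangent_angle (X t) (\<theta> t)"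
  and \<theta>_mono: "t \<in> D \<Longrightarrow> strict_mono (\<theta> t)"
  and \<theta>_cont: "continuous_on (D \<times> UNIV) (\<lambda>(t, u). \<theta> t u)"
  and X_cont: "continuous_on (D \<times> UNIV) (\<lambda>(t, u). nderiv n (X t) u)"
  and Xt_cont: "continuous_on (D \<times> UNIV) (\<lambda>(t, u). vector_derivative (\<lambda>s. nderiv n (X s) u) (at t within D))"
  and X_time: "t \<in> D \<Longrightarrow> ((\<lambda>s. X s u) has_vector_derivative
           normal_speed k m (support (X t \<circ> inv (\<theta> t))) (curvature (X t) \<circ> inv (\<theta> t)) (\<theta> t u)
             *\<^sub>R normal (\<theta> t u)) (at t within D)"
  using solution unfolding flow_solution_def closed_curve_def immersed_def L_def by blast+

definition "\<kappa> t u = curvature (X t) u"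
definition "R t u = norm (nderiv 1 (X t) u)"
definition "\<omega> t = inv (\<theta> t)"

lemma R_pos: "t \<in> D \<Longrightarrow> R t u > 0"
  using X_regular by (simp add: R_def)

lemma cont_slice:
  assumes "continuous_on (S \<times> UNIV) (\<lambda>(t, u). f t u)" "continuous_on A \<tau>" "continuous_on A h" "\<tau> ` A \<subseteq> S"
  shows "continuous_on A (\<lambda>z. f (\<tau> z) (h z))"
proof -
  have "continuous_on A (\<lambda>z. (\<lambda>(t, u). f t u) (\<tau> z, h z))"
    by (rule continuous_on_compose2[OF assms(1)]) (use assms in \<open>auto intro!: continuous_intros\<close>)
  then show ?thesis by simp
qed

lemma \<theta>_isCont: "t \<in> D \<Longrightarrow> isCont (\<theta> t) u"
  using cont_slice[OF \<theta>_cont, of UNIV "\<lambda>_. t" "\<lambda>u. u"] by (auto simp: continuous_on_eq_continuous_at)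

lemma X_u: "t \<in> D \<Longrightarrow> nderiv 1 (X t) u = R t u *\<^sub>R tangent (\<theta> t u)"
  using X_angle[of t] R_pos[of t u] unfolding tangent_angle_def R_def
  by (metis divideR_right less_irrefl sgn_div_norm)

lemma X_has_derivative: "t \<in> D \<Longrightarrow> (X t has_vector_derivative R t u *\<^sub>R tangent (\<theta> t u)) (at u)"
  using smooth_has_derivative[OF smooth_X, of t 0 u] X_u[of t u] by (simp flip: One_nat_def)

lemma \<theta>_has_derivative: "t \<in> D \<Longrightarrow> (\<theta> t has_real_derivative \<kappa> t u * R t u) (at u)"
  unfolding \<kappa>_def R_def
  using smooth_has_derivative[OF smooth_X, of t 1 u] X_regular X_angle \<theta>_isCont
  by (intro tangent_angle_has_derivative) (auto simp: Suc_1)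

lemma \<kappa>_cont: "continuous_on (D \<times> UNIV) (\<lambda>(t, u). \<kappa> t u)"
  unfolding \<kappa>_def curvature_def case_prod_unfold
  by (intro continuous_intros X_cont[unfolded case_prod_unfold]) (auto simp: X_regular)

lemma \<kappa>_periodic: "t \<in> D \<Longrightarrow> \<kappa> t (u + L) = \<kappa> t u"
  using nderiv_periodic[OF smooth_X X_periodic] by (simp add: \<kappa>_def curvature_def)

text \<open>The closed curve has the same tangent direction at \<open>u\<close> and u + L, so the
  angle increment differs from \<open>L\<close> by a multiple of 2 pi. This multiple is an integer
  depending continuously on time, and it is 0 initially.\<close>

lemma \<theta>_periodic:
  assumes t: "t \<in> D" shows "\<theta> t (u + L) = \<theta> t u + L"
proof -
  define h where "h s = (\<theta> s (u + L) - \<theta> s u - L) / (2 * pi)" for s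
  have int: "h s \<in> \<int>" if s: "s \<in> D" for s
  proof -
    have "sgn (nderiv 1 (X s) (u + L)) = sgn (nderiv 1 (X s) u)"
      by (simp add: nderiv_periodic[OF smooth_X[OF s] X_periodic[OF s]])
    then have "tangent (\<theta> s (u + L)) = tangent (\<theta> s u + L)"
      using X_angle[OF s] by (simp add: tangent_angle_def tangent_periodic)
    then have "sin (\<theta> s (u + L)) = sin (\<theta> s u + L)" "cos (\<theta> s (u + L)) = cos (\<theta> s u + L)"
      by (auto simp: tangent_def)
    then obtain n :: int where "\<theta> s (u + L) = (\<theta> s u + L) + 2 * pi * n"
      using sin_cos_eq_iff by blast
    then show ?thesis by (simp add: h_def)
  qed
  have "h constant_on {0..t}"
  proof (rule continuous_discrete_range_constant)
    show "continuous_on {0..t} h"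
      unfolding h_def using D_down[OF t] by (intro continuous_intros cont_slice[OF \<theta>_cont]) auto
    fix s assume s: "s \<in> {0..t}"
    have "1 \<le> norm (h s' - h s)" if "s' \<in> {0..t}" "h s' \<noteq> h s" for s'
    proof -
      have "h s' - h s \<in> \<int>" using int D_down[OF t] s that by (intro Ints_diff) auto
      then obtain z where z: "h s' - h s = real_of_int z" by (rule Ints_cases)
      with that have "\<bar>z\<bar> \<ge> 1" by auto
      then have "real_of_int \<bar>z\<bar> \<ge> 1" by linarith
      then show ?thesis by (simp add: z)
    qed
    then show "\<exists>e>0. \<forall>y. y \<in> {0..t} \<and> h y \<noteq> h s \<longrightarrow> e \<le> norm (h y - h s)" by (intro exI[of _ 1]) auto
  qed auto
  then have "h t = h 0" using D_nonneg[OF t] by (auto simp: constant_on_def)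
  then show ?thesis by (simp add: h_def \<theta>_0)
qed

text \<open>The displacement of the angle from its label is periodic, hence bounded, and the
  intermediate value theorem applies.\<close>

lemma \<theta>_surj:
  assumes t: "t \<in> D" shows "surj (\<theta> t)"
  unfolding surj_def
proof
  fix y
  have c: "continuous_on S (\<theta> t)" for S using \<theta>_isCont[OF t] by (simp add: continuous_at_imp_continuous_on)
  have cd: "continuous_on UNIV (\<lambda>u. \<theta> t u - u)" by (intro continuous_intros c)
  obtain K where K: "\<And>u. \<bar>\<theta> t u - u\<bar> \<le> K"
  proof (rule continuous_periodic_bounded[OF cd L_pos])
    show "\<theta> t (u + L) - (u + L) = \<theta> t u - u" for u by (simp add: \<theta>_periodic[OF t])
  qed (rule that)
  have "\<theta> t (y - K) \<le> y" "y \<le> \<theta> t (y + K)" "y - K \<le> y + K"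
    using K[of "y - K"] K[of "y + K"] by linarith+
  then show "\<exists>u. y = \<theta> t u" using IVT'[of "\<theta> t" "y - K" y "y + K"] c by force
qed

lemma \<theta>_\<omega>: "t \<in> D \<Longrightarrow> \<theta> t (\<omega> t x) = x"
  unfolding \<omega>_def by (rule surj_f_inv_f[OF \<theta>_surj])

lemma \<omega>_\<theta>: "t \<in> D \<Longrightarrow> \<omega> t (\<theta> t u) = u"
  unfolding \<omega>_def by (rule inv_f_f[OF strict_mono_imp_inj_on[OF \<theta>_mono]])

text \<open>With u the preimage of x at time t, the strict inequalities
  \<open>\<theta> t (u - e) < x < \<theta> t (u + e)\<close> persist for nearby times and angles;
  monotonicity then keeps the preimage within \<open>e\<close> of u.\<close>

lemma \<omega>_cont: "continuous_on (D \<times> UNIV) (\<lambda>(t, x). \<omega> t x)"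
  unfolding continuous_on_iff
proof (intro ballI allI impI)
  fix z :: "real \<times> real" and e :: real assume z: "z \<in> D \<times> UNIV" and e: "e > 0"
  obtain t x where tx: "z = (t, x)" by (cases z)
  have t: "t \<in> D" using z tx by simp
  let ?u = "\<omega> t x"
  define f where "f w = \<theta> (fst w) (?u + e) - snd w" for w
  define h where "h w = snd w - \<theta> (fst w) (?u - e)" for w
  have cf: "continuous_on (D \<times> UNIV) f" and ch: "continuous_on (D \<times> UNIV) h"
    unfolding f_def h_def by (intro continuous_intros cont_slice[OF \<theta>_cont]; auto)+
  have "f z > 0" "h z > 0"
    using strict_monoD[OF \<theta>_mono[OF t], of ?u "?u + e"] strict_monoD[OF \<theta>_mono[OF t], of "?u - e" ?u] e
    by (auto simp: f_def h_def tx \<theta>_\<omega>[OF t])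
  obtain d1 where d1: "d1 > 0" "\<And>w. w \<in> D \<times> UNIV \<Longrightarrow> dist w z < d1 \<Longrightarrow> dist (f w) (f z) < f z"
    using cf[unfolded continuous_on_iff] z \<open>f z > 0\<close> by blast
  obtain d2 where d2: "d2 > 0" "\<And>w. w \<in> D \<times> UNIV \<Longrightarrow> dist w z < d2 \<Longrightarrow> dist (h w) (h z) < h z"
    using ch[unfolded continuous_on_iff] z \<open>h z > 0\<close> by blast
  show "\<exists>d>0. \<forall>w\<in>D \<times> UNIV. dist w z < d \<longrightarrow> dist ((\<lambda>(t, x). \<omega> t x) w) ((\<lambda>(t, x). \<omega> t x) z) < e"
  proof (intro exI[of _ "min d1 d2"] conjI ballI impI)
    fix w assume w: "w \<in> D \<times> (UNIV :: real set)" "dist w z < min d1 d2"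
    obtain s y where sy: "w = (s, y)" by (cases w)
    have s: "s \<in> D" using w sy by simp
    have "dist (f w) (f z) < f z" "dist (h w) (h z) < h z"
      using d1(2)[OF w(1)] d2(2)[OF w(1)] w(2) by simp_all
    then have "f w > 0" "h w > 0" by (auto simp: dist_real_def abs_less_iff)
    then have "\<theta> s (?u - e) < \<theta> s (\<omega> s y)" "\<theta> s (\<omega> s y) < \<theta> s (?u + e)"
      by (auto simp: f_def h_def sy \<theta>_\<omega>[OF s])
    then have "?u - e < \<omega> s y" "\<omega> s y < ?u + e"
      using strict_mono_less[OF \<theta>_mono[OF s]] by blast+
    then show "dist ((\<lambda>(t, x). \<omega> t x) w) ((\<lambda>(t, x). \<omega> t x) z) < e"
      by (simp add: sy tx dist_real_def abs_less_iff)
  qed (use d1 d2 in auto)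
qed

text \<open>\<open>P\<close> and \<open>S\<close> are the support function and the normal speed as functions of the tangent angle.\<close>

definition "P t = support (X t \<circ> \<omega> t)"
definition "S t x = normal_speed k m (P t) (\<lambda>x. \<kappa> t (\<omega> t x)) x"

lemma X_time': "t \<in> D \<Longrightarrow> ((\<lambda>s. X s u) has_vector_derivative S t (\<theta> t u) *\<^sub>R normal (\<theta> t u)) (at t within D)"
  using X_time[of t u] by (simp add: S_def P_def \<omega>_def \<kappa>_def o_def)

text \<open>The formula for the speed divides by the curvature, which may still vanish here, so it
  does not show continuity. The assumed continuity of the time derivative of the solution
  does.\<close>

lemma Xt_cont': "continuous_on (D \<times> UNIV) (\<lambda>(t, u). S t (\<theta> t u) *\<^sub>R normal (\<theta> t u))"
proof (rule continuous_on_eq[OF Xt_cont[of 0]])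
  fix z assume "z \<in> D \<times> (UNIV :: real set)"
  then show "(\<lambda>(t, u). vector_derivative (\<lambda>s. nderiv 0 (X s) u) (at t within D)) z = (\<lambda>(t, u). S t (\<theta> t u) *\<^sub>R normal (\<theta> t u)) z"
    using vector_derivative_within[OF at_D_neq_bot X_time'] by auto
qed

lemma P_eq: "P t x = - inner (X t (\<omega> t x)) (normal x)"
  by (simp add: P_def support_def)

lemma P_periodic:
  assumes t: "t \<in> D" shows "P t (x + L) = P t x"
proof -
  have "\<omega> t (\<theta> t (\<omega> t x + L)) = \<omega> t x + L" by (rule \<omega>_\<theta>[OF t])
  then have "\<omega> t (x + L) = \<omega> t x + L" by (simp add: \<theta>_periodic[OF t] \<theta>_\<omega>[OF t])
  then show ?thesis by (simp add: P_eq normal_periodic X_periodic[OF t])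
qed

lemma P_cont: "continuous_on (D \<times> UNIV) (\<lambda>(t, x). P t x)"
proof -
  have n: "continuous_on UNIV normal" using smooth_continuous_nderiv[OF smooth_normal, of UNIV 0] by simp
  have "continuous_on (D \<times> UNIV) (\<lambda>z. X (fst z) (\<omega> (fst z) (snd z)))"
    by (rule cont_slice[OF X_cont[of 0, simplified]]) (auto intro!: continuous_intros cont_slice[OF \<omega>_cont])
  then show ?thesis
    unfolding P_eq case_prod_unfold by (intro continuous_intros continuous_on_compose2[OF n]) auto
qed

text \<open>Near \<open>\<omega> t x\<close> the height of the curve in direction \<open>- normal x\<close> is maximal at the point with
  tangent angle \<open>x\<close>; hence the tangential motion of that point does not enter the derivative.\<close>

lemma P_has_time_derivative:
  assumes t: "t \<in> D" shows "((\<lambda>s. P s x) has_real_derivative - S t x) (at t within D)"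
proof -
  define A where "A s u = - inner (X s u) (normal x)" for s u
  define A' where "A' s u = - inner (S s (\<theta> s u) *\<^sub>R normal (\<theta> s u)) (normal x)" for s u
  have cw: "continuous_on D (\<lambda>s. \<omega> s x)"
    by (rule cont_slice[OF \<omega>_cont]) (auto intro!: continuous_intros)
  have "continuous_on (D \<times> D) (\<lambda>z. \<theta> (fst z) (\<omega> (snd z) x))"
    by (rule cont_slice[OF \<theta>_cont]) (auto intro!: continuous_intros continuous_on_compose2[OF cw])
  then obtain \<epsilon> where \<epsilon>: "\<epsilon> > 0" "\<And>w. w \<in> D \<times> D \<Longrightarrow> dist w (t, t) < \<epsilon> \<Longrightarrow> dist (\<theta> (fst w) (\<omega> (snd w) x)) (\<theta> t (\<omega> t x)) < pi"
    using t pi_gt_zero unfolding continuous_on_iff by (metis SigmaI fst_conv snd_conv)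
  \<comment> \<open>Between \<open>\<omega> s x\<close> and \<open>\<omega> s s' x\<close> type
    points the angle must stay within pi of \<open>x\<close>, because the sign of the sine of the
    difference decides the monotonicity of the height.\<close>
  have near: "\<bar>\<theta> s (\<omega> s' x) - x\<bar> < pi" if "s \<in> D" "s' \<in> D" "\<bar>s - t\<bar> < \<epsilon> / 2" "\<bar>s' - t\<bar> < \<epsilon> / 2" for s s'
  proof -
    have "dist (s, s') (t, t) < \<epsilon>"
      using that sqrt_sum_squares_le_sum[of "dist s t" "dist s' t"] by (simp add: dist_Pair_Pair dist_real_def)
    then show ?thesis using \<epsilon>(2)[of "(s, s')"] that by (simp add: \<theta>_\<omega>[OF t] dist_real_def)
  qed
  have "((\<lambda>s. A s (\<omega> s x)) has_real_derivative A' t (\<omega> t x)) (at t within D)"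
  proof (rule envelope_has_derivative[of D t A A' "\<lambda>s. \<omega> s x" "\<epsilon> / 2"])
    show "convex D" unfolding convex_contains_segment time_dom_def
      by (auto simp: closed_segment_eq_real_ivl split: if_splits) (meson ereal_less_eq(3) le_less_trans)+
    show "t \<in> D" by (rule t)
    show "((\<lambda>s. A s u) has_real_derivative A' s u) (at s within D)" if "s \<in> D" for s u
      unfolding A_def A'_def
      using bounded_linear.has_vector_derivative[OF bounded_linear_inner_left has_vector_derivative_minus[OF X_time'[OF that]]]
      by (simp add: has_real_derivative_iff_has_vector_derivative)
    show "continuous_on (D \<times> UNIV) (\<lambda>(s, u). A' s u)"
      unfolding A'_def case_prod_unfold by (intro continuous_intros Xt_cont'[unfolded case_prod_unfold])
    show "continuous_on D (\<lambda>s. \<omega> s x)" by (rule cw)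
    show "\<epsilon> / 2 > 0" using \<epsilon> by simp
    fix s s' assume s: "s \<in> D" "s' \<in> D" "\<bar>s - t\<bar> < \<epsilon> / 2" "\<bar>s' - t\<bar> < \<epsilon> / 2"
    \<comment> \<open>The height increases before the angle reaches \<open>x\<close> and decreases
      after it, so the point with angle \<open>x\<close> is a maximum.\<close>
    have d: "(A s has_real_derivative - (R s u * sin (\<theta> s u - x))) (at u)" for u
      unfolding A_def
      using bounded_linear.has_vector_derivative[OF bounded_linear_inner_left[of "normal x"] has_vector_derivative_minus[OF X_has_derivative[OF s(1), of u]]]
      by (simp add: has_real_derivative_iff_has_vector_derivative inner_tangent_normal)
    have mono: "\<theta> s u \<le> \<theta> s v \<longleftrightarrow> u \<le> v" for u v by (rule strict_mono_less_eq[OF \<theta>_mono[OF s(1)]])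
    have n: "\<bar>\<theta> s (\<omega> s' x) - x\<bar> < pi" by (rule near[OF s])
    have x: "\<theta> s (\<omega> s x) = x" by (rule \<theta>_\<omega>[OF s(1)])
    show "A s (\<omega> s' x) \<le> A s (\<omega> s x)"
    proof (cases "\<omega> s x \<le> \<omega> s' x")
      case True
      show ?thesis
      proof (rule DERIV_nonpos_imp_nonincreasing[OF True], intro exI conjI, rule d)
        fix u assume u: "\<omega> s x \<le> u" "u \<le> \<omega> s' x"
        then have "0 \<le> \<theta> s u - x" "\<theta> s u - x \<le> pi"
          using mono[of "\<omega> s x" u] mono[of u "\<omega> s' x"] x n by linarith+
        then show "- (R s u * sin (\<theta> s u - x)) \<le> 0" using R_pos[OF s(1), of u] sin_ge_zero by simp
      qed
    next
      case False
      then have le: "\<omega> s' x \<le> \<omega> s x" by simp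
      show ?thesis
      proof (rule DERIV_nonneg_imp_nondecreasing[OF le], intro exI conjI, rule d)
        fix u assume u: "\<omega> s' x \<le> u" "u \<le> \<omega> s x"
        then have "0 \<le> x - \<theta> s u" "x - \<theta> s u \<le> pi"
          using mono[of u "\<omega> s x"] mono[of "\<omega> s' x" u] x n by linarith+
        then have "sin (x - \<theta> s u) \<ge> 0" by (rule sin_ge_zero)
        then have "sin (\<theta> s u - x) \<le> 0" using sin_minus[of "x - \<theta> s u"] by simp
        then show "- (R s u * sin (\<theta> s u - x)) \<ge> 0" using R_pos[OF s(1), of u] by (simp add: mult_nonneg_nonpos)
      qed
    qed
  qed
  then show ?thesis by (simp add: A_def[abs_def] A'_def P_eq \<theta>_\<omega>[OF t])
qed

end

lemma k_sum_has_derivative: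
  assumes "\<And>x. (h has_real_derivative h' x) (at x)"
  shows "(k_sum k m h has_real_derivative k_sum k m h' x) (at x)"
  unfolding k_sum_def[abs_def]
proof (rule DERIV_sum)
  fix i
  have "((\<lambda>x. x + 2 * real i * real m * pi / real k) has_real_derivative 1) (at x)"
    by (auto intro!: derivative_eq_intros)
  from DERIV_chain2[OF assms this]
  show "((\<lambda>x. h (x + 2 * real i * real m * pi / real k)) has_real_derivative h' (x + 2 * real i * real m * pi / real k)) (at x)"
    by simp
qed

lemma continuous_on_k_sum:
  assumes "continuous_on (S \<times> UNIV) (\<lambda>(t, x). h t x)"
  shows "continuous_on (S \<times> UNIV) (\<lambda>(t, x). k_sum k m (h t) x)"
proof -
  have "continuous_on (S \<times> UNIV) (\<lambda>z. \<Sum>i<k. (\<lambda>(t, x). h t x) (fst z, snd z + 2 * real i * real m * pi / real k))"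
    by (intro continuous_on_sum continuous_on_compose2[OF assms]) (auto intro!: continuous_intros)
  then show ?thesis by (simp add: k_sum_def case_prod_unfold)
qed

text \<open>Positive curvature up to \<open>\<tau>\<close> makes the tangent angle a differentiable
  coordinate with differentiable inverse. The assumption is discharged later by continuation in
  time.\<close>

locale convex_flow = flow +
  fixes \<tau> :: real
  assumes \<tau>: "\<tau> \<in> D" and \<kappa>_pos: "\<And>t u. t \<in> {0..\<tau>} \<Longrightarrow> \<kappa> t u > 0"
begin

definition "\<rho> t x = 1 / \<kappa> t (\<omega> t x)"

lemma in_D: "t \<in> {0..\<tau>} \<Longrightarrow> t \<in> D"
  using D_down[OF \<tau>] by auto

lemma \<rho>_pos: "t \<in> {0..\<tau>} \<Longrightarrow> \<rho> t x > 0"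
  using \<kappa>_pos by (simp add: \<rho>_def)

lemma \<omega>_has_derivative:
  assumes t: "t \<in> {0..\<tau>}"
  shows "(\<omega> t has_real_derivative inverse (\<kappa> t (\<omega> t x) * R t (\<omega> t x))) (at x)"
proof (rule DERIV_inverse_function[where f="\<theta> t" and g="\<omega> t" and a="x - 1" and b="x + 1"])
  show "\<kappa> t (\<omega> t x) * R t (\<omega> t x) \<noteq> 0"
    using \<kappa>_pos[OF t] R_pos[OF in_D[OF t]] by (metis less_irrefl mult_eq_0_iff)
  have "continuous_on UNIV (\<omega> t)"
    by (rule cont_slice[OF \<omega>_cont]) (use in_D[OF t] in \<open>auto intro!: continuous_intros\<close>)
  then show "isCont (\<omega> t) x" by (simp add: continuous_on_eq_continuous_at)
qed (use \<theta>_has_derivative[OF in_D[OF t]] \<theta>_\<omega>[OF in_D[OF t]] in auto)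

lemma X\<omega>_has_derivative:
  assumes t: "t \<in> {0..\<tau>}"
  shows "((X t \<circ> \<omega> t) has_vector_derivative \<rho> t x *\<^sub>R tangent x) (at x)"
proof -
  have "((X t \<circ> \<omega> t) has_vector_derivative inverse (\<kappa> t (\<omega> t x) * R t (\<omega> t x)) *\<^sub>R R t (\<omega> t x) *\<^sub>R tangent (\<theta> t (\<omega> t x))) (at x)"
    by (rule vector_diff_chain_at[OF _ X_has_derivative[OF in_D[OF t]]])
      (use \<omega>_has_derivative[OF t] in \<open>simp add: has_real_derivative_iff_has_vector_derivative\<close>)
  then show ?thesis
    using R_pos[OF in_D[OF t], of "\<omega> t x"] by (simp add: \<theta>_\<omega>[OF in_D[OF t]] \<rho>_def field_simps)
qed

lemma P_has_derivative: "t \<in> {0..\<tau>} \<Longrightarrow> (P t has_real_derivative nderiv 1 (P t) x) (at x)"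
  using support_has_derivative[OF X\<omega>_has_derivative, of t x] nderiv1_support[OF X\<omega>_has_derivative, of t] by (simp add: P_def)

lemma P1_has_derivative: "t \<in> {0..\<tau>} \<Longrightarrow> (nderiv 1 (P t) has_real_derivative \<rho> t x - P t x) (at x)"
  using nderiv1_support_has_derivative[OF X\<omega>_has_derivative, of t x] by (simp add: P_def)

lemma nderiv2_P: "t \<in> {0..\<tau>} \<Longrightarrow> nderiv 2 (P t) x = \<rho> t x - P t x"
  using nderiv2_support[OF X\<omega>_has_derivative, of t] by (simp add: P_def)

lemma \<omega>_periodic: "t \<in> D \<Longrightarrow> \<omega> t (x + L) = \<omega> t x + L"
  using \<omega>_\<theta>[of t "\<omega> t x + L"] by (simp add: \<theta>_periodic \<theta>_\<omega>)

lemma \<rho>_periodic: "t \<in> {0..\<tau>} \<Longrightarrow> \<rho> t (x + L) = \<rho> t x"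
  by (simp add: \<rho>_def \<omega>_periodic[OF in_D] \<kappa>_periodic[OF in_D])

lemma P1_periodic: "t \<in> {0..\<tau>} \<Longrightarrow> nderiv 1 (P t) (x + L) = nderiv 1 (P t) x"
  using nderiv1_support[OF X\<omega>_has_derivative, of t]
  by (simp add: P_def \<omega>_periodic[OF in_D] X_periodic[OF in_D] tangent_periodic)

lemma \<rho>_cont: "continuous_on ({0..\<tau>} \<times> UNIV) (\<lambda>(t, x). \<rho> t x)"
proof -
  have "continuous_on ({0..\<tau>} \<times> UNIV) (\<lambda>z. \<kappa> (fst z) (\<omega> (fst z) (snd z)))"
    by (rule cont_slice[OF \<kappa>_cont]) (auto intro!: continuous_intros cont_slice[OF \<omega>_cont] in_D)
  then show ?thesis
    unfolding \<rho>_def case_prod_unfold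
    by (intro continuous_intros) (auto simp: less_imp_neq[OF \<kappa>_pos, THEN not_sym])
qed

definition "W t = k_sum k m (P t)"
definition "Rk t = k_sum k m (\<rho> t)"
definition "f t = nonlocal_term k m (\<lambda>x. \<kappa> t (\<omega> t x))"

lemma S_eq: "S t x = 2 * W t x - Rk t x + f t"
  by (simp add: S_def normal_speed_def W_def Rk_def f_def \<rho>_def[abs_def])

lemma W_shift: "t \<in> {0..\<tau>} \<Longrightarrow> W t (x + a) = W t x"
  and Rk_shift: "t \<in> {0..\<tau>} \<Longrightarrow> Rk t (x + a) = Rk t x"
  and W1_shift: "t \<in> {0..\<tau>} \<Longrightarrow> k_sum k m (nderiv 1 (P t)) (x + a) = k_sum k m (nderiv 1 (P t)) x"
  unfolding W_def Rk_def a_def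
  by (rule k_sum_shift[OF k_pos(2)];
      use P_periodic[OF in_D] \<rho>_periodic P1_periodic in \<open>simp add: L_def\<close>)+

lemma k_sum_S:
  assumes t: "t \<in> {0..\<tau>}" shows "k_sum k m (S t) x = real k * S t x"
  by (rule k_sum_of_periodic) (use W_shift[OF t] Rk_shift[OF t] in \<open>simp add: S_eq a_def\<close>)

lemma P_time: "t \<in> {0..\<tau>} \<Longrightarrow> ((\<lambda>s. P s x) has_real_derivative - S t x) (at t within {0..\<tau>})"
  by (rule DERIV_subset[OF P_has_time_derivative[OF in_D] D_down[OF \<tau>]])

lemma W_time:
  assumes t: "t \<in> {0..\<tau>}"
  shows "((\<lambda>s. W s x) has_real_derivative - (real k * S t x)) (at t within {0..\<tau>})"
proof -
  have "((\<lambda>s. W s x) has_real_derivative (\<Sum>i<k. - S t (x + 2 * real i * real m * pi / real k))) (at t within {0..\<tau>})"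
    unfolding W_def k_sum_def by (intro DERIV_sum P_time t)
  then show ?thesis using k_sum_S[OF t, of x] by (simp add: k_sum_def sum_negf)
qed

text \<open>The speed is made of sums over rotations and a function of time, so each of the
  \<open>k\<close> summands of w_k changes by the same amount, and w_k / k changes exactly as p
  does.\<close>

lemma P_minus_W:
  assumes t: "t \<in> {0..\<tau>}" shows "P t x - 1 / real k * W t x = b0 x"
proof -
  have "((\<lambda>s. P s x - 1 / real k * W s x) has_real_derivative 0) (at s within {0..\<tau>})" if s: "s \<in> {0..\<tau>}" for s
  proof -
    have "((\<lambda>s. P s x - 1 / real k * W s x) has_real_derivative - S s x - 1 / real k * - (real k * S s x)) (at s within {0..\<tau>})"
      by (intro DERIV_diff DERIV_cmult P_time W_time s)
    then show ?thesis using k_pos by simp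
  qed
  from DERIV_zero_imp_eq[OF this t] have "P t x - 1 / real k * W t x = P 0 x - 1 / real k * W 0 x" .
  moreover have "\<omega> 0 y = y" for y using \<theta>_\<omega>[OF D_0, of y] by (simp add: \<theta>_0)
  then have "P 0 = p0" by (auto simp: P_def p0_def X_0 o_def)
  ultimately show ?thesis by (simp add: b0_def W_def w0_def)
qed

lemma W_0: "W 0 x = w0 x"
proof -
  have "\<omega> 0 y = y" for y using \<theta>_\<omega>[OF D_0, of y] by (simp add: \<theta>_0)
  then have "P 0 = p0" by (auto simp: P_def p0_def X_0 o_def)
  then show ?thesis by (simp add: W_def w0_def)
qed

text \<open>The increments of \<open>w\<^sub>k - k U\<close> in \<open>x\<close> solve the linear equation \<open>z\<^sub>t = k (z'' - z)\<close> with zero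
  initial value.\<close>

lemma W_minus_U_const:
  assumes t: "t \<in> {0..\<tau>}"
  shows "W t h - real k * U t h = W t 0 - real k * U t 0"
proof -
  define z where "z t x = W t x - real k * U t x" for t x
  define z1 where "z1 t x = k_sum k m (nderiv 1 (P t)) x - real k * nderiv 1 (U t) x" for t x
  define z2 where "z2 t x = (Rk t x - W t x) - real k * nderiv 2 (U t) x" for t x
  have t0: "t \<ge> 0" if "t \<in> {0..\<tau>}" for t using that by simp
  have U0: "((\<lambda>s. U s x) has_real_derivative real k * (nderiv 2 (U t) x - U t x)) (at t within {0..\<tau>})" if "t \<in> {0..\<tau>}" for t x
    using DERIV_subset[OF U_time[OF t0[OF that], of 0 x], of "{0..\<tau>}"] by simp
  have Ux: "(nderiv n (U t) has_real_derivative nderiv (Suc n) (U t) x) (at x)" if "t \<in> {0..\<tau>}" for t x n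
    using csmooth_has_derivative[OF csmooth_U t0[OF that]] by (simp add: has_real_derivative_iff_has_vector_derivative)
  have zt: "((\<lambda>s. z s x) has_real_derivative real k * (z2 t x - z t x) - real k * f t) (at t within {0..\<tau>})" if "t \<in> {0..\<tau>}" for t x
  proof -
    have "((\<lambda>s. z s x) has_real_derivative - (real k * S t x) - real k * (real k * (nderiv 2 (U t) x - U t x))) (at t within {0..\<tau>})"
      unfolding z_def by (intro DERIV_diff DERIV_cmult W_time U0 that)
    then show ?thesis by (simp add: z_def z2_def S_eq algebra_simps)
  qed
  have zx: "(z t has_real_derivative z1 t x) (at x)" if "t \<in> {0..\<tau>}" for t x
    unfolding z_def[abs_def] z1_def W_def using Ux[OF that, of 0 x]
    by (intro DERIV_diff DERIV_cmult k_sum_has_derivative P_has_derivative that) (simp flip: One_nat_def)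
  have z1x: "(z1 t has_real_derivative z2 t x) (at x)" if "t \<in> {0..\<tau>}" for t x
  proof -
    have "(k_sum k m (nderiv 1 (P t)) has_real_derivative k_sum k m (\<lambda>x. \<rho> t x - P t x) x) (at x)"
      by (intro k_sum_has_derivative P1_has_derivative that)
    then show ?thesis
      unfolding z1_def[abs_def] z2_def W_def Rk_def k_sum_diff using Ux[OF that, of 1 x]
      by (intro DERIV_diff DERIV_cmult) (simp_all add: Suc_1)
  qed
  have sub: "{0..\<tau>} \<times> UNIV \<subseteq> D \<times> (UNIV :: real set)" using D_down[OF \<tau>] by auto
  have sub': "{0..\<tau>} \<times> UNIV \<subseteq> {0..} \<times> (UNIV :: real set)" by auto
  have cW: "continuous_on ({0..\<tau>} \<times> UNIV) (\<lambda>w. W (fst w) (snd w))"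
    using continuous_on_k_sum[OF continuous_on_subset[OF P_cont sub]] by (simp add: W_def case_prod_unfold)
  have cR: "continuous_on ({0..\<tau>} \<times> UNIV) (\<lambda>w. Rk (fst w) (snd w))"
    using continuous_on_k_sum[OF \<rho>_cont] by (simp add: Rk_def case_prod_unfold)
  have cU: "continuous_on ({0..\<tau>} \<times> UNIV) (\<lambda>w. nderiv n (U (fst w)) (snd w))" for n
    using continuous_on_subset[OF csmooth_continuous[OF csmooth_nderiv[OF csmooth_U, of n]] sub'] by (simp add: case_prod_unfold)
  have cz: "continuous_on ({0..\<tau>} \<times> UNIV) (\<lambda>(t, x). z t x)"
    unfolding z_def case_prod_unfold by (intro continuous_intros cW cU[of 0, simplified])
  have cz2: "continuous_on ({0..\<tau>} \<times> UNIV) (\<lambda>(t, x). z2 t x)"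
    unfolding z2_def case_prod_unfold by (intro continuous_intros cW cR cU)
  have shift: "((\<lambda>x. F (x + h)) has_real_derivative F') (at x)" if "(F has_real_derivative F') (at (x + h))" for F F' x
    using that by (simp add: DERIV_shift)
  \<comment> \<open>Taking differences in \<open>x\<close> removes the unknown term - k f of the
    equation for \<open>z\<close>, which depends on time alone.\<close>
  have "z t (0 + h) - z t 0 = 0"
  proof (rule periodic_heat_unique[of a "real k" \<tau> "\<lambda>t x. z t (x + h) - z t x" "\<lambda>t x. z2 t (x + h) - z2 t x" "\<lambda>t x. z1 t (x + h) - z1 t x", OF a_pos k_pos(1)])
    show "((\<lambda>s. z s (x + h) - z s x) has_real_derivative real k * (z2 t (x + h) - z2 t x - (z t (x + h) - z t x))) (at t within {0..\<tau>})"
      if "t \<in> {0..\<tau>}" for t x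
      using DERIV_diff[OF zt[OF that, of "x + h"] zt[OF that, of x]] by (simp add: algebra_simps)
    show "((\<lambda>x. z t (x + h) - z t x) has_real_derivative z1 t (x + h) - z1 t x) (at x)" if "t \<in> {0..\<tau>}" for t x
      by (intro DERIV_diff shift zx that)
    show "((\<lambda>x. z1 t (x + h) - z1 t x) has_real_derivative z2 t (x + h) - z2 t x) (at x)" if "t \<in> {0..\<tau>}" for t x
      by (intro DERIV_diff shift z1x that)
    show "continuous_on ({0..\<tau>} \<times> UNIV) (\<lambda>(t, x). z t (x + h) - z t x)"
      unfolding case_prod_unfold by (intro continuous_intros cont_slice[OF cz]) auto
    show "continuous_on ({0..\<tau>} \<times> UNIV) (\<lambda>(t, x). z2 t (x + h) - z2 t x)"
      unfolding case_prod_unfold by (intro continuous_intros cont_slice[OF cz2]) auto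
    have ah: "x + a + h = x + h + a" for x by simp
    show "z t (x + a + h) - z t (x + a) = z t (x + h) - z t x" if "t \<in> {0..\<tau>}" for t x
      unfolding ah by (simp add: z_def W_shift[OF that] U_periodic)
    show "z1 t (x + a + h) - z1 t (x + a) = z1 t (x + h) - z1 t x" if "t \<in> {0..\<tau>}" for t x
      unfolding ah by (simp add: z1_def W1_shift[OF that] nderiv_periodic[OF smooth_U U_periodic] t0[OF that])
    show "z 0 (x + h) - z 0 x = 0" for x using k_pos by (simp add: z_def W_0 U_0)
  qed (rule t)
  then show ?thesis by (simp add: z_def)
qed

text \<open>The constant in w_k / k = U + C, read off at angle 0; by \<open>W_minus_U_const\<close>
  any other angle gives the same value.\<close>

definition "C t = 1 / real k * W t 0 - U t 0"

lemma P_eq_q: "t \<in> {0..\<tau>} \<Longrightarrow> P t x = q t x + C t"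
  using P_minus_W[of t x] W_minus_U_const[of t x] k_pos by (simp add: q_def C_def field_simps)

lemma \<rho>_eq_g:
  assumes t: "t \<in> {0..\<tau>}" shows "\<rho> t x = g t x + C t"
proof -
  have t0: "t \<ge> 0" using t by simp
  have "P t = (\<lambda>x. q t x + C t)" using P_eq_q[OF t] by auto
  then have "nderiv 2 (P t) x = nderiv 2 (q t) x"
    by (simp add: nderiv_add[OF smooth_q[OF t0] smooth_const] nderiv_const)
  then show ?thesis using nderiv2_P[OF t, of x] P_eq_q[OF t, of x] by (simp add: g_def)
qed

lemma g_C_pos: "t \<in> {0..\<tau>} \<Longrightarrow> g t x + C t > 0"
  using \<rho>_pos \<rho>_eq_g by metis

definition "A t = integral {0..L} (\<lambda>x. g' t x / (g t x + C t)\<^sup>2)"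
definition "B t = integral {0..L} (\<lambda>x. 1 / (g t x + C t)\<^sup>2)"

text \<open>Inserting w_k and rho_k into the speed at angle 0, all multiples of \<open>C\<close> and
  \<open>U\<close> cancel except for the quotient in the nonlocal term. This is the equation
  satisfied by \<open>c\<close>.\<close>

lemma C_has_derivative:
  assumes t: "t \<in> {0..\<tau>}" shows "(C has_real_derivative - A t / B t) (at t within {0..\<tau>})"
proof -
  have t0: "t \<ge> 0" using t by simp
  have U0: "((\<lambda>s. U s 0) has_real_derivative real k * (nderiv 2 (U t) 0 - U t 0)) (at t within {0..\<tau>})"
    using DERIV_subset[OF U_time[OF t0, of 0 0], of "{0..\<tau>}"] by simp
  have "(C has_real_derivative 1 / real k * - (real k * S t 0) - real k * (nderiv 2 (U t) 0 - U t 0)) (at t within {0..\<tau>})"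
    unfolding C_def[abs_def] by (intro DERIV_diff DERIV_cmult W_time t U0)
  moreover have "W t 0 = real k * U t 0 + real k * C t"
    using k_pos by (simp add: C_def field_simps)
  moreover have "Rk t 0 = real k * (U t 0 + nderiv 2 (U t) 0) + real k * C t"
  proof -
    have "\<rho> t = (\<lambda>x. g t x + C t)" using \<rho>_eq_g[OF t] by auto
    then show ?thesis using k_sum_radius[OF t0 g_C_pos[OF t], of 0] by (simp add: Rk_def)
  qed
  moreover have "f t = A t / B t - real k * C t"
  proof -
    have "(\<lambda>x. \<kappa> t (\<omega> t x)) = (\<lambda>x. 1 / (g t x + C t))"
      using \<rho>_eq_g[OF t] by (auto simp: \<rho>_def simp flip: \<rho>_eq_g[OF t])
    then show ?thesis using nonlocal_term_eq[OF t0 g_C_pos[OF t]] by (simp add: f_def A_def B_def)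
  qed
  ultimately show ?thesis using k_pos by (simp add: S_eq algebra_simps)
qed

text \<open>The integral of 1 / (g + C) is constant: its derivative is - A + (A / B) B = 0. Hence
  \<open>C\<close> has the defining property of \<open>c\<close>, and no uniqueness theorem for the
  differential equation is invoked.\<close>

lemma C_eq_c:
  assumes t: "t \<in> {0..\<tau>}" shows "C t = c t"
proof -
  have cC: "continuous_on {0..\<tau>} C" by (rule DERIV_continuous_on[OF C_has_derivative])
  have sub: "{0..\<tau>} \<times> {0..L} \<subseteq> {0..} \<times> UNIV" by auto
  have cg: "continuous_on ({0..\<tau>} \<times> {0..L}) (\<lambda>w. g (fst w) (snd w))"
    using continuous_on_subset[OF csmooth_continuous[OF csmooth_g] sub] by (simp add: case_prod_unfold)
  have cg': "continuous_on ({0..\<tau>} \<times> {0..L}) (\<lambda>w. g' (fst w) (snd w))"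
    using continuous_on_subset[OF csmooth_continuous[OF csmooth_g'] sub] by (simp add: case_prod_unfold)
  have cgC: "continuous_on ({0..\<tau>} \<times> {0..L}) (\<lambda>w. g (fst w) (snd w) + C (fst w))"
    by (intro continuous_intros cg continuous_on_compose2[OF cC]) auto
  have nz: "g t x + C t \<noteq> 0" if "t \<in> {0..\<tau>}" for t x using g_C_pos[OF that, of x] by simp
  have cA: "continuous_on {0..\<tau>} A"
    unfolding A_def
    by (rule continuous_on_space_integral, unfold case_prod_unfold, intro continuous_intros cgC cg') (use nz in auto)
  have cB: "continuous_on {0..\<tau>} B"
    unfolding B_def
    by (rule continuous_on_space_integral, unfold case_prod_unfold, intro continuous_intros cgC) (use nz in auto)
  have cgs: "continuous_on {0..L} (g t)" "continuous_on {0..L} (g' t)" if "t \<in> {0..\<tau>}" for t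
    using that smooth_continuous_nderiv[OF csmooth_smooth[OF csmooth_g], of t _ 0]
      smooth_continuous_nderiv[OF csmooth_smooth[OF csmooth_g'], of t _ 0] by auto
  have Bpos: "B t > 0" if "t \<in> {0..\<tau>}" for t
    unfolding B_def by (rule integral_positive[OF _ L_pos], intro continuous_intros cgs that) (use nz that in auto)
  define e where "e t = integral {0..L} (\<lambda>x. 1 / (g t x + C t))" for t
  let ?d = "\<lambda>t x. - (g' t x - A t / B t) / (g t x + C t)\<^sup>2"
  have "(e has_real_derivative 0) (at s within {0..\<tau>})" if s: "s \<in> {0..\<tau>}" for s
  proof -
    have "((\<lambda>t. integral (cbox 0 L) (\<lambda>x. 1 / (g t x + C t))) has_vector_derivative integral (cbox 0 L) (?d s)) (at s within {0..\<tau>})"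
    proof (rule leibniz_rule_vector_derivative)
      fix t x assume t: "t \<in> {0..\<tau>}"
      have "((\<lambda>s. g s x) has_real_derivative g' t x) (at t within {0..\<tau>})"
        using t by (intro DERIV_subset[OF g_has_time_derivative]) auto
      from DERIV_inverse_fun[OF DERIV_add[OF this C_has_derivative[OF t]] nz[OF t]]
      have "((\<lambda>t. 1 / (g t x + C t)) has_real_derivative
          - (inverse (g t x + C t) * (g' t x + - A t / B t) * inverse (g t x + C t))) (at t within {0..\<tau>})"
        by (simp add: inverse_eq_divide)
      moreover have "- (inverse y * (b + - d / e) * inverse y) = - (b - d / e) / y\<^sup>2" for y b d e :: real
        unfolding divide_inverse power2_eq_square by (simp add: algebra_simps)
      ultimately show "((\<lambda>t. 1 / (g t x + C t)) has_vector_derivative ?d t x) (at t within {0..\<tau>})"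
        by (simp only: has_real_derivative_iff_has_vector_derivative)
    next
      show "(\<lambda>x. 1 / (g t x + C t)) integrable_on cbox 0 L" if "t \<in> {0..\<tau>}" for t
        unfolding box_real using nz[OF that] by (intro integrable_continuous_real continuous_intros cgs that) auto
      show "continuous_on ({0..\<tau>} \<times> cbox 0 L) (\<lambda>(t, x). ?d t x)"
        unfolding case_prod_unfold box_real
        by (intro continuous_intros cg' cgC continuous_on_compose2[OF cA] continuous_on_compose2[OF cB])
          (use nz less_imp_neq[OF Bpos, THEN not_sym] in auto)
    qed (use s in auto)
    moreover have "integral {0..L} (?d s) = 0"
    proof -
      have "integral {0..L} (?d s) = integral {0..L} (\<lambda>x. (A s / B s) * (1 / (g s x + C s)\<^sup>2) - g' s x / (g s x + C s)\<^sup>2)"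
        by (intro Henstock_Kurzweil_Integration.integral_cong) (simp add: diff_divide_distrib)
      also have "\<dots> = integral {0..L} (\<lambda>x. (A s / B s) * (1 / (g s x + C s)\<^sup>2)) - A s"
        unfolding A_def using nz[OF s]
        by (intro Henstock_Kurzweil_Integration.integral_diff integrable_continuous_real continuous_intros cgs s) auto
      also have "integral {0..L} (\<lambda>x. (A s / B s) * (1 / (g s x + C s)\<^sup>2)) = (A s / B s) * B s"
        unfolding B_def by (rule integral_mult_right)
      finally show ?thesis using Bpos[OF s] by simp
    qed
    ultimately show ?thesis by (simp add: e_def[abs_def] has_real_derivative_iff_has_vector_derivative)
  qed
  from DERIV_zero_imp_eq[OF this t] have "e t = e 0" .
  also have "C 0 = 0" using k_pos by (simp add: C_def W_0 U_0)
  then have "e 0 = E0" by (simp add: e_def E0_def g_0)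
  finally show ?thesis
    using t g_C_pos[OF t] by (intro c_unique) (auto simp: e_def)
qed

lemma canonical:
  assumes t: "t \<in> {0..\<tau>}"
  shows "\<kappa> t u = 1 / r t (\<theta> t u)" "X t \<circ> \<omega> t = Y t"
proof -
  have "\<rho> t x = r t x" for x using \<rho>_eq_g[OF t] C_eq_c[OF t] by (simp add: r_def)
  then have 1: "1 / \<kappa> t (\<omega> t (\<theta> t u)) = r t (\<theta> t u)" by (simp add: \<rho>_def)
  have "\<kappa> t u = 1 / (1 / \<kappa> t u)" by simp
  also have "1 / \<kappa> t u = r t (\<theta> t u)" using 1 by (simp add: \<omega>_\<theta>[OF in_D[OF t]])
  finally show "\<kappa> t u = 1 / r t (\<theta> t u)" .
  have "P t = p t" using P_eq_q[OF t] C_eq_c[OF t] by (auto simp: p_def)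
  then show "X t \<circ> \<omega> t = Y t" using curve_of_support[OF X\<omega>_has_derivative[OF t]] by (simp add: P_def Y_def)
qed

end

section \<open>Positivity of the curvature for all times\<close>

context flow
begin

text \<open>Continuation argument at the infimum \<open>s\<close> of the times with a point of
  nonpositive curvature. Before \<open>s\<close> the curvature is 1 / r, where \<open>r\<close> is
  positive at all times by construction; so it is positive at \<open>s\<close>, and by compactness
  of a period also shortly after, contradicting the choice of \<open>s\<close>.\<close>

lemma \<kappa>_pos: assumes "t1 \<in> D" shows "\<kappa> t1 u > 0"
proof (rule ccontr)
  assume neg: "\<not> \<kappa> t1 u > 0"
  define bad where "bad = {t \<in> D. \<exists>u. \<kappa> t u \<le> 0}"
  define s where "s = Inf bad"
  have t1: "t1 \<in> bad" using assms neg by (auto simp: bad_def not_less)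
  have bb: "bdd_below bad" using D_nonneg by (intro bdd_belowI[of _ 0]) (auto simp: bad_def)
  have s_le: "s \<le> t" if "t \<in> bad" for t unfolding s_def by (rule cInf_lower[OF that bb])
  have s_ge: "s \<ge> 0" unfolding s_def using t1 D_nonneg by (intro cInf_greatest) (auto simp: bad_def)
  have sD: "{0..s} \<subseteq> D" using D_down[OF assms] s_le[OF t1] by auto
  have before: "\<kappa> t u > 0" if "0 \<le> t" "t < s" for t u
  proof (rule ccontr)
    assume "\<not> \<kappa> t u > 0"
    moreover have "t \<in> D" using that sD by auto
    ultimately have "t \<in> bad" by (auto simp: bad_def not_less)
    with s_le[of t] that show False by simp
  qed
  have at_s: "\<kappa> s u > 0" for u
  proof (cases "s = 0")
    case True
    then show ?thesis
      using convex_X0 by (simp add: \<kappa>_def X_0 locally_convex_curve_def)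
  next
    case False
    then have s: "s > 0" using s_ge by simp
    \<comment> \<open>The product form stays meaningful at time \<open>s\<close>, where the
      curvature is not yet known to be nonzero. It equals 1 before \<open>s\<close>, hence also at
      \<open>s\<close>.\<close>
    define h where "h t = \<kappa> t u * r t (\<theta> t u)" for t
    have ch: "continuous_on {0..s} h"
      unfolding h_def
      by (intro continuous_intros cont_slice[OF \<kappa>_cont] cont_slice[OF csmooth_continuous[OF csmooth_r]] cont_slice[OF \<theta>_cont])
        (use sD in auto)
    have h1: "h t = 1" if t: "t \<in> {0..<s}" for t
    proof -
      interpret c: convex_flow k m X0 T X \<theta> t
        by unfold_locales (use t sD before in auto)
      have "r t (\<theta> t u) > 0" using t by (intro r_pos) auto
      then show ?thesis using c.canonical(1)[of t u] t by (simp add: h_def)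
    qed
    have cl: "closure {0..<s} = {0..s}" using s by simp
    have "h s = 1"
      by (rule continuous_constant_on_closure[of "{0..<s}" h]) (use ch h1 s cl in auto)
    moreover have "r s (\<theta> s u) > 0" using s by (intro r_pos) auto
    ultimately show ?thesis by (simp add: h_def) (metis less_numeral_extra(1) zero_less_mult_pos2)
  qed
  have "s \<noteq> t1" using at_s t1 by (auto simp: bad_def not_le[symmetric])
  then have s_less: "s < t1" using s_le[OF t1] by simp
  have cs: "continuous_on {0..L} (\<kappa> s)"
    by (rule cont_slice[OF \<kappa>_cont]) (use sD s_ge in \<open>auto intro!: continuous_intros\<close>)
  \<comment> \<open>The positive minimum over one period serves as tolerance, so that a short time
    step cannot make the curvature vanish anywhere.\<close>
  obtain u0 where u0: "\<And>u. u \<in> {0..L} \<Longrightarrow> \<kappa> s u0 \<le> \<kappa> s u"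
    using continuous_attains_inf[OF compact_Icc _ cs] L_pos by force
  have "uniformly_continuous_on ({0..t1} \<times> {0..L}) (\<lambda>(t, u). \<kappa> t u)"
    by (intro compact_uniformly_continuous continuous_on_subset[OF \<kappa>_cont] compact_Times compact_Icc) (use D_down[OF assms] in auto)
  then obtain \<delta> where \<delta>: "\<delta> > 0" "\<And>z z'. z \<in> {0..t1} \<times> {0..L} \<Longrightarrow> z' \<in> {0..t1} \<times> {0..L} \<Longrightarrow> dist z' z < \<delta> \<Longrightarrow>
     dist ((\<lambda>(t, u). \<kappa> t u) z') ((\<lambda>(t, u). \<kappa> t u) z) < \<kappa> s u0"
    unfolding uniformly_continuous_on_def using at_s by meson
  have "Inf bad < min (s + \<delta>) t1" using s_less \<delta>(1) by (simp add: s_def)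
  then obtain t where t: "t \<in> bad" "t < min (s + \<delta>) t1"
    using cInf_lessD[of bad] t1 by blast
  have tD: "t \<in> D" and ts: "s \<le> t" using t(1) s_le by (auto simp: bad_def)
  obtain v where v: "\<kappa> t v \<le> 0" using t(1) by (auto simp: bad_def)
  obtain w where w: "w \<in> {0..L}" "\<kappa> t w = \<kappa> t v"
    using periodic_representative[OF L_pos, of "\<kappa> t" v] \<kappa>_periodic[OF tD] by metis
  have "dist (t, w) (s, w) = \<bar>t - s\<bar>" by (simp add: dist_prod_def dist_real_def)
  then have "dist (\<kappa> t w) (\<kappa> s w) < \<kappa> s u0"
    using \<delta>(2)[of "(s, w)" "(t, w)"] t ts s_ge s_less w by auto
  then have "\<kappa> t w > 0" using u0[OF w(1)] by (auto simp: dist_real_def abs_less_iff)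
  then show False using v w by simp
qed

lemma
  assumes t: "t \<in> D"
  shows curvature_eq: "curvature (X t) u = 1 / r t (\<theta> t u)" and X_eq_Y: "X t \<circ> inv (\<theta> t) = Y t"
proof -
  interpret c: convex_flow k m X0 T X \<theta> t
    by unfold_locales (use t D_down[OF t] \<kappa>_pos in auto)
  have "t \<in> {0..t}" using D_nonneg[OF t] by simp
  from c.canonical[OF this] show "curvature (X t) u = 1 / r t (\<theta> t u)" "X t \<circ> inv (\<theta> t) = Y t"
    by (auto simp: \<kappa>_def \<omega>_def)
qed

lemma elastic_energy_eq:
  assumes t: "t \<in> D" shows "elastic_energy (2 * real m * pi) (X t) = E0"
proof -
  have t0: "t \<ge> 0" by (rule D_nonneg[OF t])
  have "elastic_energy L (X t) = integral {0..L} (\<lambda>x. 1 / r t x)"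
  proof (rule elastic_energy_by_angle[of "\<theta> t"])
    show "(\<theta> t has_real_derivative curvature (X t) u * norm (nderiv 1 (X t) u)) (at u)" for u
      using \<theta>_has_derivative[OF t] by (simp add: \<kappa>_def R_def)
    show "continuous_on UNIV (\<lambda>x. 1 / r t x)"
      using r_pos[OF t0] by (intro continuous_intros r_continuous t0) (metis less_irrefl)
    show "\<theta> t L = \<theta> t 0 + L" using \<theta>_periodic[OF t, of 0] by simp
    show "mono (\<theta> t)" by (rule strict_mono_mono[OF \<theta>_mono[OF t]])
  qed (simp_all add: curvature_eq[OF t] r_periodic[OF t0] L_pos)
  then show ?thesis using r_integral[OF t0] by (simp add: L_def)
qed

lemma locally_convex_X:
  assumes t: "t \<in> D" shows "locally_convex_curve (2 * real m * pi) (X t)"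
  unfolding locally_convex_curve_def closed_curve_def immersed_def
  using smooth_X[OF t] X_periodic[OF t] X_regular[OF t] L_pos \<kappa>_pos[OF t]
  by (auto simp: smooth_def L_def \<kappa>_def)

end

section \<open>The limit curve\<close>

lemma smooth_scaleR_frame:
  assumes "smooth f" shows "smooth (\<lambda>x. f x *\<^sub>R tangent x)" "smooth (\<lambda>x. f x *\<^sub>R normal x)"
  unfolding smooth_iff_csmooth
  by (rule csmooth_scaleR[OF csmooth_static[OF assms] csmooth_static[OF smooth_tangent]]
      csmooth_scaleR[OF csmooth_static[OF assms] csmooth_static[OF smooth_normal]])+

text \<open>Each derivative of f T or f N splits into two terms of the same kind, since T' = N and
  N' = - T. This is the source of the factor 2 ^ n, and the reason why both bounds are proved
  together.\<close>

lemma nderiv_scaleR_frame_bound: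
  assumes "smooth f" "\<And>i x. i \<le> n \<Longrightarrow> \<bar>nderiv i f x\<bar> \<le> e"
  shows "norm (nderiv n (\<lambda>x. f x *\<^sub>R tangent x) x) \<le> 2 ^ n * e"
    and "norm (nderiv n (\<lambda>x. f x *\<^sub>R normal x) x) \<le> 2 ^ n * e"
proof -
  have "norm (nderiv n (\<lambda>x. f x *\<^sub>R tangent x) x) \<le> 2 ^ n * e \<and> norm (nderiv n (\<lambda>x. f x *\<^sub>R normal x) x) \<le> 2 ^ n * e"
    using assms
  proof (induction n arbitrary: f)
    case 0
    then show ?case using "0.prems"(2)[of 0 x] by (simp add: normal_eq_cis norm_mult)
  next
    case (Suc n)
    let ?f' = "nderiv 1 f" and ?g = "\<lambda>x. - f x"
    have df: "(f has_real_derivative ?f' x) (at x)" for x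
      using smooth_has_derivative[OF Suc.prems(1), of 0 x] by (simp add: has_real_derivative_iff_has_vector_derivative flip: One_nat_def)
    have sf': "smooth ?f'" by (rule smooth_nderiv[OF Suc.prems(1)])
    have sg: "smooth ?g" using csmooth_minus[OF csmooth_static[OF Suc.prems(1)]] by (simp add: smooth_iff_csmooth)
    have ng: "nderiv i ?g = (\<lambda>x. - nderiv i f x)" for i
      using nderiv_cmult[OF Suc.prems(1), of i "-1"] by simp
    have bf': "\<bar>nderiv i ?f' x\<bar> \<le> e" if "i \<le> n" for i x
      using Suc.prems(2)[of "Suc i" x] that by (simp add: nderiv_Suc[of i])
    have bf: "\<bar>nderiv i f x\<bar> \<le> e" "\<bar>nderiv i ?g x\<bar> \<le> e" if "i \<le> n" for i x
      using Suc.prems(2)[of i x] that by (auto simp: ng)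
    have "nderiv 1 (\<lambda>x. f x *\<^sub>R tangent x) = (\<lambda>x. f x *\<^sub>R normal x + ?f' x *\<^sub>R tangent x)"
      by (intro nderiv_1_eq has_vector_derivative_scaleR df tangent_has_derivative)
    then have 1: "nderiv (Suc n) (\<lambda>x. f x *\<^sub>R tangent x) x = nderiv n (\<lambda>x. f x *\<^sub>R normal x) x + nderiv n (\<lambda>x. ?f' x *\<^sub>R tangent x) x"
      unfolding nderiv_Suc[of n] by (simp add: nderiv_add smooth_scaleR_frame Suc.prems(1) sf')
    have "nderiv 1 (\<lambda>x. f x *\<^sub>R normal x) = (\<lambda>x. f x *\<^sub>R (- tangent x) + ?f' x *\<^sub>R normal x)"
      by (intro nderiv_1_eq has_vector_derivative_scaleR df normal_has_derivative)
    then have "nderiv 1 (\<lambda>x. f x *\<^sub>R normal x) = (\<lambda>x. ?g x *\<^sub>R tangent x + ?f' x *\<^sub>R normal x)" by simp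
    then have 2: "nderiv (Suc n) (\<lambda>x. f x *\<^sub>R normal x) x = nderiv n (\<lambda>x. ?g x *\<^sub>R tangent x) x + nderiv n (\<lambda>x. ?f' x *\<^sub>R normal x) x"
      unfolding nderiv_Suc[of n] by (simp only: nderiv_add[OF smooth_scaleR_frame(1)[OF sg] smooth_scaleR_frame(2)[OF sf']])
    from Suc.IH[OF sf' bf'] Suc.IH[OF Suc.prems(1) bf(1)] Suc.IH[OF sg bf(2)]
    show ?case
      unfolding 1 2 by (auto intro!: order_trans[OF norm_triangle_ineq])
  qed
  then show "norm (nderiv n (\<lambda>x. f x *\<^sub>R tangent x) x) \<le> 2 ^ n * e" "norm (nderiv n (\<lambda>x. f x *\<^sub>R normal x) x) \<le> 2 ^ n * e" by auto
qed

context initial_curve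
begin

text \<open>What is left of \<open>g\<close> once \<open>U\<close> has decayed; the limit
  translation is fixed by the same energy \<open>E0\<close>.\<close>

definition "g_inf x = b0 x + nderiv 2 b0 x"

lemma smooth_g_inf: "smooth g_inf"
  unfolding g_inf_def[abs_def] by (intro smooth_add smooth_b0 smooth_nderiv)

lemma g_inf_periodic: "g_inf (x + L) = g_inf x"
  by (simp add: g_inf_def b0_periodic nderiv_periodic[OF smooth_b0 b0_periodic])

lemma g_inf_continuous: "continuous_on S g_inf"
  using smooth_continuous_nderiv[OF smooth_g_inf, of S 0] by simp

lemma translation_limit_exists:
  "\<exists>C. (\<forall>x. g_inf x + C > 0) \<and> integral {0..L} (\<lambda>x. 1 / (g_inf x + C)) = E0"
proof -
  obtain K where K: "\<And>x. \<bar>nderiv 1 g_inf x\<bar> \<le> K"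
    using smooth_periodic_nderiv_bounded[OF smooth_g_inf L_pos g_inf_periodic] by blast
  have "K \<ge> 0" using K[of 0] by linarith
  then have K1: "K + 1 > 0" by simp
  have "\<bar>g_inf x - g_inf y\<bar> \<le> (K + 1) * \<bar>x - y\<bar>" for x y
  proof (rule lipschitz_of_bounded_derivative)
    show "(g_inf has_real_derivative nderiv 1 g_inf x) (at x)" for x
      using smooth_has_derivative[OF smooth_g_inf, of 0 x] by (simp add: has_real_derivative_iff_has_vector_derivative flip: One_nat_def)
    show "\<bar>nderiv 1 g_inf x\<bar> \<le> K + 1" for x using K[of x] by simp
  qed
  then show ?thesis
    by (intro translation_exists[OF L_pos K1 _ g_inf_continuous g_inf_periodic E0_pos]) auto
qed

definition "c_inf = (SOME C. (\<forall>x. g_inf x + C > 0) \<and> integral {0..L} (\<lambda>x. 1 / (g_inf x + C)) = E0)"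

lemma c_inf_pos: "g_inf x + c_inf > 0"
  and c_inf_integral: "integral {0..L} (\<lambda>x. 1 / (g_inf x + c_inf)) = E0"
  using someI_ex[OF translation_limit_exists] by (auto simp: c_inf_def)

definition "p_inf x = b0 x + c_inf"
definition "Z = curve_of p_inf"

lemma smooth_p_inf: "smooth p_inf"
  unfolding p_inf_def[abs_def] by (intro smooth_add smooth_b0 smooth_const)

lemma nderiv_p_inf: "nderiv n p_inf x = nderiv n b0 x + (if n = 0 then c_inf else 0)"
  unfolding p_inf_def[abs_def] by (simp add: nderiv_add[OF smooth_b0 smooth_const] nderiv_const)

lemma smooth_Z: "smooth Z"
  using csmooth_curve_of[OF csmooth_static[OF smooth_p_inf]] by (simp add: Z_def smooth_iff_csmooth)

lemma Z_has_derivative: "(Z has_vector_derivative (g_inf x + c_inf) *\<^sub>R tangent x) (at x)"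
proof -
  have "(Z has_vector_derivative (p_inf x + nderiv 2 p_inf x) *\<^sub>R tangent x) (at x)"
    unfolding Z_def
    using smooth_has_derivative[OF smooth_p_inf, of 0 x] smooth_has_derivative[OF smooth_p_inf, of 1 x]
    by (intro curve_of_has_derivative)
      (auto simp: has_real_derivative_iff_has_vector_derivative Suc_1 simp flip: One_nat_def)
  moreover have "p_inf x + nderiv 2 p_inf x = g_inf x + c_inf"
    by (simp add: nderiv_p_inf g_inf_def) (simp add: p_inf_def)
  ultimately show ?thesis by simp
qed

lemma Z_x: "nderiv 1 Z = (\<lambda>x. (g_inf x + c_inf) *\<^sub>R tangent x)"
  by (rule nderiv_1_eq) (rule Z_has_derivative)

lemma Z_periodic: "Z (x + L) = Z x"
proof -
  have p: "p_inf (x + L) = p_inf x" for x by (simp add: p_inf_def b0_periodic)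
  show ?thesis
    using nderiv_periodic[OF smooth_p_inf p, of 1]
    by (simp add: Z_def curve_of_def tangent_periodic normal_periodic p)
qed

lemma by_tangent_angle_Z: "by_tangent_angle Z"
  unfolding by_tangent_angle_def tangent_angle_def Z_x
proof
  fix x show "sgn ((g_inf x + c_inf) *\<^sub>R tangent x) = tangent x"
    using c_inf_pos[of x] by (simp add: sgn_div_norm)
qed

lemma locally_convex_Z: "locally_convex_curve (2 * real m * pi) Z"
proof -
  have "curvature Z x = 1 / (g_inf x + c_inf)" for x
  proof (rule curvature_of_polar_derivative[OF Z_x])
    show "((\<lambda>x. g_inf x + c_inf) has_real_derivative nderiv 1 g_inf x + 0) (at x)"
      using smooth_has_derivative[OF smooth_g_inf, of 0 x]
      by (intro DERIV_add DERIV_const) (simp add: has_real_derivative_iff_has_vector_derivative flip: One_nat_def)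
  qed (auto simp: c_inf_pos)
  moreover have "nderiv 1 Z x \<noteq> 0" for x
    unfolding Z_x using c_inf_pos[of x] norm_tangent[of x] by (metis less_irrefl norm_zero scaleR_eq_0_iff zero_neq_one)
  ultimately show ?thesis
    using smooth_Z Z_periodic L_pos c_inf_pos
    by (simp add: locally_convex_curve_def smooth_def closed_curve_def immersed_def L_def)
qed

lemma constant_width_Z: "constant_width k m Z"
proof -
  have "k_sum k m (support Z) x = real k * c_inf" for x
    unfolding Z_def support_curve_of p_inf_def[abs_def] by (simp add: k_sum_add k_sum_b0 k_sum_const)
  then show ?thesis by (auto simp: constant_width_def)
qed

text \<open>No analysis of the equation for \<open>c\<close> is involved:
  \<open>translation_bound\<close> estimates the distance of \<open>c t\<close> to its limit by that
  of \<open>g t\<close> to \<open>g_inf\<close>, which is U + U'' and decays exponentially.\<close>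

lemma p_converges: "\<exists>C\<ge>0. \<forall>t\<ge>0. \<forall>x. \<bar>nderiv n (\<lambda>x. p t x - p_inf x) x\<bar> \<le> C * exp (- real k * t)"
proof -
  obtain C0 where C0: "\<And>t x. t \<ge> 0 \<Longrightarrow> \<bar>nderiv 0 (U t) x\<bar> \<le> C0 * exp (- real k * t)" using U_decay by blast
  obtain C2 where C2: "\<And>t x. t \<ge> 0 \<Longrightarrow> \<bar>nderiv 2 (U t) x\<bar> \<le> C2 * exp (- real k * t)" using U_decay by blast
  obtain Cn where Cn: "\<And>t x. t \<ge> 0 \<Longrightarrow> \<bar>nderiv n (U t) x\<bar> \<le> Cn * exp (- real k * t)" using U_decay by blast
  have nn: "C0 \<ge> 0" "C2 \<ge> 0" "Cn \<ge> 0" using C0[of 0 0] C2[of 0 0] Cn[of 0 0] by simp_all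
  have "\<bar>nderiv n (\<lambda>x. p t x - p_inf x) x\<bar> \<le> (Cn + (C0 + C2)) * exp (- real k * t)" if t: "t \<ge> 0" for t x
  proof -
    have "\<bar>c t - c_inf\<bar> \<le> (C0 + C2) * exp (- real k * t)"
    proof (rule translation_bound[OF L_pos g_continuous[OF t] g_inf_continuous])
      show "g t x + c t > 0" for x using c_spec[OF t] by blast
      show "integral {0..L} (\<lambda>x. 1 / (g t x + c t)) = integral {0..L} (\<lambda>x. 1 / (g_inf x + c_inf))"
        using c_spec[OF t] c_inf_integral by simp
      fix x
      have "g t x - g_inf x = U t x + nderiv 2 (U t) x"
        by (simp add: g_def g_inf_def nderiv_q[OF t]) (simp add: q_def)
      also have "\<bar>\<dots>\<bar> \<le> (C0 + C2) * exp (- real k * t)"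
        using C0[OF t, of x] C2[OF t, of x] by (simp add: distrib_right)
      finally show "\<bar>g t x - g_inf x\<bar> \<le> (C0 + C2) * exp (- real k * t)" .
    qed (rule c_inf_pos)
    moreover have "nderiv n (\<lambda>x. p t x - p_inf x) x = nderiv n (U t) x + (if n = 0 then c t - c_inf else 0)"
      using nderiv_diff[OF csmooth_smooth[OF csmooth_p t] smooth_p_inf, of n]
      by (simp add: nderiv_p[OF t] nderiv_q[OF t] nderiv_p_inf)
    moreover have "(C0 + C2) * exp (- real k * t) \<ge> 0" using nn by simp
    ultimately show ?thesis using Cn[OF t, of x] by (auto simp: distrib_right)
  qed
  then show ?thesis using nn by (intro exI[of _ "Cn + (C0 + C2)"]) auto
qed

lemma Y_converges: "converges_smoothly Y Z"
  unfolding converges_smoothly_def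
proof
  fix n
  obtain C where C: "\<And>i. C i \<ge> 0" "\<And>i t x. t \<ge> 0 \<Longrightarrow> \<bar>nderiv i (\<lambda>x. p t x - p_inf x) x\<bar> \<le> C i * exp (- real k * t)"
    using p_converges by metis
  \<comment> \<open>The curve contains the first derivative of the support function, so order n of
    the curve needs order n + 1 there.\<close>
  define M where "M = (\<Sum>i\<le>Suc n. C i)"
  have M: "C i \<le> M" if "i \<le> Suc n" for i
    unfolding M_def using that C(1) by (intro member_le_sum) auto
  have bound: "norm (nderiv n (Y t) x - nderiv n Z x) \<le> 2 * 2 ^ n * M * exp (- real k * t)" if t: "t \<ge> 0" for t x
  proof -
    define d where "d x = p t x - p_inf x" for x
    have sp: "smooth (p t)" by (rule csmooth_smooth[OF csmooth_p t])
    have sd: "smooth d" unfolding d_def[abs_def] by (intro smooth_diff sp smooth_p_inf)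
    have d1: "nderiv 1 d x = nderiv 1 (p t) x - nderiv 1 p_inf x" for x
      unfolding d_def[abs_def] by (simp add: nderiv_diff[OF sp smooth_p_inf])
    have b: "\<bar>nderiv i d x\<bar> \<le> M * exp (- real k * t)" if "i \<le> Suc n" for i x
      using C(2)[OF t, of i x] M[OF that] unfolding d_def[abs_def]
      by (meson exp_ge_zero mult_right_mono order_trans)
    have "(\<lambda>x. Y t x - Z x) = (\<lambda>x. nderiv 1 d x *\<^sub>R tangent x - d x *\<^sub>R normal x)"
      by (auto simp: Y_def Z_def curve_of_def d1 d_def algebra_simps)
    moreover have "nderiv n (\<lambda>x. Y t x - Z x) x = nderiv n (Y t) x - nderiv n Z x"
      by (simp add: nderiv_diff[OF csmooth_smooth[OF csmooth_Y t] smooth_Z])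
    moreover have "nderiv n (\<lambda>x. nderiv 1 d x *\<^sub>R tangent x - d x *\<^sub>R normal x) x
        = nderiv n (\<lambda>x. nderiv 1 d x *\<^sub>R tangent x) x - nderiv n (\<lambda>x. d x *\<^sub>R normal x) x"
      by (simp add: nderiv_diff smooth_scaleR_frame smooth_nderiv sd)
    moreover have "norm (nderiv n (\<lambda>x. nderiv 1 d x *\<^sub>R tangent x) x) \<le> 2 ^ n * (M * exp (- real k * t))"
      by (rule nderiv_scaleR_frame_bound(1)[OF smooth_nderiv[OF sd]])
        (use b in \<open>simp flip: nderiv_Suc\<close>)
    moreover have "norm (nderiv n (\<lambda>x. d x *\<^sub>R normal x) x) \<le> 2 ^ n * (M * exp (- real k * t))"
      by (rule nderiv_scaleR_frame_bound(2)[OF sd]) (use b in simp)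
    ultimately show ?thesis
      using norm_triangle_ineq4[of "nderiv n (\<lambda>x. nderiv 1 d x *\<^sub>R tangent x) x" "nderiv n (\<lambda>x. d x *\<^sub>R normal x) x"]
      by simp
  qed
  show "uniform_limit UNIV (\<lambda>t. nderiv n (Y t)) (nderiv n Z) at_top"
    unfolding uniform_limit_iff
  proof (intro allI impI)
    fix e :: real assume e: "e > 0"
    have "filterlim (\<lambda>t. real k * t) at_top at_top"
      by (rule filterlim_tendsto_pos_mult_at_top[OF tendsto_const k_pos(1) filterlim_ident])
    then have "filterlim (\<lambda>t. - real k * t) at_bot at_top"
      by (simp add: filterlim_uminus_at_top)
    then have "((\<lambda>t. exp (- real k * t)) \<longlongrightarrow> 0) at_top"
      by (rule filterlim_compose[OF exp_at_bot])
    then have "((\<lambda>t. 2 * 2 ^ n * M * exp (- real k * t)) \<longlongrightarrow> 0) at_top"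
      by (rule tendsto_mult_right_zero)
    then have "\<forall>\<^sub>F t in at_top. 2 * 2 ^ n * M * exp (- real k * t) < e"
      using e by (rule order_tendstoD(2))
    then show "\<forall>\<^sub>F t in at_top. \<forall>x\<in>UNIV. dist (nderiv n (Y t) x) (nderiv n Z x) < e"
      using eventually_ge_at_top[of 0]
    proof eventually_elim
      case (elim t)
      show ?case
      proof
        fix x show "dist (nderiv n (Y t) x) (nderiv n Z x) < e"
          using bound[OF elim(2), of x] elim(1) by (simp add: dist_norm)
      qed
    qed
  qed
qed

text \<open>Links the limit to the symmetry of the initial curve: up to a constant, the limiting
  radius is the deviation of \<open>r0\<close> from its mean over the rotations.\<close>

lemma g_inf_eq: "g_inf x = r0 x - 1 / real k * k_sum k m r0 x"
proof -
  have "nderiv 2 b0 x = nderiv 2 p0 x - 1 / real k * nderiv 2 w0 x"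
    unfolding b0_def[abs_def]
    by (simp only: nderiv_diff[OF smooth_p0 smooth_mult[OF smooth_const smooth_w0]] nderiv_cmult[OF smooth_w0])
  moreover have "k_sum k m r0 x = w0 x + nderiv 2 w0 x"
  proof -
    have "r0 = (\<lambda>x. p0 x + nderiv 2 p0 x)" using r0_eq by auto
    then show ?thesis by (simp add: k_sum_add w0_def nderiv_k_sum[OF smooth_p0])
  qed
  ultimately show ?thesis by (simp add: g_inf_def b0_def r0_eq distrib_left)
qed

lemma tangent_shift: "tangent (x + a) = cis a * tangent x"
  by (simp add: tangent_eq_cis cis_mult add.commute)

lemma X0_shift_has_derivative: "((\<lambda>x. X0 (x + a)) has_vector_derivative r0 (x + a) *\<^sub>R tangent (x + a)) (at x)"
proof -
  have "((\<lambda>x. x + a) has_vector_derivative 1) (at x)" by (auto intro!: derivative_eq_intros)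
  from vector_diff_chain_at[OF this X0_has_derivative] show ?thesis by (simp add: o_def)
qed

text \<open>Differentiating the symmetry shows that \<open>r0\<close> has period \<open>a\<close>
  and so coincides with its mean over the rotations. Then Z' = c_inf T, and since N' = - T, the
  point Z + c_inf N is fixed: it is the centre.\<close>

lemma k_symmetric_imp_circle:
  assumes "k_symmetric k m X0" shows "multiple_circle m Z"
proof -
  obtain C where C: "\<And>x. X0 (x + a) = C + cis a * (X0 x - C)"
    using assms by (auto simp: k_symmetric_def a_def)
  have r: "r0 (x + a) = r0 x" for x
  proof -
    have "((\<lambda>x. C + cis a * (X0 x - C)) has_vector_derivative 0 + cis a * (r0 x *\<^sub>R tangent x - 0)) (at x)"
      by (intro has_vector_derivative_add has_vector_derivative_mult_right has_vector_derivative_diff X0_has_derivative has_vector_derivative_const)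
    then have "((\<lambda>x. X0 (x + a)) has_vector_derivative r0 x *\<^sub>R tangent (x + a)) (at x)"
      by (simp add: C tangent_shift)
    from vector_derivative_unique_at[OF this X0_shift_has_derivative]
    have "(r0 x - r0 (x + a)) *\<^sub>R tangent (x + a) = 0" by (simp add: scaleR_left_diff_distrib)
    then show ?thesis using norm_tangent[of "x + a"] by (metis eq_iff_diff_eq_0 norm_zero scaleR_eq_0_iff zero_neq_one)
  qed
  have "k_sum k m r0 x = real k * r0 x" for x
    by (rule k_sum_of_periodic) (use r in \<open>simp add: a_def\<close>)
  then have g0: "g_inf x = 0" for x using k_pos by (simp add: g_inf_eq)
  have "((\<lambda>x. Z x + c_inf *\<^sub>R normal x) has_vector_derivative 0) (at x within UNIV)" for x
    using has_vector_derivative_add[OF Z_has_derivative[of x] bounded_linear.has_vector_derivative[OF bounded_linear_scaleR_right[of c_inf] normal_has_derivative[of x]]]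
    by (simp add: g0)
  then obtain C' where "\<And>x. Z x + c_inf *\<^sub>R normal x = C'"
    using has_vector_derivative_zero_constant[of UNIV "\<lambda>x. Z x + c_inf *\<^sub>R normal x"] by auto
  then have "Z x = C' - c_inf *\<^sub>R normal x" for x by (metis add_diff_cancel)
  moreover have "c_inf > 0" using c_inf_pos[of 0] by (simp add: g0)
  ultimately show ?thesis by (auto simp: multiple_circle_def)
qed

text \<open>A constant limiting radius makes \<open>r0\<close> a constant plus its mean over the
  rotations, hence of period \<open>a\<close>. Integrating once, the shifted curve is the rotated
  curve up to a translation \<open>\<delta>\<close>, for which a centre must be found.\<close>

lemma circle_imp_k_symmetric:
  assumes "multiple_circle m Z" shows "k_symmetric k m X0"
proof -
  obtain C \<rho> where C: "\<And>x. x \<in> {0..L} \<Longrightarrow> Z x = C - \<rho> *\<^sub>R normal x"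
    using assms by (auto simp: multiple_circle_def L_def)
  \<comment> \<open>The circle equation is available on one closed period only, so derivatives are
    compared within that interval.\<close>
  have "g_inf x + c_inf = \<rho>" if x: "x \<in> {0..L}" for x
  proof -
    have "((\<lambda>x. C - \<rho> *\<^sub>R normal x) has_vector_derivative 0 - \<rho> *\<^sub>R (- tangent x)) (at x within {0..L})"
      by (intro has_vector_derivative_diff has_vector_derivative_const
          bounded_linear.has_vector_derivative[OF bounded_linear_scaleR_right has_vector_derivative_at_within[OF normal_has_derivative]])
    then have "(Z has_vector_derivative 0 - \<rho> *\<^sub>R (- tangent x)) (at x within {0..L})"
      by (rule has_vector_derivative_transform[OF x, rotated]) (use C in auto)
    from vector_derivative_unique_within_closed_interval[OF L_pos _ this[folded box_real] has_vector_derivative_at_within[OF Z_has_derivative]]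
    have "(g_inf x + c_inf - \<rho>) *\<^sub>R tangent x = 0" using x by (auto simp: scaleR_left_diff_distrib)
    then show ?thesis using norm_tangent[of x] by (metis eq_iff_diff_eq_0 norm_zero scaleR_eq_0_iff zero_neq_one)
  qed
  then have g: "g_inf x = \<rho> - c_inf" for x
    using periodic_representative[OF L_pos, of g_inf x] g_inf_periodic by (metis add_diff_cancel)
  have r: "r0 (x + a) = r0 x" for x
  proof -
    have "r0 y = \<rho> - c_inf + 1 / real k * k_sum k m r0 y" for y using g[of y] by (simp add: g_inf_eq)
    moreover have "k_sum k m r0 (x + a) = k_sum k m r0 x"
      unfolding a_def
    proof (rule k_sum_shift[OF k_pos(2)])
      fix y
      have "r0 (y + L) = r0 y" using r_periodic[of 0 y] by (simp add: r_def g_0 c_0)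
      then show "r0 (y + 2 * real m * pi) = r0 y" by (simp add: L_def)
    qed
    ultimately show ?thesis by metis
  qed
  have "((\<lambda>x. X0 (x + a) - cis a * X0 x) has_vector_derivative 0) (at x within UNIV)" for x
    using has_vector_derivative_diff[OF X0_shift_has_derivative[of x] has_vector_derivative_mult_right[OF X0_has_derivative[of x], of "cis a"]]
    by (simp add: r tangent_shift)
  then obtain \<delta> where "\<And>x. X0 (x + a) - cis a * X0 x = \<delta>"
    using has_vector_derivative_zero_constant[of UNIV "\<lambda>x. X0 (x + a) - cis a * X0 x"] by auto
  then have \<delta>: "X0 (x + a) = \<delta> + cis a * X0 x" for x by (metis diff_add_cancel)
  \<comment> \<open>A centre is a fixed point of z to \<open>\<delta> + cis a * z\<close>. For a
    nontrivial rotation it is found by division; for a trivial one the translation has to be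
    zero.\<close>
  have "\<exists>c. \<delta> = c - cis a * c"
  proof (cases "cis a = 1")
    case True
    \<comment> \<open>The rotation is trivial when \<open>k\<close> divides \<open>m\<close>; then \<open>k\<close> translations by \<open>\<delta>\<close> close up.\<close>
    have "X0 (real j * a) = X0 0 + of_nat j * \<delta>" for j
    proof (induction j)
      case (Suc j)
      then show ?case using \<delta>[of "real j * a"] True by (simp add: algebra_simps)
    qed simp
    from this[of k] have "of_nat k * \<delta> = 0" using X0_periodic[of 0] by (simp add: L_eq)
    then show ?thesis using k_pos by (intro exI[of _ 0]) simp
  next
    case False
    then have "\<delta> = (1 - cis a) * (\<delta> / (1 - cis a))" by simp
    also have "\<dots> = \<delta> / (1 - cis a) - cis a * (\<delta> / (1 - cis a))"
      unfolding left_diff_distrib[of 1] mult_1_left ..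
    finally show ?thesis by blast
  qed
  then obtain c where "\<delta> = c - cis a * c" by blast
  then have "X0 (x + a) = c + cis a * (X0 x - c)" for x by (simp add: \<delta> algebra_simps)
  then show ?thesis unfolding k_symmetric_def a_def by blast
qed

end

lemma (in flow) limit_exists:
  assumes T: "T = \<infinity>"
  shows "converges_smoothly (\<lambda>t. X t \<circ> inv (\<theta> t)) Z"
  unfolding converges_smoothly_def
proof
  fix n
  have "uniform_limit UNIV (\<lambda>t. nderiv n (Y t)) (nderiv n Z) at_top"
    using Y_converges by (simp add: converges_smoothly_def)
  moreover have "\<forall>\<^sub>F t in at_top. \<forall>x\<in>UNIV. nderiv n (Y t) x = nderiv n (X t \<circ> inv (\<theta> t)) x"
    using eventually_ge_at_top[of 0] by eventually_elim (simp add: X_eq_Y T time_dom_infinity)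
  ultimately show "uniform_limit UNIV (\<lambda>t. nderiv n (X t \<circ> inv (\<theta> t))) (nderiv n Z) at_top"
    by (rule uniform_limit_cong[THEN iffD1, rotated -1]) auto
qed

theorem theorem1p1:
  fixes k m :: nat and X0 :: "real \<Rightarrow> complex"
  assumes "k \<ge> 2"
    and "smooth X0"
    and "locally_convex_curve (2 * real m * pi) X0"
    and "rotation_number (2 * real m * pi) X0 = real m"
    and "by_tangent_angle X0"
  shows "(\<exists>X \<theta>. flow_solution k m X0 \<infinity> X \<theta>)
    \<and> (\<forall>T X \<theta>. flow_solution k m X0 T X \<theta> \<longrightarrow>
         (\<forall>t\<in>time_dom T. locally_convex_curve (2 * real m * pi) (X t)
            \<and> elastic_energy (2 * real m * pi) (X t) = elastic_energy (2 * real m * pi) X0))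
    \<and> (\<forall>X \<theta>. flow_solution k m X0 \<infinity> X \<theta> \<longrightarrow>
         (\<exists>Z. converges_smoothly (\<lambda>t. X t \<circ> inv (\<theta> t)) Z
            \<and> smooth Z
            \<and> locally_convex_curve (2 * real m * pi) Z
            \<and> by_tangent_angle Z
            \<and> constant_width k m Z
            \<and> (multiple_circle m Z \<longleftrightarrow> k_symmetric k m X0)))"
proof -
  interpret initial_curve k m X0 using assms by unfold_locales
  show ?thesis
  proof (intro conjI allI impI ballI)
    show "\<exists>X \<theta>. flow_solution k m X0 \<infinity> X \<theta>" by (rule flow_exists)
  next
    fix T X \<theta> t assume s: "flow_solution k m X0 T X \<theta>" and t: "t \<in> time_dom T"
    interpret flow k m X0 T X \<theta> using s by unfold_locales
    show "locally_convex_curve (2 * real m * pi) (X t)" by (rule locally_convex_X[OF t])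
    show "elastic_energy (2 * real m * pi) (X t) = elastic_energy (2 * real m * pi) X0"
      using elastic_energy_eq[OF t] elastic_energy_eq[OF D_0] by (simp add: X_0)
  next
    fix X \<theta> assume s: "flow_solution k m X0 \<infinity> X \<theta>"
    interpret flow k m X0 \<infinity> X \<theta> using s by unfold_locales
    show "\<exists>Z. converges_smoothly (\<lambda>t. X t \<circ> inv (\<theta> t)) Z \<and> smooth Z
        \<and> locally_convex_curve (2 * real m * pi) Z \<and> by_tangent_angle Z \<and> constant_width k m Z
        \<and> (multiple_circle m Z \<longleftrightarrow> k_symmetric k m X0)"
      using limit_exists[OF refl] smooth_Z locally_convex_Z by_tangent_angle_Z constant_width_Z
        k_symmetric_imp_circle circle_imp_k_symmetric by blast
  qed
qed

end
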